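(* Let $(q_n),(r_n)$ be complex sequences vanishing faster than any negative power of $|n|$ as $n\to\pm\infty$ with $1-q_nr_n\neq0$ and $1+q_nr_{n+1}\ne0$ for all $n$, let $u_n,v_n,p_n,s_n$ be as in the context, and let $\mathscr K_{nm}^{(u,v)},\bar{\mathscr K}_{nm}^{(p,s)},G_n^{(u,v)},\bar G_n^{(u,v)},G_n^{(p,s)},\bar G_n^{(p,s)}$ be as in the context. Then for all $m>n$, $$\mathscr K_{nm}^{(u,v)}+\bar G_{n+m}^{(u,v)}+\sum_{l=n+1}^\infty\sum_{j=n+1}^\infty\big(\mathscr K_{n(j+1)}^{(u,v)}-\mathscr K_{nj}^{(u,v)}\big)G_{j+l}^{(u,v)}\big(\bar G_{l+m}^{(u,v)}-\bar G_{l+m-1}^{(u,v)}\big)=0,$$ $$\bar{\mathscr K}_{nm}^{(p,s)}+G_{n+m}^{(p,s)}+\sum_{l=n+1}^\infty\sum_{j=n+1}^\infty\big(\bar{\mathscr K}_{n(j+1)}^{(p,s)}-\bar{\mathscr K}_{nj}^{(p,s)}\big)\bar G_{j+l}^{(p,s)}\big(G_{l+m}^{(p,s)}-G_{l+m-1}^{(p,s)}\big)=0.$$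
   Context: With $D_n=\prod_{j\le n}(1-q_jr_j)$, $E_n=\prod_{j\le n}(1+q_jr_{j+1})$: $u_n=q_nE_{n-1}/D_n$, $v_n=(-r_n+r_{n+1}-q_nr_nr_{n+1})D_{n-1}/E_n$, $p_n=(q_n-q_{n+1}-q_nq_{n+1}r_{n+1})E_{n-1}/D_{n+1}$, $s_n=r_{n+1}D_n/E_n$. For potentials $(a,b)\in\{(u,v),(p,s)\}$ consider $\begin{bmatrix}\xi_n\\ \eta_n\end{bmatrix}=\begin{bmatrix} z & z a_n\\ z^{-1}b_n & z^{-1}\end{bmatrix}\begin{bmatrix}\xi_{n+1}\\ \eta_{n+1}\end{bmatrix}$. For $|z|=1$ its Jost solutions (overbars not complex conjugation) are $\psi_n=\begin{bmatrix}o(1)\\ z^n[1+o(1)]\end{bmatrix}$, $\bar\psi_n=\begin{bmatrix}z^{-n}[1+o(1)]\\ o(1)\end{bmatrix}$ ($n\to+\infty$), $\phi_n=\begin{bmatrix}z^{-n}[1+o(1)]\\ o(1)\end{bmatrix}$, $\bar\phi_n=\begin{bmatrix}o(1)\\ z^{n}[1+o(1)]\end{bmatrix}$ ($n\to-\infty$); right scattering coefficients via $\phi_n=\begin{bmatrix}(1/T_{\rm r})z^{-n}[1+o(1)]\\ (R/T_{\rm r})z^{n}[1+o(1)]\end{bmatrix}$, $\bar\phi_n=\begin{bmatrix}(\bar R/\bar T_{\rm r})z^{-n}[1+o(1)]\\ (1/\bar T_{\rm r})z^{n}[1+o(1)]\end{bmatrix}$ ($n\to+\infty$). $K_{nm}:=\frac1{2\pi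 i}\oint\psi_nz^{-m-1}dz$, $\bar K_{nm}:=\frac1{2\pi i}\oint\bar\psi_nz^{m-1}dz$ (counterclockwise over the unit circle). Bound states: poles $\pm z_j$ ($1\le j\le N$, multiplicity $m_j$) of $T_{\rm r}$ in $0<|z|<1$ and $\pm\bar z_j$ ($1\le j\le\bar N$, multiplicity $\bar m_j$) of $\bar T_{\rm r}$ in $|z|>1$; residues $t_{jk}$ from $T_{\rm r}=\sum_{k=1}^{m_j}t_{jk}(z-z_j)^{-k}+O(1)$, $\bar t_{jk}$ analogously; dependency constants $\gamma_{jk}$ from $\frac{d^k\phi_n(z_j)}{dz^k}=\sum_{l=0}^k\binom kl\gamma_{j(k-l)}\frac{d^l\psi_n(z_j)}{dz^l}$ ($0\le k\le m_j-1$, all $n$), $\bar\gamma_{jk}$ analogously; norming constants $c_{jk}=-2\sum_{l=0}^{m_j-1-k}t_{j(k+1+l)}\gamma_{jl}/l!$, $\bar c_{jk}=2\sum_{l=0}^{\bar m_j-1-k}\bar t_{j(k+1+l)}\bar\gamma_{jl}/l!$. $A=\mathrm{diag}(A_1,\dots,A_N)$ with $A_j$ the $m_j\times m_j$ Jordan block with eigenvalue $z_j$, $B$ the stacked column of $B_j=\begin{bmatrix}0&\cdots&0&1\end{bmatrix}^T$, $C=\begin{bmatrix}C_1&\cdots&C_N\end{bmatrix}$ with $C_j=\begin{bmatrix}c_{j(m_j-1)}&\cdots&c_{j0}\end{bmatrix}$; $(\bar A,\bar B,\bar C)$ analogously. $\hat R_k=\frac1{2\pi i}\oint Rz^{k-1}dz$,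 $\hat{\bar R}_k=\frac1{2\pi i}\oint\bar Rz^{-k-1}dz$; $\Omega_k=\hat R_k+CA^{k-1}B$, $\bar\Omega_k=\hat{\bar R}_k+\bar C(\bar A)^{-k-1}\bar B$ for $k$ even, and $\Omega_k=\bar\Omega_k=0$ for $k$ odd. All these quantities carry the superscript of the potential pair. Finally $G_n:=\sum_{j\ge n}\Omega_j$, $\bar G_n:=\sum_{j\ge n}\bar\Omega_j$ (for each pair), and with $[\cdot]_1,[\cdot]_2$ the components of column vectors, $$\mathscr K_{nm}^{(u,v)}:=\frac{\sum_{l=m}^\infty[K_{nl}^{(u,v)}]_1}{\sum_{l=n}^\infty[\bar K_{nl}^{(u,v)}]_1},\qquad \bar{\mathscr K}_{nm}^{(p,s)}:=\frac{\sum_{l=m}^\infty[\bar K_{nl}^{(p,s)}]_2}{\sum_{l=n}^\infty[K_{nl}^{(p,s)}]_2},\qquad m\ge n.$$ *)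

theory Defs
  imports "HOL-Complex_Analysis.Complex_Analysis"
          "Jordan_Normal_Form.Jordan_Normal_Form"
          "Jordan_Normal_Form.Gauss_Jordan_Elimination"
begin

text \<open>Infinite products over j \<le> n, written as products over i with j = n - i.\<close>

definition Dp :: "(int \<Rightarrow> complex) \<Rightarrow> (int \<Rightarrow> complex) \<Rightarrow> int \<Rightarrow> complex" where
  "Dp q r n = (\<Prod>i. 1 - q (n - int i) * r (n - int i))"

definition Ep :: "(int \<Rightarrow> complex) \<Rightarrow> (int \<Rightarrow> complex) \<Rightarrow> int \<Rightarrow> complex" where
  "Ep q r n = (\<Prod>i. 1 + q (n - int i) * r (n - int i + 1))"

definition pot_u :: "(int \<Rightarrow> complex) \<Rightarrow> (int \<Rightarrow> complex) \<Rightarrow> int \<Rightarrow> complex" where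
  "pot_u q r n = q n * Ep q r (n - 1) / Dp q r n"

definition pot_v :: "(int \<Rightarrow> complex) \<Rightarrow> (int \<Rightarrow> complex) \<Rightarrow> int \<Rightarrow> complex" where
  "pot_v q r n = (- r n + r (n + 1) - q n * r n * r (n + 1)) * Dp q r (n - 1) / Ep q r n"

definition pot_p :: "(int \<Rightarrow> complex) \<Rightarrow> (int \<Rightarrow> complex) \<Rightarrow> int \<Rightarrow> complex" where
  "pot_p q r n = (q n - q (n + 1) - q n * q (n + 1) * r (n + 1)) * Ep q r (n - 1) / Dp q r (n + 1)"

definition pot_s :: "(int \<Rightarrow> complex) \<Rightarrow> (int \<Rightarrow> complex) \<Rightarrow> int \<Rightarrow> complex" where
  "pot_s q r n = r (n + 1) * Dp q r n / Ep q r n"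

text \<open>Solutions of [xi_n; eta_n] = [z, z a_n; b_n/z, 1/z] [xi_(n+1); eta_(n+1)] at the spectral
  parameter z.  Vectors are represented as pairs (first component, second component).\<close>

definition is_sol :: "(int \<Rightarrow> complex) \<Rightarrow> (int \<Rightarrow> complex) \<Rightarrow> (int \<Rightarrow> complex \<Rightarrow> complex \<times> complex) \<Rightarrow> complex \<Rightarrow> bool" where
  "is_sol a b Y z \<longleftrightarrow> (\<forall>n. Y n z =
      (z * fst (Y (n + 1) z) + z * a n * snd (Y (n + 1) z),
       b n * fst (Y (n + 1) z) / z + snd (Y (n + 1) z) / z))"

text \<open>Closed punctured unit disk (where psi and phi live, analytic inside) and closed exterior
  (where psi-bar and phi-bar live, analytic outside).\<close>

definition DI :: "complex set" where "DI = cball 0 1 - {0}"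
definition DO :: "complex set" where "DO = {z. 1 \<le> norm z}"

definition ext_in :: "(int \<Rightarrow> complex \<Rightarrow> complex \<times> complex) \<Rightarrow> bool" where
  "ext_in Y \<longleftrightarrow> (\<forall>n. (\<lambda>z. fst (Y n z)) holomorphic_on (ball 0 1 - {0})
        \<and> (\<lambda>z. snd (Y n z)) holomorphic_on (ball 0 1 - {0})
        \<and> continuous_on DI (Y n) \<and> (\<forall>z. z \<notin> DI \<longrightarrow> Y n z = (0, 0)))"

definition ext_out :: "(int \<Rightarrow> complex \<Rightarrow> complex \<times> complex) \<Rightarrow> bool" where
  "ext_out Y \<longleftrightarrow> (\<forall>n. (\<lambda>z. fst (Y n z)) holomorphic_on {z. 1 < norm z}
        \<and> (\<lambda>z. snd (Y n z)) holomorphic_on {z. 1 < norm z}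
        \<and> continuous_on DO (Y n) \<and> (\<forall>z. z \<notin> DO \<longrightarrow> Y n z = (0, 0)))"

definition jost_psi :: "(int \<Rightarrow> complex) \<Rightarrow> (int \<Rightarrow> complex) \<Rightarrow> int \<Rightarrow> complex \<Rightarrow> complex \<times> complex" where
  "jost_psi a b = (THE Y. ext_in Y \<and> (\<forall>z\<in>DI. is_sol a b Y z) \<and>
     (\<forall>z. norm z = 1 \<longrightarrow> ((\<lambda>n. fst (Y n z)) \<longlongrightarrow> 0) at_top
                      \<and> ((\<lambda>n. snd (Y n z) / z powi n) \<longlongrightarrow> 1) at_top))"

definition jost_psib :: "(int \<Rightarrow> complex) \<Rightarrow> (int \<Rightarrow> complex) \<Rightarrow> int \<Rightarrow> complex \<Rightarrow> complex \<times> complex" where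
  "jost_psib a b = (THE Y. ext_out Y \<and> (\<forall>z\<in>DO. is_sol a b Y z) \<and>
     (\<forall>z. norm z = 1 \<longrightarrow> ((\<lambda>n. fst (Y n z) * z powi n) \<longlongrightarrow> 1) at_top
                      \<and> ((\<lambda>n. snd (Y n z)) \<longlongrightarrow> 0) at_top))"

definition jost_phi :: "(int \<Rightarrow> complex) \<Rightarrow> (int \<Rightarrow> complex) \<Rightarrow> int \<Rightarrow> complex \<Rightarrow> complex \<times> complex" where
  "jost_phi a b = (THE Y. ext_in Y \<and> (\<forall>z\<in>DI. is_sol a b Y z) \<and>
     (\<forall>z. norm z = 1 \<longrightarrow> ((\<lambda>n. fst (Y n z) * z powi n) \<longlongrightarrow> 1) at_bot
                      \<and> ((\<lambda>n. snd (Y n z)) \<longlongrightarrow> 0) at_bot))"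

definition jost_phib :: "(int \<Rightarrow> complex) \<Rightarrow> (int \<Rightarrow> complex) \<Rightarrow> int \<Rightarrow> complex \<Rightarrow> complex \<times> complex" where
  "jost_phib a b = (THE Y. ext_out Y \<and> (\<forall>z\<in>DO. is_sol a b Y z) \<and>
     (\<forall>z. norm z = 1 \<longrightarrow> ((\<lambda>n. fst (Y n z)) \<longlongrightarrow> 0) at_bot
                      \<and> ((\<lambda>n. snd (Y n z) / z powi n) \<longlongrightarrow> 1) at_bot))"

text \<open>phi_n = [(1/T_r) z^(-n)(1+o(1)); (R/T_r) z^n (1+o(1))] as n \<rightarrow> +\<infinity>.\<close>
definition inv_Tr :: "(int \<Rightarrow> complex) \<Rightarrow> (int \<Rightarrow> complex) \<Rightarrow> complex \<Rightarrow> complex" where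
  "inv_Tr a b z = Lim at_top (\<lambda>n. fst (jost_phi a b n z) * z powi n)"

definition Tr :: "(int \<Rightarrow> complex) \<Rightarrow> (int \<Rightarrow> complex) \<Rightarrow> complex \<Rightarrow> complex" where
  "Tr a b z = 1 / inv_Tr a b z"

definition Rr :: "(int \<Rightarrow> complex) \<Rightarrow> (int \<Rightarrow> complex) \<Rightarrow> complex \<Rightarrow> complex" where
  "Rr a b z = Lim at_top (\<lambda>n. snd (jost_phi a b n z) / z powi n) * Tr a b z"

text \<open>phi-bar_n = [(Rbar/Tbar_r) z^(-n)(1+o(1)); (1/Tbar_r) z^n (1+o(1))] as n \<rightarrow> +\<infinity>.\<close>
definition inv_Trb :: "(int \<Rightarrow> complex) \<Rightarrow> (int \<Rightarrow> complex) \<Rightarrow> complex \<Rightarrow> complex" where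
  "inv_Trb a b z = Lim at_top (\<lambda>n. snd (jost_phib a b n z) / z powi n)"

definition Trb :: "(int \<Rightarrow> complex) \<Rightarrow> (int \<Rightarrow> complex) \<Rightarrow> complex \<Rightarrow> complex" where
  "Trb a b z = 1 / inv_Trb a b z"

definition Rrb :: "(int \<Rightarrow> complex) \<Rightarrow> (int \<Rightarrow> complex) \<Rightarrow> complex \<Rightarrow> complex" where
  "Rrb a b z = Lim at_top (\<lambda>n. fst (jost_phib a b n z) * z powi n) * Trb a b z"

text \<open>1/T_r extends holomorphically to |z|<1, continuously up to |z| = 1;
  the extension of T_r is its reciprocal (meromorphic in |z|<1).\<close>
definition inv_Tr_ext :: "(int \<Rightarrow> complex) \<Rightarrow> (int \<Rightarrow> complex) \<Rightarrow> complex \<Rightarrow> complex" where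
  "inv_Tr_ext a b = (THE g. g holomorphic_on ball 0 1 \<and> continuous_on (cball 0 1) g
      \<and> (\<forall>z. norm z = 1 \<longrightarrow> g z = inv_Tr a b z) \<and> (\<forall>z. 1 < norm z \<longrightarrow> g z = 0))"

definition Tr_ext :: "(int \<Rightarrow> complex) \<Rightarrow> (int \<Rightarrow> complex) \<Rightarrow> complex \<Rightarrow> complex" where
  "Tr_ext a b z = 1 / inv_Tr_ext a b z"

definition inv_Trb_ext :: "(int \<Rightarrow> complex) \<Rightarrow> (int \<Rightarrow> complex) \<Rightarrow> complex \<Rightarrow> complex" where
  "inv_Trb_ext a b = (THE g. g holomorphic_on {z. 1 < norm z} \<and> continuous_on DO g
      \<and> (\<forall>z. norm z = 1 \<longrightarrow> g z = inv_Trb a b z) \<and> (\<forall>z. norm z < 1 \<longrightarrow> g z = 0))"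

definition Trb_ext :: "(int \<Rightarrow> complex) \<Rightarrow> (int \<Rightarrow> complex) \<Rightarrow> complex \<Rightarrow> complex" where
  "Trb_ext a b z = 1 / inv_Trb_ext a b z"

definition poles :: "(int \<Rightarrow> complex) \<Rightarrow> (int \<Rightarrow> complex) \<Rightarrow> complex set" where
  "poles a b = {z. 0 < norm z \<and> norm z < 1 \<and> is_pole (Tr_ext a b) z}"

definition polesb :: "(int \<Rightarrow> complex) \<Rightarrow> (int \<Rightarrow> complex) \<Rightarrow> complex set" where
  "polesb a b = {z. 1 < norm z \<and> is_pole (Trb_ext a b) z}"

definition reps :: "complex set \<Rightarrow> complex set" where
  "reps S = (SOME P. P \<subseteq> S \<and> S = P \<union> uminus ` P \<and> P \<inter> uminus ` P = {})"

definition mult :: "(complex \<Rightarrow> complex) \<Rightarrow> complex \<Rightarrow> nat" where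
  "mult T z = nat (- zorder T z)"

text \<open>Laurent coefficients: T = \<Sum>k=1..m t_k (w-z)^(-k) + O(1) near z.\<close>
definition tres :: "(complex \<Rightarrow> complex) \<Rightarrow> complex \<Rightarrow> nat \<Rightarrow> complex" where
  "tres T z k = residue (\<lambda>w. (w - z) ^ (k - 1) * T w) z"

definition dep :: "(int \<Rightarrow> complex \<Rightarrow> complex \<times> complex) \<Rightarrow> (int \<Rightarrow> complex \<Rightarrow> complex \<times> complex)
                   \<Rightarrow> nat \<Rightarrow> complex \<Rightarrow> nat \<Rightarrow> complex" where
  "dep Phi Psi m z = (THE g. (\<forall>k\<ge>m. g k = 0) \<and> (\<forall>k<m. \<forall>n.
      (deriv ^^ k) (\<lambda>w. fst (Phi n w)) z
        = (\<Sum>l\<le>k. of_nat (k choose l) * g (k - l) * (deriv ^^ l) (\<lambda>w. fst (Psi n w)) z)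
    \<and> (deriv ^^ k) (\<lambda>w. snd (Phi n w)) z
        = (\<Sum>l\<le>k. of_nat (k choose l) * g (k - l) * (deriv ^^ l) (\<lambda>w. snd (Psi n w)) z)))"

definition cnorm :: "(int \<Rightarrow> complex) \<Rightarrow> (int \<Rightarrow> complex) \<Rightarrow> complex \<Rightarrow> nat \<Rightarrow> complex" where
  "cnorm a b z k = (let T = Tr_ext a b; m = mult T z;
      g = dep (jost_phi a b) (jost_psi a b) m z in
      - 2 * (\<Sum>l\<in>{0..m - 1 - k}. tres T z (k + 1 + l) * g l / fact l))"

definition cnormb :: "(int \<Rightarrow> complex) \<Rightarrow> (int \<Rightarrow> complex) \<Rightarrow> complex \<Rightarrow> nat \<Rightarrow> complex" where
  "cnormb a b z k = (let T = Trb_ext a b; m = mult T z;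
      g = dep (jost_phib a b) (jost_psib a b) m z in
      2 * (\<Sum>l\<in>{0..m - 1 - k}. tres T z (k + 1 + l) * g l / fact l))"

definition mat_powi :: "complex mat \<Rightarrow> int \<Rightarrow> complex mat" where
  "mat_powi A t = (if 0 \<le> t then A ^\<^sub>m nat t else (the (mat_inverse A)) ^\<^sub>m nat (- t))"

definition colB :: "nat \<Rightarrow> complex mat" where
  "colB m = mat m 1 (\<lambda>(i, j). if i = m - 1 then 1 else 0)"

definition rowC :: "nat \<Rightarrow> (nat \<Rightarrow> complex) \<Rightarrow> complex mat" where
  "rowC m c = mat 1 m (\<lambda>(i, j). c (m - 1 - j))"

text \<open>C A^t B for the block-diagonal triple (A,B,C): it is the sum over the blocks
  C_j A_j^t B_j, with A_j the Jordan block of size m_j and eigenvalue z_j.\<close>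
definition CAB :: "(int \<Rightarrow> complex) \<Rightarrow> (int \<Rightarrow> complex) \<Rightarrow> int \<Rightarrow> complex" where
  "CAB a b t = (\<Sum>z\<in>reps (poles a b). let m = mult (Tr_ext a b) z in
      (rowC m (cnorm a b z) * mat_powi (jordan_block m z) t * colB m) $$ (0, 0))"

definition CABb :: "(int \<Rightarrow> complex) \<Rightarrow> (int \<Rightarrow> complex) \<Rightarrow> int \<Rightarrow> complex" where
  "CABb a b t = (\<Sum>z\<in>reps (polesb a b). let m = mult (Trb_ext a b) z in
      (rowC m (cnormb a b z) * mat_powi (jordan_block m z) t * colB m) $$ (0, 0))"

definition circ_int :: "(complex \<Rightarrow> complex) \<Rightarrow> complex" where
  "circ_int f = contour_integral (circlepath 0 1) f / (2 * pi * \<i>)"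

definition Rhat :: "(int \<Rightarrow> complex) \<Rightarrow> (int \<Rightarrow> complex) \<Rightarrow> int \<Rightarrow> complex" where
  "Rhat a b k = circ_int (\<lambda>z. Rr a b z * z powi (k - 1))"

definition Rhatb :: "(int \<Rightarrow> complex) \<Rightarrow> (int \<Rightarrow> complex) \<Rightarrow> int \<Rightarrow> complex" where
  "Rhatb a b k = circ_int (\<lambda>z. Rrb a b z * z powi (- k - 1))"

definition Omega :: "(int \<Rightarrow> complex) \<Rightarrow> (int \<Rightarrow> complex) \<Rightarrow> int \<Rightarrow> complex" where
  "Omega a b k = (if even k then Rhat a b k + CAB a b (k - 1) else 0)"

definition Omegab :: "(int \<Rightarrow> complex) \<Rightarrow> (int \<Rightarrow> complex) \<Rightarrow> int \<Rightarrow> complex" where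
  "Omegab a b k = (if even k then Rhatb a b k + CABb a b (- k - 1) else 0)"

definition GG :: "(int \<Rightarrow> complex) \<Rightarrow> (int \<Rightarrow> complex) \<Rightarrow> int \<Rightarrow> complex" where
  "GG a b n = (\<Sum>i. Omega a b (n + int i))"

definition GGb :: "(int \<Rightarrow> complex) \<Rightarrow> (int \<Rightarrow> complex) \<Rightarrow> int \<Rightarrow> complex" where
  "GGb a b n = (\<Sum>i. Omegab a b (n + int i))"

definition KK :: "(int \<Rightarrow> complex) \<Rightarrow> (int \<Rightarrow> complex) \<Rightarrow> int \<Rightarrow> int \<Rightarrow> complex \<times> complex" where
  "KK a b n m = (circ_int (\<lambda>z. fst (jost_psi a b n z) * z powi (- m - 1)),
                 circ_int (\<lambda>z. snd (jost_psi a b n z) * z powi (- m - 1)))"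

definition KKb :: "(int \<Rightarrow> complex) \<Rightarrow> (int \<Rightarrow> complex) \<Rightarrow> int \<Rightarrow> int \<Rightarrow> complex \<times> complex" where
  "KKb a b n m = (circ_int (\<lambda>z. fst (jost_psib a b n z) * z powi (m - 1)),
                  circ_int (\<lambda>z. snd (jost_psib a b n z) * z powi (m - 1)))"

definition scrK :: "(int \<Rightarrow> complex) \<Rightarrow> (int \<Rightarrow> complex) \<Rightarrow> int \<Rightarrow> int \<Rightarrow> complex" where
  "scrK a b n m = (\<Sum>i. fst (KK a b n (m + int i))) / (\<Sum>i. fst (KKb a b n (n + int i)))"

definition scrKb :: "(int \<Rightarrow> complex) \<Rightarrow> (int \<Rightarrow> complex) \<Rightarrow> int \<Rightarrow> int \<Rightarrow> complex" where
  "scrKb a b n m = (\<Sum>i. snd (KKb a b n (m + int i))) / (\<Sum>i. snd (KK a b n (n + int i)))"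

end

theory Submission
  imports Defs
begin

text \<open>
  Let (a, b) be absolutely summable with \<open>1 - a n * b n \<noteq> 0\<close>. Multiplying the scattering relation
  \<open>T * \<phi> n = \<psi>b n + R * \<psi> n\<close> by \<open>z powi (m - 1)\<close> with \<open>m > n\<close> and integrating over the unit circle,
  the left-hand side is a sum of residues at the poles of T, which the dependency constants express
  through \<open>\<psi> n\<close>. The result is the Marchenko equation
  \<open>(\<Sum>l\<ge>n. K n l * Omega (l + m)) = - Kb n m\<close>. The equation for the barred quantities is the same one
  for (b, a), because \<open>z \<mapsto> 1 / z\<close> together with a swap of the components exchanges the two systems.
  The Marchenko equation itself also yields the absolute summability of Omega.

  Summing the first components over m and using Abel summation to eliminate one of the two unknowns
  gives the stated equation, provided that the normalising sum of the first components of \<open>Kb n\<close> is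
  nonzero. This sum is the first component of \<open>\<psi>b n\<close> at \<open>z = 1\<close>, where the systems for (u, v) and
  (p, s) have explicit solutions in terms of the products E and D; nothing else about these potentials
  is used.
\<close>

subsection \<open>Coefficients of the Jost solutions\<close>

text \<open>The obstacle is regularity: R is shown only to be continuous on the circle, which does
  not make its Fourier coefficients summable. Directly, Omega is only seen to be bounded. At a large
  n, however, the Marchenko kernel is the identity plus a perturbation of l1 norm below 1/2, and
  this upgrades boundedness to summability. For a similar reason psi is built from coefficient
  sequences in w = z^2 that are summable in norm: this yields continuity up to the circle, the
  numbers K, and the value at z = 1 as the plain sum of the coefficients. The Jost solutions and the
  extension of 1/T are definite descriptions, so each existence proof has to be matched by
  uniqueness. Asymptotics is prescribed only for |z| = 1, hence uniqueness inside the disc must come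
  from boundary values. Omega is nonzero only at even k, so matrix powers occur with odd exponents,
  for which the poles z and -z contribute equally; this accounts for the factor 2 in the norming
  constants. The restriction m > n removes the singularity at 0 from the contour integral.\<close>

lemma tendsto_at_top_int:
  fixes f :: "int \<Rightarrow> 'a::topological_space"
  assumes "((\<lambda>k::nat. f (n0 + int k)) \<longlonglongrightarrow> L)"
  shows "(f \<longlongrightarrow> L) at_top"
proof -
  have "filterlim (\<lambda>n. nat (n - n0)) at_top at_top"
    unfolding filterlim_at_top
  proof
    fix Z show "eventually (\<lambda>x. Z \<le> nat (x - n0)) at_top"
      using eventually_ge_at_top[of "n0 + int Z"] by eventually_elim auto
  qed
  from filterlim_compose[OF assms this]
  have "((\<lambda>n. f (n0 + int (nat (n - n0)))) \<longlongrightarrow> L) at_top" .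
  moreover have "eventually (\<lambda>n. f (n0 + int (nat (n - n0))) = f n) at_top"
    using eventually_ge_at_top[of n0] by eventually_elim auto
  ultimately show ?thesis by (rule Lim_transform_eventually)
qed

lemma tendsto_at_top_intD:
  fixes f :: "int \<Rightarrow> 'a::topological_space"
  assumes "(f \<longlongrightarrow> L) at_top"
  shows "(\<lambda>k::nat. f (n0 + int k)) \<longlonglongrightarrow> L"
proof -
  have "filterlim (\<lambda>k::nat. n0 + int k) at_top at_top"
    unfolding filterlim_at_top
  proof
    fix Z show "eventually (\<lambda>x. Z \<le> n0 + int x) at_top"
      using eventually_ge_at_top[of "nat (Z - n0)"] by eventually_elim auto
  qed
  from filterlim_compose[OF assms this] show ?thesis .
qed

text \<open>Data are prescribed at +infinity and estimates run towards smaller n. A weighted size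
  that increases with n is bounded by its limit; the Gronwall-type arguments below are closed in
  this way.\<close>

lemma le_lim_at_top_int:
  fixes f :: "int \<Rightarrow> real" and n :: int
  assumes "\<And>n. f n \<le> f (n + 1)" "(f \<longlongrightarrow> L) at_top"
  shows "f n \<le> L"
proof -
  have *: "f n \<le> f (n + int k)" for k
  proof (induction k)
    case (Suc k)
    then show ?case using assms(1)[of "n + int k"] by (simp add: algebra_simps)
  qed simp
  show ?thesis
    using tendsto_at_top_intD[OF assms(2), of n] * by (intro LIMSEQ_le_const) auto
qed

text \<open>Only decay at +infinity enters psi. Decay at -infinity is later expressed by the same
  predicate for reflected sequences.\<close>

definition right_summable :: "(int \<Rightarrow> complex) \<Rightarrow> (int \<Rightarrow> complex) \<Rightarrow> bool" where
  "right_summable a b \<longleftrightarrow> (\<forall>n. summable (\<lambda>i. norm (a (n + int i)))) \<and> (\<forall>n. summable (\<lambda>i. norm (b (n + int i))))"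

text \<open>The Gronwall weight: one step to the left raises it by |a n| + |b n|, the exponent in
  the growth bound for one step of the recursion.\<close>

definition tail_mass :: "(int \<Rightarrow> complex) \<Rightarrow> (int \<Rightarrow> complex) \<Rightarrow> int \<Rightarrow> real" where
  "tail_mass a b n = (\<Sum>i. norm (a (n + int i)) + norm (b (n + int i)))"

lemma right_summable_commute: "right_summable a b \<longleftrightarrow> right_summable b a" unfolding right_summable_def by blast

lemma right_summable_sum: "right_summable a b \<Longrightarrow> summable (\<lambda>i. norm (a (n + int i)) + norm (b (n + int i)))"
  unfolding right_summable_def by (intro summable_add) auto

lemma tail_mass_step:
  assumes "right_summable a b" shows "tail_mass a b n = norm (a n) + norm (b n) + tail_mass a b (n + 1)"
proof -
  have "tail_mass a b n = (\<Sum>i. norm (a (n + int (Suc i))) + norm (b (n + int (Suc i)))) + (norm (a n) + norm (b n))"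
    unfolding tail_mass_def using suminf_split_head[OF right_summable_sum[OF assms, of n]] by simp
  then show ?thesis unfolding tail_mass_def by (simp add: algebra_simps)
qed

lemma tail_mass_nonneg: assumes "right_summable a b" shows "0 \<le> tail_mass a b n"
  unfolding tail_mass_def by (intro suminf_nonneg right_summable_sum assms) auto

lemma tail_mass_antimono:
  assumes "right_summable a b" shows "tail_mass a b (n + int k) \<le> tail_mass a b n"
proof (induction k)
  case (Suc k)
  have "tail_mass a b (n + int k) = norm (a (n + int k)) + norm (b (n + int k)) + tail_mass a b (n + int k + 1)"
    by (rule tail_mass_step[OF assms])
  moreover have "n + int (Suc k) = n + int k + 1" by simp
  ultimately have "tail_mass a b (n + int (Suc k)) \<le> tail_mass a b (n + int k)"
    using norm_ge_zero[of "a (n + int k)"] norm_ge_zero[of "b (n + int k)"] by (simp add: algebra_simps)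
  then show ?case using Suc.IH by simp
qed simp

lemma tail_mass_tendsto: assumes "right_summable a b" shows "(tail_mass a b \<longlongrightarrow> 0) at_top"
proof (rule tendsto_at_top_int[of _ 0])
  let ?f = "\<lambda>i. norm (a (0 + int i)) + norm (b (0 + int i))"
  have "(\<lambda>k. suminf ?f - sum ?f {..<k}) \<longlonglongrightarrow> suminf ?f - suminf ?f"
    by (intro tendsto_intros summable_LIMSEQ right_summable_sum[OF assms])
  moreover have "suminf ?f - sum ?f {..<k} = tail_mass a b (0 + int k)" for k
  proof -
    have "tail_mass a b (0 + int k) = (\<Sum>i. ?f (i + k))" unfolding tail_mass_def by (simp add: algebra_simps)
    then show ?thesis using suminf_minus_initial_segment[OF right_summable_sum[OF assms, of 0], of k] by simp
  qed
  ultimately show "(\<lambda>k. tail_mass a b (0 + int k)) \<longlonglongrightarrow> 0" by simp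
qed

text \<open>The coefficients of \<open>w ^ k\<close> in P and Q, where \<open>\<psi> n = z ^ n * (w * Q n w, P n w)\<close> with \<open>w = z ^ 2\<close>.
  The system becomes \<open>P n = P (n + 1) + w * b n * Q (n + 1)\<close> and
  \<open>Q n = w * Q (n + 1) + a n * P (n + 1)\<close>, normalised by \<open>P \<longrightarrow> 1\<close> and \<open>Q \<longrightarrow> 0\<close>
  as \<open>n \<longrightarrow> \<infinity>\<close>.\<close>

primrec jc :: "(int \<Rightarrow> complex) \<Rightarrow> (int \<Rightarrow> complex) \<Rightarrow> nat \<Rightarrow> int \<Rightarrow> complex \<times> complex" where
  "jc a b 0 = (\<lambda>n. (1, a n))"
| "jc a b (Suc k) = (let p = (\<lambda>n. \<Sum>j. b (n + int j) * snd (jc a b k (n + int j + 1)))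
     in (\<lambda>n. (p n, snd (jc a b k (n + 1)) + a n * p (n + 1))))"

definition jp where "jp a b k n = fst (jc a b k n)"
definition jq where "jq a b k n = snd (jc a b k n)"

lemma jp_0 [simp]: "jp a b 0 n = 1" and jq_0 [simp]: "jq a b 0 n = a n"
  by (simp_all add: jp_def jq_def)

text \<open>A recursion in n would have to start at infinity. Degree k + 1 of P needs only degree k
  of Q, summed over all later n, so the recursion can run over the degree instead.\<close>

lemma jp_Suc_sum: "jp a b (Suc k) n = (\<Sum>j. b (n + int j) * jq a b k (n + int j + 1))"
  and jq_Suc: "jq a b (Suc k) n = jq a b k (n + 1) + a n * jp a b (Suc k) (n + 1)"
  by (simp_all add: jp_def jq_def Let_def)

context fixes a b assumes ab: "right_summable a b" begin

text \<open>One half of an induction on the degree: the hypothesis is the bound on \<open>jq\<close>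
  of the same degree, supplied by the induction in \<open>jq_bound\<close>.\<close>

lemma jp_step_bound:
  assumes "\<And>n. norm (jq a b k n) \<le> tail_mass a b n * (1 + (tail_mass a b n)\<^sup>2) ^ k"
  shows "summable (\<lambda>j. norm (b (n + int j) * jq a b k (n + int j + 1)))"
    and "norm (jp a b (Suc k) n) \<le> tail_mass a b n * (tail_mass a b n * (1 + (tail_mass a b n)\<^sup>2) ^ k)"
proof -
  let ?B = "tail_mass a b n * (1 + (tail_mass a b n)\<^sup>2) ^ k"
  have *: "norm (b (n + int j) * jq a b k (n + int j + 1)) \<le> norm (b (n + int j)) * ?B" for j
  proof -
    have t: "0 \<le> tail_mass a b (n + int j + 1)" "tail_mass a b (n + int j + 1) \<le> tail_mass a b n"
      using tail_mass_nonneg[OF ab] tail_mass_antimono[OF ab, of n "Suc j"] by (auto simp: add.assoc algebra_simps)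
    have "norm (jq a b k (n + int j + 1)) \<le> tail_mass a b (n + int j + 1) * (1 + (tail_mass a b (n + int j + 1))\<^sup>2) ^ k"
      by (rule assms)
    also have "\<dots> \<le> ?B" using t by (intro mult_mono power_mono add_mono) auto
    finally show ?thesis by (simp add: norm_mult mult_left_mono)
  qed
  have sb: "summable (\<lambda>j. norm (b (n + int j)))" using ab by (simp add: right_summable_def)
  have s2: "summable (\<lambda>j. norm (b (n + int j)) * ?B)" by (rule summable_mult2[OF sb])
  show s1: "summable (\<lambda>j. norm (b (n + int j) * jq a b k (n + int j + 1)))"
    by (rule summable_comparison_test'[OF s2, of 0]) (use * in simp)
  have "norm (jp a b (Suc k) n) \<le> (\<Sum>j. norm (b (n + int j) * jq a b k (n + int j + 1)))"
    unfolding jp_Suc_sum by (rule summable_norm[OF s1])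
  also have "\<dots> \<le> (\<Sum>j. norm (b (n + int j)) * ?B)" by (rule suminf_le[OF * s1 s2])
  also have "\<dots> = (\<Sum>j. norm (b (n + int j))) * ?B" by (rule suminf_mult2[OF sb, symmetric])
  also have "\<dots> \<le> tail_mass a b n * ?B"
  proof (rule mult_right_mono)
    show "(\<Sum>j. norm (b (n + int j))) \<le> tail_mass a b n" unfolding tail_mass_def
      by (rule suminf_le) (auto intro: sb right_summable_sum[OF ab])
    show "0 \<le> ?B" using tail_mass_nonneg[OF ab, of n] by auto
  qed
  finally show "norm (jp a b (Suc k) n) \<le> tail_mass a b n * ?B" .
qed

text \<open>Going from degree k to k + 1 passes once through b and once through a, which costs a
  factor 1 + t^2 with t the tail mass. These bounds grow with k and do not help in summing over k;
  they make the series of \<open>jp\<close> converge and each single coefficient tend to 0 as n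
  grows.\<close>

lemma jq_bound: "norm (jq a b k n) \<le> tail_mass a b n * (1 + (tail_mass a b n)\<^sup>2) ^ k"
proof (induction k arbitrary: n)
  case 0
  show ?case using tail_mass_step[OF ab, of n] tail_mass_nonneg[OF ab, of "n+1"] by simp
next
  case (Suc k)
  let ?t = "tail_mass a b n" and ?t' = "tail_mass a b (n + 1)"
  have t: "0 \<le> ?t'" "norm (a n) + ?t' \<le> ?t" "?t' \<le> ?t"
    using tail_mass_step[OF ab, of n] tail_mass_nonneg[OF ab, of "n+1"] by (auto simp: add_nonneg_nonneg)
  have "norm (jq a b (Suc k) n) \<le> norm (jq a b k (n + 1)) + norm (a n) * norm (jp a b (Suc k) (n + 1))"
    unfolding jq_Suc by (metis norm_mult norm_triangle_ineq)
  also have "\<dots> \<le> ?t' * (1 + ?t'\<^sup>2) ^ k + norm (a n) * (?t' * (?t' * (1 + ?t'\<^sup>2) ^ k))"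
    by (intro add_mono mult_left_mono Suc jp_step_bound) auto
  also have "\<dots> \<le> ?t * (1 + ?t\<^sup>2) ^ k + ?t * (?t * (?t * (1 + ?t\<^sup>2) ^ k))"
    using t by (intro add_mono mult_mono power_mono) (auto intro: order_trans[OF _ t(2)])
  also have "\<dots> = ?t * (1 + ?t\<^sup>2) ^ Suc k" by (simp add: algebra_simps power2_eq_square)
  finally show ?case .
qed

lemmas jp_summable = jp_step_bound(1)[OF jq_bound]

lemma jp_bound: "norm (jp a b (Suc k) n) \<le> tail_mass a b n * (tail_mass a b n * (1 + (tail_mass a b n)\<^sup>2) ^ k)"
  by (rule jp_step_bound[OF jq_bound])

lemma jp_Suc: "jp a b (Suc k) n = jp a b (Suc k) (n + 1) + b n * jq a b k (n + 1)"
proof -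
  have "jp a b (Suc k) n = (\<Sum>j. b (n + int (Suc j)) * jq a b k (n + int (Suc j) + 1)) + b n * jq a b k (n + 1)"
    unfolding jp_Suc_sum using suminf_split_head[OF summable_norm_cancel[OF jp_summable[of n k]]] by simp
  also have "(\<Sum>j. b (n + int (Suc j)) * jq a b k (n + int (Suc j) + 1)) = jp a b (Suc k) (n + 1)"
    unfolding jp_Suc_sum by (simp add: algebra_simps)
  finally show ?thesis .
qed

lemma jq_tendsto: "(jq a b k \<longlongrightarrow> 0) at_top"
proof (rule Lim_null_comparison)
  show "eventually (\<lambda>n. norm (jq a b k n) \<le> tail_mass a b n * (1 + (tail_mass a b n)\<^sup>2) ^ k) at_top"
    by (simp add: jq_bound)
  have "((\<lambda>n. tail_mass a b n * (1 + (tail_mass a b n)\<^sup>2) ^ k) \<longlongrightarrow> 0 * (1 + 0\<^sup>2) ^ k) at_top"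
    by (intro tendsto_intros tail_mass_tendsto[OF ab])
  then show "((\<lambda>n. tail_mass a b n * (1 + (tail_mass a b n)\<^sup>2) ^ k) \<longlongrightarrow> 0) at_top" by simp
qed

lemma jp_tendsto: "(jp a b (Suc k) \<longlongrightarrow> 0) at_top"
proof (rule Lim_null_comparison)
  show "eventually (\<lambda>n. norm (jp a b (Suc k) n) \<le> tail_mass a b n * (tail_mass a b n * (1 + (tail_mass a b n)\<^sup>2) ^ k)) at_top"
    by (simp add: jp_bound)
  have "((\<lambda>n. tail_mass a b n * (tail_mass a b n * (1 + (tail_mass a b n)\<^sup>2) ^ k)) \<longlongrightarrow> 0 * (0 * (1 + 0\<^sup>2) ^ k)) at_top"
    by (intro tendsto_intros tail_mass_tendsto[OF ab])
  then show "((\<lambda>n. tail_mass a b n * (tail_mass a b n * (1 + (tail_mass a b n)\<^sup>2) ^ k)) \<longlongrightarrow> 0) at_top" by simp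
qed

text \<open>The partial norms times \<open>exp (- tail_mass a b n)\<close> increase with n and tend to 1.\<close>

lemma jc_sum_le:
  "(\<Sum>k\<le>K. norm (jp a b k n)) + (\<Sum>k\<le>K. norm (jq a b k n)) \<le> exp (tail_mass a b n)"
proof -
  let ?p = "\<lambda>K n. \<Sum>k\<le>K. norm (jp a b k n)" and ?q = "\<lambda>K n. \<Sum>k\<le>K. norm (jq a b k n)"
  \<comment> \<open>Degree K of P draws only on degrees below K of Q, and the shift in Q loses its
    top degree. The subtracted terms record this truncation; they have the favourable sign and are
    dropped in the bound for \<open>S\<close>.\<close>
  have p: "?p K n \<le> ?p K (n + 1) + norm (b n) * ?q K (n + 1) - norm (b n) * norm (jq a b K (n + 1))" for n
  proof (induction K)
    case (Suc K)
    have "norm (jp a b (Suc K) n) \<le> norm (jp a b (Suc K) (n + 1)) + norm (b n) * norm (jq a b K (n + 1))"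
      unfolding jp_Suc[of K n] by (metis norm_mult norm_triangle_ineq)
    with Suc show ?case by (simp add: algebra_simps)
  qed simp
  have q: "?q K n \<le> ?q K (n + 1) - norm (jq a b K (n + 1)) + norm (a n) * ?p K (n + 1)" for n
  proof (induction K)
    case (Suc K)
    have "norm (jq a b (Suc K) n) \<le> norm (jq a b K (n + 1)) + norm (a n) * norm (jp a b (Suc K) (n + 1))"
      unfolding jq_Suc by (metis norm_mult norm_triangle_ineq)
    with Suc show ?case by (simp add: algebra_simps)
  qed simp
  define S where "S = (\<lambda>n. ?p K n + ?q K n)"
  have S0: "0 \<le> S n" for n unfolding S_def by (auto intro!: add_nonneg_nonneg sum_nonneg)
  have S: "S n \<le> exp (norm (a n) + norm (b n)) * S (n + 1)" for n
  proof -
    have "S n \<le> S (n + 1) + norm (b n) * ?q K (n + 1) + norm (a n) * ?p K (n + 1)"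
      unfolding S_def using p[of n] q[of n] norm_ge_zero[of "jq a b K (n+1)"]
        mult_nonneg_nonneg[OF norm_ge_zero[of "b n"] norm_ge_zero[of "jq a b K (n+1)"]] by linarith
    also have "\<dots> \<le> S (n + 1) + norm (b n) * S (n + 1) + norm (a n) * S (n + 1)"
      by (intro add_mono mult_left_mono) (auto simp: S_def intro!: sum_nonneg)
    also have "\<dots> = (1 + (norm (a n) + norm (b n))) * S (n + 1)" by (simp add: algebra_simps)
    also have "\<dots> \<le> exp (norm (a n) + norm (b n)) * S (n + 1)"
      by (intro mult_right_mono S0 exp_ge_add_one_self)
    finally show ?thesis .
  qed
  have inc: "exp (- tail_mass a b n) * S n \<le> exp (- tail_mass a b (n + 1)) * S (n + 1)" for n
  proof -
    have "exp (- tail_mass a b n) * S n \<le> exp (- tail_mass a b n) * (exp (norm (a n) + norm (b n)) * S (n + 1))"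
      by (intro mult_left_mono S) simp
    also have "\<dots> = exp (- tail_mass a b (n + 1)) * S (n + 1)"
      by (subst tail_mass_step[OF ab, of n]) (simp add: exp_add[symmetric] mult.assoc[symmetric])
    finally show ?thesis .
  qed
  have "((\<lambda>n. S n) \<longlongrightarrow> (\<Sum>k\<le>K. if k = 0 then 1 else 0) + (\<Sum>k\<le>K. 0)) at_top"
    unfolding S_def
  proof (intro tendsto_add tendsto_sum)
    fix k show "((\<lambda>n. norm (jp a b k n)) \<longlongrightarrow> (if k = 0 then 1 else 0)) at_top"
      by (cases k) (auto intro!: tendsto_norm_zero jp_tendsto)
    show "((\<lambda>n. norm (jq a b k n)) \<longlongrightarrow> 0) at_top" by (intro tendsto_norm_zero jq_tendsto)
  qed
  then have "(S \<longlongrightarrow> 1) at_top" by (simp add: sum.delta)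
  then have "((\<lambda>n. exp (- tail_mass a b n) * S n) \<longlongrightarrow> exp (- 0) * 1) at_top"
    by (intro tendsto_intros tail_mass_tendsto[OF ab])
  from le_lim_at_top_int[OF inc this] have "exp (- tail_mass a b n) * S n \<le> 1" by simp
  then have "S n \<le> exp (tail_mass a b n)" by (simp add: exp_minus field_simps)
  then show ?thesis by (simp add: S_def)
qed

lemma jp_norm_summable: "summable (\<lambda>k. norm (jp a b k n))"
  and jq_norm_summable: "summable (\<lambda>k. norm (jq a b k n))"
  and jc_suminf_le: "(\<Sum>k. norm (jp a b k n)) + (\<Sum>k. norm (jq a b k n)) \<le> exp (tail_mass a b n)"
proof -
  have q: "0 \<le> (\<Sum>k\<le>K. norm (jq a b k n))" and p: "0 \<le> (\<Sum>k\<le>K. norm (jp a b k n))" for K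
    by (auto intro: sum_nonneg)
  have "(\<Sum>k\<le>K. norm (jp a b k n)) \<le> exp (tail_mass a b n)" for K
    using jc_sum_le[where n = n and K = K] q[of K] by linarith
  then show s1: "summable (\<lambda>k. norm (jp a b k n))"
    by (intro bounded_imp_summable) auto
  have "(\<Sum>k\<le>K. norm (jq a b k n)) \<le> exp (tail_mass a b n)" for K
    using jc_sum_le[where n = n and K = K] p[of K] by linarith
  then show s2: "summable (\<lambda>k. norm (jq a b k n))"
    by (intro bounded_imp_summable) auto
  have "(\<lambda>K. (\<Sum>k\<le>K. norm (jp a b k n)) + (\<Sum>k\<le>K. norm (jq a b k n)))
     \<longlonglongrightarrow> (\<Sum>k. norm (jp a b k n)) + (\<Sum>k. norm (jq a b k n))"
    by (intro tendsto_add summable_LIMSEQ' s1 s2)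
  then show "(\<Sum>k. norm (jp a b k n)) + (\<Sum>k. norm (jq a b k n)) \<le> exp (tail_mass a b n)"
    using jc_sum_le by (intro LIMSEQ_le_const2) auto
qed

text \<open>Removing the constant coefficient 1 of P leaves a bound that tends to 0 as n grows. It
  is uniform in |w| <= 1 and gives the asymptotics of psi.\<close>

lemma jc_rest_le: "(\<Sum>k. norm (jp a b (Suc k) n)) + (\<Sum>k. norm (jq a b k n)) \<le> exp (tail_mass a b n) - 1"
  using jc_suminf_le[of n] suminf_split_head[OF jp_norm_summable[of n]] by simp

end

subsection \<open>The Jost solutions\<close>

text \<open>In the coordinate \<open>- \<i> * Ln z\<close> the unit circle is the real line, and the extension of f by 0
  is holomorphic across it.\<close>

lemma boundary_vanish:
  fixes f :: "complex \<Rightarrow> complex"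
  assumes hol: "f holomorphic_on (ball 0 1 - {0})" and cont: "continuous_on DI f"
    and z: "\<And>z. norm z = 1 \<Longrightarrow> f z = 0" and zD: "z \<in> DI"
  shows "f z = 0"
proof -
  define g where "g w = (if 0 \<le> Im w then f (exp (\<i> * w)) else 0)" for w
  have n: "norm (exp (\<i> * w)) = exp (- Im w)" for w by (simp add: norm_exp_eq_Re)
  have c1: "continuous_on {w. 0 \<le> Im w} (\<lambda>w. f (exp (\<i> * w)))"
    by (rule continuous_on_compose2[OF cont]) (auto intro!: continuous_intros simp: DI_def n)
  have "continuous_on ({w. 0 \<le> Im w} \<union> {w. Im w \<le> 0}) g"
    unfolding g_def
    by (rule continuous_on_cases)
      (auto intro!: closed_halfspace_Im_ge closed_halfspace_Im_le c1 z simp: n)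
  moreover have "{w. 0 \<le> Im w} \<union> {w. Im w \<le> 0} = UNIV" by auto
  ultimately have cg: "continuous_on UNIV g" by simp
  have h1: "g holomorphic_on (UNIV \<inter> {z. \<i> \<bullet> z < 0})"
    by (rule holomorphic_transform[of "\<lambda>_. 0"]) (auto simp: g_def)
  have "(f \<circ> (\<lambda>w. exp (\<i> * w))) holomorphic_on {w. 0 < Im w}"
    by (rule holomorphic_on_compose_gen[OF _ hol]) (auto intro!: holomorphic_intros simp: n)
  then have "g holomorphic_on {w. 0 < Im w}"
    by (rule holomorphic_transform) (auto simp: g_def)
  then have h2: "g holomorphic_on (UNIV \<inter> {z. 0 < \<i> \<bullet> z})"
    by (rule holomorphic_on_subset) auto
  have hg: "g holomorphic_on UNIV"
    by (rule holomorphic_on_paste_across_line[OF _ _ h1 h2 cg]) auto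
  have g0: "g w = 0" for w
  proof (rule analytic_continuation_open[of "{w. Im w < 0}" UNIV g "\<lambda>_. 0"])
    show "{w. Im w < 0} \<noteq> {}" by (auto intro: exI[of _ "- \<i>"])
  qed (auto simp: g_def hg open_halfspace_Im_lt)
  have z0: "z \<noteq> 0" and z1: "norm z \<le> 1" using zD by (auto simp: DI_def)
  \<comment> \<open>This says that - i Ln z lies in the closed upper half-plane, where
    \<open>g\<close> is given by f.\<close>
  have "ln (norm z) \<le> 0" using z0 z1 by simp
  then have "g (- \<i> * Ln z) = f z" using z0 by (simp add: g_def)
  then show ?thesis using g0 by simp
qed

section \<open>Power series with absolutely summable coefficients on the closed unit disc\<close>

definition power_sum :: "(nat \<Rightarrow> complex) \<Rightarrow> complex \<Rightarrow> complex" where "power_sum c w = (\<Sum>k. c k * w ^ k)"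

context fixes c :: "nat \<Rightarrow> complex" assumes c: "summable (\<lambda>k. norm (c k))" begin

lemma power_sum_term_le: "norm w \<le> 1 \<Longrightarrow> norm (c k * w ^ k) \<le> norm (c k)"
  by (simp add: norm_mult norm_power mult_left_le power_le_one)

lemma power_sum_abs_summable: "norm w \<le> 1 \<Longrightarrow> summable (\<lambda>k. norm (c k * w ^ k))"
  by (rule summable_comparison_test'[OF c, of 0]) (use power_sum_term_le in auto)

lemma power_sum_summable: "norm w \<le> 1 \<Longrightarrow> summable (\<lambda>k. c k * w ^ k)"
  by (rule summable_norm_cancel[OF power_sum_abs_summable])

lemma power_sum_norm_le: "norm w \<le> 1 \<Longrightarrow> norm (power_sum c w) \<le> (\<Sum>k. norm (c k))"
  unfolding power_sum_def
  by (rule order_trans[OF summable_norm[OF power_sum_abs_summable]]) (auto intro!: suminf_le power_sum_term_le power_sum_abs_summable c)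

lemma power_sum_uniform: "uniform_limit (cball 0 1) (\<lambda>n w. \<Sum>k<n. c k * w ^ k) (power_sum c) sequentially"
  unfolding power_sum_def by (rule Weierstrass_m_test[OF _ c]) (use power_sum_term_le in auto)

lemma power_sum_continuous: "continuous_on (cball 0 1) (power_sum c)"
  by (rule uniform_limit_theorem[OF _ power_sum_uniform]) (auto intro!: always_eventually continuous_intros)

lemma power_sum_holomorphic: "power_sum c holomorphic_on ball 0 1"
  by (rule power_series_holomorphic[where a = c])
    (use summable_sums[OF power_sum_summable] in \<open>auto simp: power_sum_def\<close>)

end

definition JP where "JP a b n = power_sum (\<lambda>k. jp a b k n)"
definition JQ where "JQ a b n = power_sum (\<lambda>k. jq a b k n)"

lemma JP_0 [simp]: "JP a b n 0 = 1"
  by (simp add: JP_def power_sum_def powser_zero)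

context fixes a b assumes ab: "right_summable a b" begin

lemmas jp_norm_summable_ab = jp_norm_summable[OF ab] and jq_norm_summable_ab = jq_norm_summable[OF ab]

lemma JP_head: assumes "norm w \<le> 1" shows "JP a b n w = 1 + w * power_sum (\<lambda>k. jp a b (Suc k) n) w"
proof -
  have "summable (\<lambda>k. norm (jp a b (Suc k) n))" using jp_norm_summable_ab by (subst summable_Suc_iff)
  from power_sum_summable[OF this assms] show ?thesis
  unfolding JP_def power_sum_def using suminf_split_head[OF power_sum_summable[OF jp_norm_summable_ab assms], of n]
  by (simp add: suminf_mult[symmetric] algebra_simps)
qed

lemma JP_step:
  assumes "norm w \<le> 1" shows "JP a b n w = JP a b (n + 1) w + w * b n * JQ a b (n + 1) w"
proof -
  have s: "summable (\<lambda>k. norm (jp a b (Suc k) n))" for n using jp_norm_summable_ab by (subst summable_Suc_iff)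
  have "power_sum (\<lambda>k. jp a b (Suc k) n) w = power_sum (\<lambda>k. jp a b (Suc k) (n + 1)) w + b n * JQ a b (n + 1) w"
    unfolding power_sum_def JQ_def jp_Suc[OF ab, of _ n] using power_sum_summable[OF s assms] power_sum_summable[OF jq_norm_summable_ab assms]
    by (simp add: suminf_mult[symmetric] suminf_add summable_mult algebra_simps)
  then show ?thesis by (simp add: JP_head[OF assms] algebra_simps)
qed

lemma JQ_step:
  assumes "norm w \<le> 1" shows "JQ a b n w = w * JQ a b (n + 1) w + a n * JP a b (n + 1) w"
proof -
  have s: "summable (\<lambda>k. norm (jp a b (Suc k) n))" for n using jp_norm_summable_ab by (subst summable_Suc_iff)
  have "JQ a b n w = a n + w * (\<Sum>k. jq a b (Suc k) n * w ^ k)"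
  proof -
    have "summable (\<lambda>k. norm (jq a b (Suc k) n))" using jq_norm_summable_ab by (subst summable_Suc_iff)
    from power_sum_summable[OF this assms] show ?thesis
      unfolding JQ_def power_sum_def using suminf_split_head[OF power_sum_summable[OF jq_norm_summable_ab assms], of n]
      by (simp add: suminf_mult[symmetric] algebra_simps)
  qed
  also have "(\<Sum>k. jq a b (Suc k) n * w ^ k) = JQ a b (n + 1) w + a n * power_sum (\<lambda>k. jp a b (Suc k) (n + 1)) w"
    unfolding power_sum_def JQ_def jq_Suc using power_sum_summable[OF s assms] power_sum_summable[OF jq_norm_summable_ab assms]
    by (simp add: suminf_mult[symmetric] suminf_add summable_mult algebra_simps)
  finally show ?thesis by (simp add: JP_head[OF assms] algebra_simps)
qed

lemma JP_bound: assumes "norm w \<le> 1" shows "norm (JP a b n w - 1) \<le> exp (tail_mass a b n) - 1"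
proof -
  have s: "summable (\<lambda>k. norm (jp a b (Suc k) n))" for n using jp_norm_summable_ab by (subst summable_Suc_iff)
  have "norm (JP a b n w - 1) \<le> norm (power_sum (\<lambda>k. jp a b (Suc k) n) w)"
    using assms by (simp add: JP_head norm_mult mult_left_le_one_le)
  also have "\<dots> \<le> (\<Sum>k. norm (jp a b (Suc k) n))" by (rule power_sum_norm_le[OF s assms])
  also have "\<dots> \<le> exp (tail_mass a b n) - 1"
    using jc_rest_le[OF ab, of n] suminf_nonneg[OF jq_norm_summable_ab, of n] by simp
  finally show ?thesis .
qed

lemma JQ_bound: assumes "norm w \<le> 1" shows "norm (JQ a b n w) \<le> exp (tail_mass a b n) - 1"
proof -
  have s: "summable (\<lambda>k. norm (jp a b (Suc k) n))" for n using jp_norm_summable_ab by (subst summable_Suc_iff)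
  have "norm (JQ a b n w) \<le> (\<Sum>k. norm (jq a b k n))" unfolding JQ_def by (rule power_sum_norm_le[OF jq_norm_summable_ab assms])
  also have "\<dots> \<le> exp (tail_mass a b n) - 1"
    using jc_rest_le[OF ab, of n] suminf_nonneg[OF s, of n] by simp
  finally show ?thesis .
qed

lemma exp_tail_mass_tendsto: "((\<lambda>n. exp (tail_mass a b n) - 1) \<longlongrightarrow> 0) at_top"
  using tendsto_diff[OF tendsto_exp[OF tail_mass_tendsto[OF ab]] tendsto_const, of 1] by simp

lemma JP_tendsto: assumes "norm w \<le> 1" shows "((\<lambda>n. JP a b n w) \<longlongrightarrow> 1) at_top"
proof -
  have "((\<lambda>n. JP a b n w - 1) \<longlongrightarrow> 0) at_top"
    by (rule Lim_null_comparison[OF always_eventually exp_tail_mass_tendsto]) (use JP_bound[OF assms] in blast)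
  then show ?thesis by (simp add: LIM_zero_iff)
qed

lemma JQ_tendsto: assumes "norm w \<le> 1" shows "((\<lambda>n. JQ a b n w) \<longlongrightarrow> 0) at_top"
  by (rule Lim_null_comparison[OF always_eventually exp_tail_mass_tendsto]) (use JQ_bound[OF assms] in blast)

lemma JP_continuous: "continuous_on (cball 0 1) (JP a b n)"
  and JQ_continuous: "continuous_on (cball 0 1) (JQ a b n)"
  and JP_holomorphic: "JP a b n holomorphic_on ball 0 1"
  and JQ_holomorphic: "JQ a b n holomorphic_on ball 0 1"
  unfolding JP_def JQ_def by (intro power_sum_continuous power_sum_holomorphic jp_norm_summable_ab jq_norm_summable_ab)+

lemma JP2_continuous: "continuous_on (cball 0 1) (\<lambda>z. JP a b n (z\<^sup>2))"
  by (rule continuous_on_compose2[OF JP_continuous]) (auto intro!: continuous_intros simp: norm_power power_le_one)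

lemma JQ2_continuous: "continuous_on (cball 0 1) (\<lambda>z. JQ a b n (z\<^sup>2))"
  by (rule continuous_on_compose2[OF JQ_continuous]) (auto intro!: continuous_intros simp: norm_power power_le_one)

lemma JP2_holomorphic: "(\<lambda>z. JP a b n (z\<^sup>2)) holomorphic_on ball 0 1"
proof -
  have "(JP a b n \<circ> (\<lambda>z. z\<^sup>2)) holomorphic_on ball 0 1"
    by (rule holomorphic_on_compose_gen[OF _ JP_holomorphic])
      (auto intro!: holomorphic_intros simp: norm_power power_less_one_iff)
  then show ?thesis by (simp add: o_def)
qed

lemma JQ2_holomorphic: "(\<lambda>z. JQ a b n (z\<^sup>2)) holomorphic_on ball 0 1"
proof -
  have "(JQ a b n \<circ> (\<lambda>z. z\<^sup>2)) holomorphic_on ball 0 1"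
    by (rule holomorphic_on_compose_gen[OF _ JQ_holomorphic])
      (auto intro!: holomorphic_intros simp: norm_power power_less_one_iff)
  then show ?thesis by (simp add: o_def)
qed

end

text \<open>The value (0, 0) off \<open>DI\<close> is the one imposed by \<open>ext_in\<close>. It
  makes the Jost solution unique as a total function, as its definite description requires.\<close>

definition psiF :: "(int \<Rightarrow> complex) \<Rightarrow> (int \<Rightarrow> complex) \<Rightarrow> int \<Rightarrow> complex \<Rightarrow> complex \<times> complex" where
  "psiF a b n z = (if z \<in> DI then (z powi n * z\<^sup>2 * JQ a b n (z\<^sup>2), z powi n * JP a b n (z\<^sup>2)) else (0, 0))"

definition is_psi :: "(int \<Rightarrow> complex) \<Rightarrow> (int \<Rightarrow> complex) \<Rightarrow> (int \<Rightarrow> complex \<Rightarrow> complex \<times> complex) \<Rightarrow> bool" where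
  "is_psi a b Y \<longleftrightarrow> ext_in Y \<and> (\<forall>z\<in>DI. is_sol a b Y z) \<and>
     (\<forall>z. norm z = 1 \<longrightarrow> ((\<lambda>n. fst (Y n z)) \<longlongrightarrow> 0) at_top
                      \<and> ((\<lambda>n. snd (Y n z) / z powi n) \<longlongrightarrow> 1) at_top)"

lemma jost_psi_THE: "jost_psi a b = (THE Y. is_psi a b Y)"
  by (simp add: jost_psi_def is_psi_def)

lemma powi_Suc: "(z::complex) \<noteq> 0 \<Longrightarrow> z powi (n + 1) = z powi n * z"
  by (simp add: power_int_add)

lemma norm_powi_1: "norm (z::complex) = 1 \<Longrightarrow> norm (z powi n) = 1"
  by (simp add: norm_power_int)

lemma psiF_sol: assumes "right_summable a b" "z \<in> DI" shows "is_sol a b (psiF a b) z"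
proof -
  have z: "z \<noteq> 0" "norm (z\<^sup>2) \<le> 1" using assms(2) by (auto simp: DI_def norm_power power_le_one)
  show ?thesis unfolding is_sol_def
  proof
    fix n
    have "z powi n * z\<^sup>2 * JQ a b n (z\<^sup>2) = z * (z powi (n + 1) * z\<^sup>2 * JQ a b (n + 1) (z\<^sup>2))
        + z * a n * (z powi (n + 1) * JP a b (n + 1) (z\<^sup>2))"
      unfolding powi_Suc[OF z(1)] JQ_step[OF assms(1) z(2), of n] by (simp add: algebra_simps power2_eq_square)
    moreover have "z powi n * JP a b n (z\<^sup>2) = b n * (z powi (n + 1) * z\<^sup>2 * JQ a b (n + 1) (z\<^sup>2)) / z
        + z powi (n + 1) * JP a b (n + 1) (z\<^sup>2) / z"
      unfolding powi_Suc[OF z(1)] JP_step[OF assms(1) z(2), of n] using z(1) by (simp add: algebra_simps power2_eq_square)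
    ultimately show "psiF a b n z =
      (z * fst (psiF a b (n + 1) z) + z * a n * snd (psiF a b (n + 1) z),
       b n * fst (psiF a b (n + 1) z) / z + snd (psiF a b (n + 1) z) / z)"
      using assms(2) by (simp add: psiF_def)
  qed
qed

lemma psiF_ext_in: assumes "right_summable a b" shows "ext_in (psiF a b)"
  unfolding ext_in_def
proof (intro allI conjI impI)
  fix n
  have "(\<lambda>z. z powi n * z\<^sup>2 * JQ a b n (z\<^sup>2)) holomorphic_on (ball 0 1 - {0})"
    by (intro holomorphic_intros holomorphic_on_subset[OF JQ2_holomorphic[OF assms]]) auto
  then show "(\<lambda>z. fst (psiF a b n z)) holomorphic_on ball 0 1 - {0}"
    by (rule holomorphic_transform) (auto simp: psiF_def DI_def)
  have "(\<lambda>z. z powi n * JP a b n (z\<^sup>2)) holomorphic_on (ball 0 1 - {0})"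
    by (intro holomorphic_intros holomorphic_on_subset[OF JP2_holomorphic[OF assms]]) auto
  then show "(\<lambda>z. snd (psiF a b n z)) holomorphic_on ball 0 1 - {0}"
    by (rule holomorphic_transform) (auto simp: psiF_def DI_def)
  have "continuous_on DI (\<lambda>z. (z powi n * z\<^sup>2 * JQ a b n (z\<^sup>2), z powi n * JP a b n (z\<^sup>2)))"
    by (intro continuous_intros continuous_on_subset[OF JP2_continuous[OF assms]]
        continuous_on_subset[OF JQ2_continuous[OF assms]]) (auto simp: DI_def)
  then show "continuous_on DI (psiF a b n)"
    by (rule continuous_on_eq) (auto simp: psiF_def)
qed (auto simp: psiF_def)

lemma psiF_is_psi: assumes "right_summable a b" shows "is_psi a b (psiF a b)"
  unfolding is_psi_def
proof (intro conjI ballI allI impI)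
  fix z :: complex assume z: "norm z = 1"
  then have zD: "z \<in> DI" and z0: "z \<noteq> 0" by (auto simp: DI_def)
  have z2: "norm (z\<^sup>2) \<le> 1" using z by (simp add: norm_power)
  show "((\<lambda>n. fst (psiF a b n z)) \<longlongrightarrow> 0) at_top"
    by (rule tendsto_norm_zero_cancel)
      (use tendsto_norm[OF JQ_tendsto[OF assms z2]] zD z in \<open>simp add: psiF_def norm_mult norm_powi_1 norm_power\<close>)
  show "((\<lambda>n. snd (psiF a b n z) / z powi n) \<longlongrightarrow> 1) at_top"
    using JP_tendsto[OF assms z2] zD z0 by (simp add: psiF_def)
qed (auto simp: psiF_ext_in psiF_sol assms)

text \<open>On the unit circle the factors z and 1/z preserve norms, so a step to the left enlarges
  the sum of the component norms by at most exp (|a n| + |b n|). Weighted by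
  \<open>exp (- tail_mass a b n)\<close>, this sum increases with n and has limit 0.\<close>

lemma sol_decay_zero:
  assumes "right_summable a b" "norm z = 1" "is_sol a b D z"
    "((\<lambda>n. fst (D n z)) \<longlongrightarrow> 0) at_top" "((\<lambda>n. snd (D n z)) \<longlongrightarrow> 0) at_top"
  shows "D n z = (0, 0)"
proof -
  define N where "N n = norm (fst (D n z)) + norm (snd (D n z))" for n
  have N0: "0 \<le> N n" for n by (simp add: N_def)
  have st: "N n \<le> exp (norm (a n) + norm (b n)) * N (n + 1)" for n
  proof -
    let ?x = "fst (D (n + 1) z)" and ?y = "snd (D (n + 1) z)"
    have D: "D n z = (z * ?x + z * a n * ?y, b n * ?x / z + ?y / z)"
      using assms(3)[unfolded is_sol_def, THEN spec, of n] .
    have "norm (z * ?x + z * a n * ?y) \<le> norm ?x + norm (a n) * norm ?y"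
      by (rule order_trans[OF norm_triangle_ineq]) (simp add: norm_mult assms)
    moreover have "norm (b n * ?x / z + ?y / z) \<le> norm (b n) * norm ?x + norm ?y"
      by (rule order_trans[OF norm_triangle_ineq]) (simp add: norm_mult norm_divide assms)
    ultimately have "N n \<le> norm ?x + norm (a n) * norm ?y + (norm (b n) * norm ?x + norm ?y)"
      unfolding N_def[of n] by (subst (1 2) D) simp
    also have "\<dots> \<le> (1 + (norm (a n) + norm (b n))) * N (n + 1)"
      by (simp add: N_def algebra_simps)
    also have "\<dots> \<le> exp (norm (a n) + norm (b n)) * N (n + 1)"
      by (intro mult_right_mono N0 exp_ge_add_one_self)
    finally show ?thesis .
  qed
  have inc: "exp (- tail_mass a b n) * N n \<le> exp (- tail_mass a b (n + 1)) * N (n + 1)" for n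
  proof -
    have "exp (- tail_mass a b n) * N n \<le> exp (- tail_mass a b n) * (exp (norm (a n) + norm (b n)) * N (n + 1))"
      by (intro mult_left_mono st) simp
    also have "\<dots> = exp (- tail_mass a b (n + 1)) * N (n + 1)"
      by (subst tail_mass_step[OF assms(1), of n]) (simp add: exp_add[symmetric] mult.assoc[symmetric])
    finally show ?thesis .
  qed
  have "((\<lambda>n. exp (- tail_mass a b n) * N n) \<longlongrightarrow> exp (- 0) * (norm (0::complex) + norm (0::complex))) at_top"
    unfolding N_def by (intro tendsto_intros tail_mass_tendsto assms)
  from le_lim_at_top_int[OF inc this] have "exp (- tail_mass a b n) * N n \<le> 0" by simp
  then have "N n \<le> 0" by (simp add: mult_le_0_iff)
  then have "norm (fst (D n z)) = 0 \<and> norm (snd (D n z)) = 0"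
    unfolding N_def using norm_ge_zero[of "fst (D n z)"] norm_ge_zero[of "snd (D n z)"] by linarith
  then show ?thesis by (simp add: prod_eq_iff)
qed

lemma psi_circle_unique:
  assumes "right_summable a b" "norm z = 1" "is_sol a b Y z" "is_sol a b Y' z"
    "((\<lambda>n. fst (Y n z)) \<longlongrightarrow> 0) at_top" "((\<lambda>n. snd (Y n z) / z powi n) \<longlongrightarrow> 1) at_top"
    "((\<lambda>n. fst (Y' n z)) \<longlongrightarrow> 0) at_top" "((\<lambda>n. snd (Y' n z) / z powi n) \<longlongrightarrow> 1) at_top"
  shows "Y n z = Y' n z"
proof -
  define D where "D n z = (fst (Y n z) - fst (Y' n z), snd (Y n z) - snd (Y' n z))" for n z
  have "D n z = (0, 0)"
  proof (rule sol_decay_zero[OF assms(1,2)])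
    show "is_sol a b D z" unfolding is_sol_def
    proof
      fix n
      from assms(3,4)[unfolded is_sol_def, THEN spec, of n]
      show "D n z = (z * fst (D (n + 1) z) + z * a n * snd (D (n + 1) z),
           b n * fst (D (n + 1) z) / z + snd (D (n + 1) z) / z)"
        by (simp add: D_def algebra_simps diff_divide_distrib)
    qed
    show "((\<lambda>n. fst (D n z)) \<longlongrightarrow> 0) at_top"
      using tendsto_diff[OF assms(5,7)] by (simp add: D_def)
    have "((\<lambda>n. snd (Y n z) / z powi n - snd (Y' n z) / z powi n) \<longlongrightarrow> 0) at_top"
      using tendsto_diff[OF assms(6,8)] by simp
    from tendsto_norm[OF this] have "((\<lambda>n. norm (snd (D n z))) \<longlongrightarrow> 0) at_top"
      by (simp add: D_def diff_divide_distrib[symmetric] norm_divide norm_powi_1 assms(2))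
    then show "((\<lambda>n. snd (D n z)) \<longlongrightarrow> 0) at_top" by (rule tendsto_norm_zero_cancel)
  qed
  then show ?thesis by (simp add: D_def prod_eq_iff)
qed

text \<open>No asymptotics is available inside the disc. Uniqueness there is inherited from the
  circle, because the difference of two candidates has zero boundary values.\<close>

lemma is_psi_unique:
  assumes "right_summable a b" "is_psi a b Y" "is_psi a b Y'" shows "Y = Y'"
proof (intro ext)
  fix n z
  have c: "Y n z = Y' n z" if z: "norm z = 1" for z n
    by (rule psi_circle_unique[OF assms(1) z]) (use assms z in \<open>auto simp: is_psi_def DI_def\<close>)
  show "Y n z = Y' n z"
  proof (cases "z \<in> DI")
    case False
    with assms show ?thesis by (auto simp: is_psi_def ext_in_def)
  next
    case True
    define f where "f z = fst (Y n z) - fst (Y' n z)" for z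
    define g where "g z = snd (Y n z) - snd (Y' n z)" for z
    have h: "f holomorphic_on (ball 0 1 - {0})" "g holomorphic_on (ball 0 1 - {0})"
      unfolding f_def[abs_def] g_def[abs_def] using assms unfolding is_psi_def ext_in_def
      by (auto intro!: holomorphic_intros)
    have "continuous_on DI (Y n)" "continuous_on DI (Y' n)" using assms by (auto simp: is_psi_def ext_in_def)
    then have k: "continuous_on DI f" "continuous_on DI g"
      unfolding f_def[abs_def] g_def[abs_def] by (auto intro!: continuous_intros)
    have "f z = 0" by (rule boundary_vanish[OF h(1) k(1) _ True]) (simp add: f_def c)
    moreover have "g z = 0" by (rule boundary_vanish[OF h(2) k(2) _ True]) (simp add: g_def c)
    ultimately show ?thesis by (simp add: f_def g_def prod_eq_iff)
  qed
qed

lemma jost_psi_eq: assumes "right_summable a b" shows "jost_psi a b = psiF a b"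
  unfolding jost_psi_THE
  by (rule the_equality[where P = "is_psi a b", OF psiF_is_psi[OF assms]])
    (use is_psi_unique[OF assms] psiF_is_psi[OF assms] in blast)

text \<open>Inverting z and swapping the components exchanges the pairs (a, b) and (b, a); it turns the
  Jost solutions into the barred ones.\<close>

definition flip :: "(int \<Rightarrow> complex \<Rightarrow> complex \<times> complex) \<Rightarrow> int \<Rightarrow> complex \<Rightarrow> complex \<times> complex" where
  "flip Y n z = prod.swap (Y n (inverse z))"

lemma flip_flip [simp]: "flip (flip Y) = Y" by (simp add: flip_def fun_eq_iff)

lemma inverse_DI_iff: "inverse z \<in> DI \<longleftrightarrow> z \<in> DO" and inverse_DO_iff: "inverse z \<in> DO \<longleftrightarrow> z \<in> DI"
proof -
  show "inverse z \<in> DI \<longleftrightarrow> z \<in> DO" for z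
    by (cases "z = 0") (auto simp: DI_def DO_def norm_inverse inverse_le_1_iff)
  from this[of "inverse z"] show "inverse z \<in> DO \<longleftrightarrow> z \<in> DI" by simp
qed

lemma ext_in_flip: assumes "ext_in Y" shows "ext_out (flip Y)"
  unfolding ext_out_def
proof (intro allI conjI impI)
  fix n
  have *: "(f \<circ> inverse) holomorphic_on {z. 1 < norm z}" if "f holomorphic_on (ball 0 1 - {0})" for f
    by (rule holomorphic_on_compose_gen[OF _ that])
      (auto intro!: holomorphic_intros simp: norm_inverse inverse_less_1_iff)
  show "(\<lambda>z. fst (flip Y n z)) holomorphic_on {z. 1 < norm z}" "(\<lambda>z. snd (flip Y n z)) holomorphic_on {z. 1 < norm z}"
    using assms *[of "\<lambda>z. fst (Y n z)"] *[of "\<lambda>z. snd (Y n z)"] by (simp_all add: ext_in_def flip_def o_def)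
  have "continuous_on DO (\<lambda>z. Y n (inverse z))"
  proof (rule continuous_on_compose2[where g = "Y n" and f = inverse])
    show "continuous_on DI (Y n)" using assms by (simp add: ext_in_def)
    show "continuous_on DO inverse" by (intro continuous_intros) (auto simp: DO_def)
  qed (auto simp: inverse_DI_iff)
  then have "continuous_on DO (\<lambda>z. (snd (Y n (inverse z)), fst (Y n (inverse z))))"
    by (intro continuous_intros)
  then show "continuous_on DO (flip Y n)"
    by (rule continuous_on_eq) (simp add: flip_def prod.swap_def)
  fix z :: complex assume "z \<notin> DO" then show "flip Y n z = (0, 0)"
    using assms by (simp add: ext_in_def flip_def inverse_DI_iff[symmetric])
qed

lemma ext_out_flip: assumes "ext_out Y" shows "ext_in (flip Y)"
  unfolding ext_in_def
proof (intro allI conjI impI)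
  fix n
  have *: "(f \<circ> inverse) holomorphic_on ball 0 1 - {0}" if "f holomorphic_on {z. 1 < norm z}" for f
    by (rule holomorphic_on_compose_gen[OF _ that])
      (auto intro!: holomorphic_intros simp: norm_inverse one_less_inverse_iff)
  show "(\<lambda>z. fst (flip Y n z)) holomorphic_on ball 0 1 - {0}" "(\<lambda>z. snd (flip Y n z)) holomorphic_on ball 0 1 - {0}"
    using assms *[of "\<lambda>z. fst (Y n z)"] *[of "\<lambda>z. snd (Y n z)"] by (simp_all add: ext_out_def flip_def o_def)
  have "continuous_on DI (\<lambda>z. Y n (inverse z))"
  proof (rule continuous_on_compose2[where g = "Y n" and f = inverse])
    show "continuous_on DO (Y n)" using assms by (simp add: ext_out_def)
    show "continuous_on DI inverse" by (intro continuous_intros) (auto simp: DI_def)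
  qed (auto simp: inverse_DO_iff)
  then have "continuous_on DI (\<lambda>z. (snd (Y n (inverse z)), fst (Y n (inverse z))))"
    by (intro continuous_intros)
  then show "continuous_on DI (flip Y n)"
    by (rule continuous_on_eq) (simp add: flip_def prod.swap_def)
  fix z :: complex assume "z \<notin> DI" then show "flip Y n z = (0, 0)"
    using assms by (simp add: ext_out_def flip_def inverse_DO_iff[symmetric])
qed

lemma ext_flip_iff: "ext_out Y \<longleftrightarrow> ext_in (flip Y)"
  using ext_in_flip[of "flip Y"] ext_out_flip[of Y] by auto

lemma is_sol_flip: "is_sol b a (flip Y) z \<longleftrightarrow> is_sol a b Y (inverse z)"
  unfolding is_sol_def flip_def by (auto simp: prod_eq_iff field_simps)

lemma ball_DO_flip: "(\<forall>z\<in>DO. P (inverse z)) \<longleftrightarrow> (\<forall>z\<in>DI. P z)"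
  by (metis inverse_DI_iff inverse_DO_iff inverse_inverse_eq)

lemma norm1_flip: "(\<forall>z::complex. norm z = 1 \<longrightarrow> P (inverse z)) \<longleftrightarrow> (\<forall>z. norm z = 1 \<longrightarrow> P z)"
  by (metis inverse_inverse_eq norm_inverse inverse_1)

lemma jost_psib_eq: assumes "right_summable b a" shows "jost_psib a b = flip (jost_psi b a)"
proof -
  \<comment> \<open>The description that defines psi-bar of (a, b), read for Y, is the one that
    defines psi of (b, a), read for \<open>flip Y\<close>; existence and uniqueness carry
    over.\<close>
  have *: "(ext_out Y \<and> (\<forall>z\<in>DO. is_sol a b Y z) \<and>
     (\<forall>z. norm z = 1 \<longrightarrow> ((\<lambda>n. fst (Y n z) * z powi n) \<longlongrightarrow> 1) at_top
                      \<and> ((\<lambda>n. snd (Y n z)) \<longlongrightarrow> 0) at_top)) \<longleftrightarrow> is_psi b a (flip Y)" for Y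
    unfolding is_psi_def ext_flip_iff[of Y] is_sol_flip ball_DO_flip[of "is_sol a b Y", symmetric]
    by (subst (2) norm1_flip[symmetric]) 
      (auto simp: flip_def power_int_inverse divide_inverse ball_DO_flip[of "\<lambda>z. is_sol a b Y (inverse z)", symmetric])
  show ?thesis
    unfolding jost_psib_def * 
  proof (rule the_equality)
    show "is_psi b a (flip (flip (jost_psi b a)))"
      using psiF_is_psi[OF assms] jost_psi_eq[OF assms] by simp
    fix Y assume "is_psi b a (flip Y)"
    then have "flip Y = jost_psi b a" using is_psi_unique[OF assms _ psiF_is_psi[OF assms]] jost_psi_eq[OF assms] by simp
    then show "Y = flip (jost_psi b a)" by (metis flip_flip)
  qed
qed

lemma filterlim_at_bot_int: "filterlim (f :: int \<Rightarrow> 'a) F at_bot \<longleftrightarrow> filterlim (\<lambda>n. f (- n)) F at_top"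
  by (simp add: at_bot_mirror filterlim_filtermap)

text \<open>Reversing n, rescaling by the products \<open>Dp a b\<close> of the determinants and swapping the components
  turns \<open>\<phi>\<close> of (a, b) into \<open>\<psi>\<close> of \<open>(reflect b, reflect a)\<close>; see \<open>reverse_sol\<close>.\<close>

definition reflect :: "(int \<Rightarrow> complex) \<Rightarrow> int \<Rightarrow> complex" where "reflect a n = - a (- n - 1)"

text \<open>Two-sided summability, its left half being stated through the reflected pair, together
  with invertibility of every transfer matrix, whose determinant is 1 - a n * b n.\<close>

definition l1pair :: "(int \<Rightarrow> complex) \<Rightarrow> (int \<Rightarrow> complex) \<Rightarrow> bool" where
  "l1pair a b \<longleftrightarrow> right_summable a b \<and> right_summable (reflect b) (reflect a) \<and> (\<forall>n. 1 - a n * b n \<noteq> 0)"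

lemma l1pair_commute: "l1pair a b \<longleftrightarrow> l1pair b a"
  unfolding l1pair_def using right_summable_commute by (auto simp: mult.commute)

lemma summable_mult_norm:
  fixes f g :: "nat \<Rightarrow> complex"
  assumes "summable (\<lambda>i. norm (f i))" "summable (\<lambda>i. norm (g i))"
  shows "summable (\<lambda>i. norm (f i * g i))"
proof (rule summable_comparison_test_ev[OF _ assms(1)])
  have "eventually (\<lambda>i. norm (g i) < 1) sequentially"
    using order_tendstoD(2)[OF summable_LIMSEQ_zero[OF assms(2)], of 1] by simp
  then show "eventually (\<lambda>i. norm (norm (f i * g i)) \<le> norm (f i)) sequentially"
    by eventually_elim (simp add: norm_mult mult_left_le)
qed

section \<open>Infinite products over left half-lines\<close>

definition left_prod :: "(int \<Rightarrow> complex) \<Rightarrow> int \<Rightarrow> complex" where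
  "left_prod f n = (\<Prod>i. 1 + f (n - int i))"

context
  fixes f :: "int \<Rightarrow> complex"
  assumes f: "\<And>n. summable (\<lambda>i. norm (f (n - int i)))"
begin

lemma left_prod_convergent: "convergent_prod (\<lambda>i. 1 + f (n - int i))"
  by (intro abs_convergent_prod_imp_convergent_prod summable_imp_abs_convergent_prod) (use f in simp)

lemma left_prod_nonzero: "(\<And>n. 1 + f n \<noteq> 0) \<Longrightarrow> left_prod f n \<noteq> 0"
  unfolding left_prod_def by (rule prodinf_nonzero[OF left_prod_convergent])

lemma left_prod_step: assumes nz: "\<And>n. 1 + f n \<noteq> 0" shows "left_prod f n = (1 + f n) * left_prod f (n - 1)"
proof -
  have "left_prod f n = (1 + f n) * (\<Prod>i. 1 + f (n - int (Suc i)))"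
    unfolding left_prod_def using prodinf_split_head[OF left_prod_convergent[of n]] nz[of n]
    by (simp add: field_simps)
  also have "(\<Prod>i. 1 + f (n - int (Suc i))) = left_prod f (n - 1)"
    unfolding left_prod_def by (simp add: algebra_simps)
  finally show ?thesis .
qed

text \<open>The product up to 0 is a finite product times the remaining one. The finite products
  converge to the whole, which is nonzero, so the quotient that remains tends to 1.\<close>

lemma left_prod_tendsto: assumes nz: "\<And>n. 1 + f n \<noteq> 0" shows "(left_prod f \<longlongrightarrow> 1) at_bot"
proof -
  have *: "left_prod f 0 = (\<Prod>i<k. 1 + f (- int i)) * left_prod f (- int k)" for k
  proof (induction k)
    case (Suc k)
    have "- int (Suc k) = - int k - 1" by simp
    with Suc show ?case using left_prod_step[OF nz, of "- int k"] by (simp only: prod.lessThan_Suc) (simp add: algebra_simps)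
  qed simp
  have "(\<lambda>k. left_prod f 0 / (\<Prod>i<k. 1 + f (- int i))) \<longlonglongrightarrow> left_prod f 0 / left_prod f 0"
    by (intro tendsto_divide tendsto_const left_prod_nonzero nz)
     (use convergent_prod_LIMSEQ[OF left_prod_convergent[of 0]] in \<open>simp add: left_prod_def LIMSEQ_lessThan_iff_atMost[symmetric]\<close>)
  moreover have "left_prod f 0 / (\<Prod>i<k. 1 + f (- int i)) = left_prod f (- int k)" for k
  proof -
    have "(\<Prod>i<k. 1 + f (- int i)) \<noteq> 0" using nz by simp
    then show ?thesis using *[of k] by (simp add: field_simps)
  qed
  ultimately have "(\<lambda>k. left_prod f (- (0 + int k))) \<longlonglongrightarrow> 1" using left_prod_nonzero[OF nz] by simp
  then have "((\<lambda>n. left_prod f (- n)) \<longlongrightarrow> 1) at_top" by (rule tendsto_at_top_int)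
  then show ?thesis by (simp add: filterlim_at_bot_int)
qed

end

lemma Dp_left_prod: "Dp q r = left_prod (\<lambda>n. - (q n * r n))" by (simp add: Dp_def left_prod_def fun_eq_iff)
lemma Ep_left_prod: "Ep q r = left_prod (\<lambda>n. q n * r (n + 1))" by (simp add: Ep_def left_prod_def fun_eq_iff algebra_simps)

section \<open>The solution phi, normalised at -infinity\<close>

context fixes a b assumes ab: "l1pair a b" begin

lemma l1pair_summable: "right_summable a b" "right_summable b a" "right_summable (reflect b) (reflect a)" "right_summable (reflect a) (reflect b)"
  using ab right_summable_commute by (auto simp: l1pair_def)

lemma l1pair_nonzero: "1 - a n * b n \<noteq> 0" using ab by (simp add: l1pair_def)

lemma prod_bsummable: "summable (\<lambda>i. norm (- (a (n - int i) * b (n - int i))))"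
proof -
  have "summable (\<lambda>i. norm (reflect a (- n - 1 + int i)))" "summable (\<lambda>i. norm (reflect b (- n - 1 + int i)))"
    using l1pair_summable(3) unfolding right_summable_def by blast+
  then have "summable (\<lambda>i. norm (a (n - int i)))" "summable (\<lambda>i. norm (b (n - int i)))"
    by (simp_all add: reflect_def algebra_simps)
  from summable_mult_norm[OF this] show ?thesis by simp
qed

lemma Dp_nonzero: "Dp a b n \<noteq> 0"
  unfolding Dp_left_prod by (intro left_prod_nonzero prod_bsummable) (use l1pair_nonzero in simp)

lemma Dp_step: "Dp a b n = (1 - a n * b n) * Dp a b (n - 1)"
  unfolding Dp_left_prod by (subst left_prod_step[OF prod_bsummable]) (use l1pair_nonzero in simp_all)

lemma Dp_tendsto: "(Dp a b \<longlongrightarrow> 1) at_bot"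
  unfolding Dp_left_prod by (intro left_prod_tendsto prod_bsummable) (use l1pair_nonzero in simp)

text \<open>Found by solving \<open>reverse_sol\<close> for its argument. Continuing to the right
  uses inverse transfer matrices, whose entries carry -a n and -b n divided by 1 - a n * b n. The
  factor \<open>Dp a b (n - 1)\<close> collects these determinants; it tends to 1 at -infinity and
  so leaves the normalisation unchanged.\<close>

definition "phiF n z = (if z \<in> DI then (z powi (- n) * JP (reflect b) (reflect a) (- n) (z\<^sup>2) / Dp a b (n - 1),
    z powi (- n) * JQ (reflect b) (reflect a) (- n) (z\<^sup>2) / Dp a b (n - 1)) else (0, 0))"

lemma Dp_tendsto': "((\<lambda>n. Dp a b (- n - 1)) \<longlongrightarrow> 1) at_top"
proof -
  have "filterlim (\<lambda>n::int. - n - 1) at_bot at_top"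
    unfolding filterlim_at_bot
  proof
    fix Z :: int show "eventually (\<lambda>x. - x - 1 \<le> Z) at_top"
      using eventually_ge_at_top[of "- Z - 1"] by eventually_elim auto
  qed
  from filterlim_compose[OF Dp_tendsto this] show ?thesis .
qed

lemma phiF_sol: assumes "z \<in> DI" shows "is_sol a b phiF z"
proof -
  have z: "z \<noteq> 0" "norm (z\<^sup>2) \<le> 1" using assms by (auto simp: DI_def norm_power power_le_one)
  show ?thesis unfolding is_sol_def
  proof
    fix n
    let ?w = "z\<^sup>2" and ?D = "Dp a b (n - 1)"
    let ?P = "JP (reflect b) (reflect a) (- n) ?w" and ?Q = "JQ (reflect b) (reflect a) (- n) ?w"
    have e: "- (n + 1) = - n - 1" "- n - 1 + 1 = - n" "n + 1 - 1 = n" by auto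
    have P: "JP (reflect b) (reflect a) (- (n + 1)) ?w = ?P - ?w * a n * ?Q"
      unfolding e(1) JP_step[OF l1pair_summable(3) z(2), of "- n - 1"] by (simp add: reflect_def)
    have Q: "JQ (reflect b) (reflect a) (- (n + 1)) ?w = ?w * ?Q - b n * ?P"
      unfolding e(1) JQ_step[OF l1pair_summable(3) z(2), of "- n - 1"] by (simp add: reflect_def)
    have D: "Dp a b (n + 1 - 1) = (1 - a n * b n) * ?D" using Dp_step[of n] by simp
    have zp: "z powi (- n) = z * z powi (- (n + 1))"
      using powi_Suc[OF z(1), of "- (n + 1)"] by (simp add: mult.commute)
    define Z where "Z = z powi (- (n + 1))"
    have "z * Z * ?P / ?D = z * (Z * (?P - ?w * a n * ?Q) / ((1 - a n * b n) * ?D))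
        + z * a n * (Z * (?w * ?Q - b n * ?P) / ((1 - a n * b n) * ?D))"
      using l1pair_nonzero[of n] Dp_nonzero[of "n - 1"] by (simp add: divide_simps) (simp add: algebra_simps)
    moreover have "z * Z * ?Q / ?D = b n * (Z * (?P - ?w * a n * ?Q) / ((1 - a n * b n) * ?D)) / z
        + (Z * (?w * ?Q - b n * ?P) / ((1 - a n * b n) * ?D)) / z"
      using l1pair_nonzero[of n] Dp_nonzero[of "n - 1"] z(1) by (simp add: divide_simps) (simp add: algebra_simps power2_eq_square)
    ultimately show "phiF n z = (z * fst (phiF (n + 1) z) + z * a n * snd (phiF (n + 1) z),
       b n * fst (phiF (n + 1) z) / z + snd (phiF (n + 1) z) / z)"
      unfolding phiF_def P Q D zp Z_def using assms by simp
  qed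
qed

definition "is_phi Y \<longleftrightarrow> ext_in Y \<and> (\<forall>z\<in>DI. is_sol a b Y z) \<and>
     (\<forall>z. norm z = 1 \<longrightarrow> ((\<lambda>n. fst (Y n z) * z powi n) \<longlongrightarrow> 1) at_bot
                      \<and> ((\<lambda>n. snd (Y n z)) \<longlongrightarrow> 0) at_bot)"

lemma phiF_is_phi: "is_phi phiF"
  unfolding is_phi_def
proof (intro conjI ballI allI impI)
  show "ext_in phiF"
    unfolding ext_in_def
  proof (intro allI conjI impI)
    fix n
    have "(\<lambda>z. z powi (- n) * JP (reflect b) (reflect a) (- n) (z\<^sup>2) / Dp a b (n - 1)) holomorphic_on (ball 0 1 - {0})"
      by (intro holomorphic_intros holomorphic_on_subset[OF JP2_holomorphic[OF l1pair_summable(3)]]) (auto simp: Dp_nonzero)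
    then show "(\<lambda>z. fst (phiF n z)) holomorphic_on ball 0 1 - {0}"
      by (rule holomorphic_transform) (auto simp: phiF_def DI_def)
    have "(\<lambda>z. z powi (- n) * JQ (reflect b) (reflect a) (- n) (z\<^sup>2) / Dp a b (n - 1)) holomorphic_on (ball 0 1 - {0})"
      by (intro holomorphic_intros holomorphic_on_subset[OF JQ2_holomorphic[OF l1pair_summable(3)]]) (auto simp: Dp_nonzero)
    then show "(\<lambda>z. snd (phiF n z)) holomorphic_on ball 0 1 - {0}"
      by (rule holomorphic_transform) (auto simp: phiF_def DI_def)
    have "continuous_on DI (\<lambda>z. (z powi (- n) * JP (reflect b) (reflect a) (- n) (z\<^sup>2) / Dp a b (n - 1),
       z powi (- n) * JQ (reflect b) (reflect a) (- n) (z\<^sup>2) / Dp a b (n - 1)))"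
      by (intro continuous_intros continuous_on_subset[OF JP2_continuous[OF l1pair_summable(3)]]
          continuous_on_subset[OF JQ2_continuous[OF l1pair_summable(3)]]) (auto simp: DI_def Dp_nonzero)
    then show "continuous_on DI (phiF n)"
      by (rule continuous_on_eq) (auto simp: phiF_def)
  qed (auto simp: phiF_def)
next
  fix z :: complex assume z: "norm z = 1"
  then have zD: "z \<in> DI" and z0: "z \<noteq> 0" by (auto simp: DI_def)
  have z2: "norm (z\<^sup>2) \<le> 1" using z by (simp add: norm_power)
  have "((\<lambda>n. JP (reflect b) (reflect a) n (z\<^sup>2) / Dp a b (- n - 1)) \<longlongrightarrow> 1 / 1) at_top"
    by (intro tendsto_divide JP_tendsto[OF l1pair_summable(3) z2] Dp_tendsto') simp
  moreover have "(\<lambda>n. fst (phiF (- n) z) * z powi (- n)) = (\<lambda>n. JP (reflect b) (reflect a) n (z\<^sup>2) / Dp a b (- n - 1))"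
    using zD z0 by (simp add: phiF_def power_int_minus fun_eq_iff)
  ultimately show "((\<lambda>n. fst (phiF n z) * z powi n) \<longlongrightarrow> 1) at_bot"
    unfolding filterlim_at_bot_int by simp
  have "((\<lambda>n. norm (JQ (reflect b) (reflect a) n (z\<^sup>2) / Dp a b (- n - 1))) \<longlongrightarrow> norm (0 / 1 :: complex)) at_top"
    by (intro tendsto_norm tendsto_divide JQ_tendsto[OF l1pair_summable(3) z2] Dp_tendsto') simp
  moreover have "(\<lambda>n. norm (snd (phiF (- n) z))) = (\<lambda>n. norm (JQ (reflect b) (reflect a) n (z\<^sup>2) / Dp a b (- n - 1)))"
    using zD z by (simp add: phiF_def norm_mult norm_divide norm_powi_1 fun_eq_iff)
  ultimately have "((\<lambda>n. norm (snd (phiF (- n) z))) \<longlongrightarrow> 0) at_top" by simp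
  then show "((\<lambda>n. snd (phiF n z)) \<longlongrightarrow> 0) at_bot"
    unfolding filterlim_at_bot_int by (rule tendsto_norm_zero_cancel)
qed (auto simp: phiF_sol)

definition "reverse_sol Y (m :: int) z = (if z \<in> DI then (Dp a b (- m - 1) * z\<^sup>2 * snd (Y (- m) z), Dp a b (- m - 1) * fst (Y (- m) z)) else (0, 0))"

lemma reverse_sol_is_psi:
  assumes Y: "is_phi Y" shows "is_psi (reflect b) (reflect a) (reverse_sol Y)"
  unfolding is_psi_def
proof (intro conjI ballI allI impI)
  have E: "ext_in Y" and S: "\<And>z. z \<in> DI \<Longrightarrow> is_sol a b Y z" using Y by (auto simp: is_phi_def)
  show "ext_in (reverse_sol Y)"
    unfolding ext_in_def
  proof (intro allI conjI impI)
    fix n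
    have h: "(\<lambda>z. fst (Y (- n) z)) holomorphic_on ball 0 1 - {0}" "(\<lambda>z. snd (Y (- n) z)) holomorphic_on ball 0 1 - {0}"
      and c: "continuous_on DI (Y (- n))"
      using E by (auto simp: ext_in_def)
    have "(\<lambda>z. Dp a b (- n - 1) * z\<^sup>2 * snd (Y (- n) z)) holomorphic_on ball 0 1 - {0}"
      by (intro holomorphic_intros h)
    then show "(\<lambda>z. fst (reverse_sol Y n z)) holomorphic_on ball 0 1 - {0}"
      by (rule holomorphic_transform) (auto simp: reverse_sol_def DI_def)
    have "(\<lambda>z. Dp a b (- n - 1) * fst (Y (- n) z)) holomorphic_on ball 0 1 - {0}"
      by (intro holomorphic_intros h)
    then show "(\<lambda>z. snd (reverse_sol Y n z)) holomorphic_on ball 0 1 - {0}"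
      by (rule holomorphic_transform) (auto simp: reverse_sol_def DI_def)
    have "continuous_on DI (\<lambda>z. (Dp a b (- n - 1) * z\<^sup>2 * snd (Y (- n) z), Dp a b (- n - 1) * fst (Y (- n) z)))"
      by (intro continuous_intros c)
    then show "continuous_on DI (reverse_sol Y n)"
      by (rule continuous_on_eq) (auto simp: reverse_sol_def)
  qed (auto simp: reverse_sol_def)
  fix z
  show "is_sol (reflect b) (reflect a) (reverse_sol Y) z" if zD: "z \<in> DI"
    unfolding is_sol_def
  proof
    fix m :: int
    define n where "n = - m - 1"
    have z0: "z \<noteq> 0" using zD by (auto simp: DI_def)
    have m: "- m = n + 1" "- (m + 1) = n" "- m - 1 = n" "- (m + 1) - 1 = n - 1" by (auto simp: n_def)
    obtain x y where xy: "Y (n + 1) z = (x, y)" by fastforce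
    have Yn: "Y n z = (z * x + z * a n * y, b n * x / z + y / z)"
      using S[OF zD, unfolded is_sol_def, THEN spec, of n] xy by simp
    have r: "reflect b m = - b n" "reflect a m = - a n" by (auto simp: reflect_def n_def)
    have D: "Dp a b (n + 1 - 1) = (1 - a n * b n) * Dp a b (n - 1)" using Dp_step[of n] by simp
    show "reverse_sol Y m z =
         (z * fst (reverse_sol Y (m + 1) z) + z * reflect b m * snd (reverse_sol Y (m + 1) z),
          reflect a m * fst (reverse_sol Y (m + 1) z) / z + snd (reverse_sol Y (m + 1) z) / z)"
      unfolding reverse_sol_def r m xy Yn D using zD z0
      by (simp add: field_simps power2_eq_square)
  qed
  assume z: "norm z = 1"
  then have zD: "z \<in> DI" and z0: "z \<noteq> 0" by (auto simp: DI_def)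
  have 1: "((\<lambda>n. fst (Y (- n) z) * z powi (- n)) \<longlongrightarrow> 1) at_top" and 2: "((\<lambda>n. snd (Y (- n) z)) \<longlongrightarrow> 0) at_top"
    using Y z unfolding is_phi_def filterlim_at_bot_int by auto
  have "((\<lambda>m. Dp a b (- m - 1) * z\<^sup>2 * snd (Y (- m) z)) \<longlongrightarrow> 1 * z\<^sup>2 * 0) at_top"
    by (intro tendsto_intros 2 Dp_tendsto')
  then show "((\<lambda>m. fst (reverse_sol Y m z)) \<longlongrightarrow> 0) at_top" using zD by (simp add: reverse_sol_def)
  have "((\<lambda>m. Dp a b (- m - 1) * (fst (Y (- m) z) * z powi (- m))) \<longlongrightarrow> 1 * 1) at_top"
    by (intro tendsto_intros 1 Dp_tendsto')
  then show "((\<lambda>m. snd (reverse_sol Y m z) / z powi m) \<longlongrightarrow> 1) at_top"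
    using zD by (simp add: reverse_sol_def power_int_minus divide_inverse mult.assoc)
qed

text \<open>On \<open>DI\<close> the transformation \<open>reverse_sol\<close> is injective, since z
  and \<open>Dp a b\<close> do not vanish, so uniqueness of psi for the reflected pair transfers to
  phi.\<close>

lemma is_phi_unique: assumes Y: "is_phi Y" shows "Y = phiF"
proof (intro ext)
  have e: "reverse_sol Y = reverse_sol phiF"
    by (rule is_psi_unique[OF l1pair_summable(3) reverse_sol_is_psi[OF Y] reverse_sol_is_psi[OF phiF_is_phi]])
  fix n z
  show "Y n z = phiF n z"
  proof (cases "z \<in> DI")
    case False
    then show ?thesis using Y phiF_is_phi by (simp add: is_phi_def ext_in_def)
  next
    case True
    then have "z \<noteq> 0" by (auto simp: DI_def)
    then show ?thesis using fun_cong[OF fun_cong[OF e, of "- n"], of z] True Dp_nonzero[of "n - 1"]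
      by (simp add: reverse_sol_def prod_eq_iff)
  qed
qed

lemma jost_phi_eq: "jost_phi a b = phiF"
proof -
  have "jost_phi a b = (THE Y. is_phi Y)" by (simp add: jost_phi_def is_phi_def)
  also have "\<dots> = phiF"
    by (rule the_equality[where P = is_phi, OF phiF_is_phi is_phi_unique])
  finally show ?thesis .
qed

end

lemma jost_phib_eq: assumes "l1pair b a" shows "jost_phib a b = flip (jost_phi b a)"
proof -
  have *: "(ext_out Y \<and> (\<forall>z\<in>DO. is_sol a b Y z) \<and>
     (\<forall>z. norm z = 1 \<longrightarrow> ((\<lambda>n. fst (Y n z)) \<longlongrightarrow> 0) at_bot
                      \<and> ((\<lambda>n. snd (Y n z) / z powi n) \<longlongrightarrow> 1) at_bot)) \<longleftrightarrow> is_phi b a (flip Y)" for Y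
    unfolding is_phi_def[OF assms] ext_flip_iff[of Y] is_sol_flip ball_DO_flip[of "is_sol a b Y", symmetric]
    by (subst (2) norm1_flip[symmetric]) 
      (auto simp: flip_def power_int_inverse divide_inverse ball_DO_flip[of "\<lambda>z. is_sol a b Y (inverse z)", symmetric])
  show ?thesis
    unfolding jost_phib_def * 
  proof (rule the_equality)
    show "is_phi b a (flip (flip (jost_phi b a)))"
      using phiF_is_phi[OF assms] jost_phi_eq[OF assms] by simp
    fix Y assume "is_phi b a (flip Y)"
    then have "flip Y = jost_phi b a" using is_phi_unique[OF assms] jost_phi_eq[OF assms] by simp
    then show "Y = flip (jost_phi b a)" by (metis flip_flip)
  qed
qed

subsection \<open>Scattering on the unit circle\<close>

definition wronskian :: "complex \<times> complex \<Rightarrow> complex \<times> complex \<Rightarrow> complex" where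
  "wronskian X Y = fst X * snd Y - snd X * fst Y"

text \<open>The factor is the determinant of the transfer matrix, in which z and 1/z cancel.\<close>

lemma wronskian_step:
  assumes "is_sol a b X z" "is_sol a b Y z" "z \<noteq> 0"
  shows "wronskian (X n z) (Y n z) = (1 - a n * b n) * wronskian (X (n + 1) z) (Y (n + 1) z)"
proof -
  have X: "X n z = (z * fst (X (n + 1) z) + z * a n * snd (X (n + 1) z), b n * fst (X (n + 1) z) / z + snd (X (n + 1) z) / z)"
    and Y: "Y n z = (z * fst (Y (n + 1) z) + z * a n * snd (Y (n + 1) z), b n * fst (Y (n + 1) z) / z + snd (Y (n + 1) z) / z)"
    using assms(1,2)[unfolded is_sol_def, THEN spec, of n] by blast+
  show ?thesis unfolding wronskian_def X Y using assms(3) by (simp add: field_simps)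
qed

lemma wronskian_prod:
  assumes "is_sol a b X z" "is_sol a b Y z" "z \<noteq> 0"
  shows "wronskian (X 0 z) (Y 0 z) = (\<Prod>i<k. 1 - a (int i) * b (int i)) * wronskian (X (int k) z) (Y (int k) z)"
proof (induction k)
  case (Suc k)
  then show ?case using wronskian_step[OF assms, of "int k"] by (simp add: add.commute mult.assoc)
qed simp

text \<open>Moving left, zero propagates by the recursion itself; moving right needs the inverse
  transfer matrix, hence the nonvanishing determinants.\<close>

lemma sol_zero:
  assumes sol: "is_sol a b Y z" and z: "z \<noteq> 0" and nz: "\<And>n. 1 - a n * b n \<noteq> 0" and Y0: "Y 0 z = (0, 0)"
  shows "Y n z = (0, 0)"
proof (induction n rule: int_induct[where k = 0])
  case (step1 i)
  obtain x y where xy: "Y (i + 1) z = (x, y)" by fastforce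
  have "(0, 0) = (z * x + z * a i * y, b i * x / z + y / z)"
    using sol[unfolded is_sol_def, THEN spec, of i] step1 xy by simp
  then have "z * (x + a i * y) = 0" "(b i * x + y) / z = 0" by (auto simp: algebra_simps add_divide_distrib)
  then have e: "x + a i * y = 0" "b i * x + y = 0" using z by auto
  have "(1 - a i * b i) * y = (b i * x + y) - b i * (x + a i * y)"
    and "(1 - a i * b i) * x = (x + a i * y) - a i * (b i * x + y)" by (simp_all add: algebra_simps)
  then have "(1 - a i * b i) * y = 0" "(1 - a i * b i) * x = 0" unfolding e by simp_all
  then show ?case using nz[of i] xy by simp
next
  case (step2 i)
  then show ?case using sol[unfolded is_sol_def, THEN spec, of "i - 1"] by simp
qed (use Y0 in simp)

context fixes a b assumes ab: "l1pair a b" begin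


lemma circle_solutions:
  assumes "norm z = 1"
  shows "is_sol a b (psiF a b) z" "is_sol a b (flip (psiF b a)) z" "is_sol a b (phiF a b) z"
proof -
  have z: "z \<in> DI" "inverse z \<in> DI" using assms by (auto simp: DI_def norm_inverse)
  show "is_sol a b (psiF a b) z" by (rule psiF_sol[OF l1pair_summable(1)[OF ab] z(1)])
  show "is_sol a b (phiF a b) z" by (rule phiF_sol[OF ab z(1)])
  show "is_sol a b (flip (psiF b a)) z" unfolding is_sol_flip by (rule psiF_sol[OF l1pair_summable(2)[OF ab] z(2)])
qed

text \<open>The infinite product of 1 - a i * b i over i >= 0: the Wronskian of psi-bar and psi
  tends to 1 at +infinity. The value is therefore the same at every point of the unit circle, and z
  = 1 is only a convenient choice.\<close>

definition wronskian_0 :: complex where "wronskian_0 = wronskian (flip (psiF b a) 0 1) (psiF a b 0 1)"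

lemma wronskian_0: assumes z: "norm z = 1" shows "wronskian (flip (psiF b a) 0 z) (psiF a b 0 z) = wronskian_0" and wronskian_0_nonzero: "wronskian_0 \<noteq> 0"
proof -
  have *: "(\<lambda>k. \<Prod>i<k. 1 - a (int i) * b (int i)) \<longlonglongrightarrow> wronskian (flip (psiF b a) 0 z) (psiF a b 0 z)
      \<and> wronskian (flip (psiF b a) 0 z) (psiF a b 0 z) \<noteq> 0" if z: "norm z = 1" for z
  proof -
    have z0: "z \<noteq> 0" and zD: "z \<in> DI" "inverse z \<in> DI" using z by (auto simp: DI_def norm_inverse)
    have z2: "norm (z\<^sup>2) \<le> 1" "norm ((inverse z)\<^sup>2) \<le> 1" using z by (auto simp: norm_power norm_inverse)
    have eq: "wronskian (flip (psiF b a) n z) (psiF a b n z) = JP b a n ((inverse z)\<^sup>2) * JP a b n (z\<^sup>2) - JQ b a n ((inverse z)\<^sup>2) * JQ a b n (z\<^sup>2)" for n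
      using zD z0 by (simp add: wronskian_def flip_def psiF_def power_int_inverse power2_eq_square field_simps)
    have "((\<lambda>n. wronskian (flip (psiF b a) n z) (psiF a b n z)) \<longlongrightarrow> 1 * 1 - 0 * 0) at_top"
      unfolding eq by (intro tendsto_intros JP_tendsto JQ_tendsto l1pair_summable[OF ab] z2)
    then have lim: "((\<lambda>n. wronskian (flip (psiF b a) n z) (psiF a b n z)) \<longlongrightarrow> 1) at_top" by simp
    have limk: "(\<lambda>k. wronskian (flip (psiF b a) (int k) z) (psiF a b (int k) z)) \<longlonglongrightarrow> 1"
      using tendsto_at_top_intD[OF lim, of 0] by simp
    have W: "wronskian (flip (psiF b a) 0 z) (psiF a b 0 z) = (\<Prod>i<k. 1 - a (int i) * b (int i)) * wronskian (flip (psiF b a) (int k) z) (psiF a b (int k) z)" for k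
      by (rule wronskian_prod[OF circle_solutions(2)[OF z] circle_solutions(1)[OF z] z0])
    have ev: "eventually (\<lambda>k. wronskian (flip (psiF b a) (int k) z) (psiF a b (int k) z) \<noteq> 0) sequentially"
      by (rule tendsto_imp_eventually_ne[OF limk]) simp
    then obtain k where "wronskian (flip (psiF b a) (int k) z) (psiF a b (int k) z) \<noteq> 0" by (auto simp: eventually_sequentially)
    then have nz0: "wronskian (flip (psiF b a) 0 z) (psiF a b 0 z) \<noteq> 0" unfolding W[of k] using l1pair_nonzero[OF ab] by simp
    have "(\<lambda>k. wronskian (flip (psiF b a) 0 z) (psiF a b 0 z) / wronskian (flip (psiF b a) (int k) z) (psiF a b (int k) z)) \<longlonglongrightarrow> wronskian (flip (psiF b a) 0 z) (psiF a b 0 z) / 1"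
      by (intro tendsto_divide tendsto_const limk) simp
    moreover have "eventually (\<lambda>k. wronskian (flip (psiF b a) 0 z) (psiF a b 0 z) / wronskian (flip (psiF b a) (int k) z) (psiF a b (int k) z) = (\<Prod>i<k. 1 - a (int i) * b (int i))) sequentially"
      using ev
    proof eventually_elim
      case (elim k)
      then show ?case using W[of k] by (simp add: divide_eq_eq)
    qed
    ultimately have "(\<lambda>k. \<Prod>i<k. 1 - a (int i) * b (int i)) \<longlonglongrightarrow> wronskian (flip (psiF b a) 0 z) (psiF a b 0 z) / 1"
      by (rule Lim_transform_eventually)
    then show ?thesis using nz0 by simp
  qed
  show "wronskian (flip (psiF b a) 0 z) (psiF a b 0 z) = wronskian_0" unfolding wronskian_0_def using *[OF z] *[of 1] LIMSEQ_unique by auto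
  show "wronskian_0 \<noteq> 0" using *[of 1] unfolding wronskian_0_def by auto
qed

text \<open>\<open>\<phi> = scat_a * \<psi>b + scat_b * \<psi>\<close> on the unit circle, so \<open>scat_a = 1 / T\<close> and
  \<open>scat_b = R / T\<close>. Both are read off at \<open>n = 0\<close>, hence no limit \<open>n \<longrightarrow> \<infinity>\<close> of \<open>\<phi>\<close>
  has to be estimated.\<close>

definition scat_a :: "complex \<Rightarrow> complex" where "scat_a z = wronskian (phiF a b 0 z) (psiF a b 0 z) / wronskian_0"
definition scat_b :: "complex \<Rightarrow> complex" where "scat_b z = wronskian (flip (psiF b a) 0 z) (phiF a b 0 z) / wronskian_0"

text \<open>At n = 0 this is Cramer's rule for the basis psi-bar, psi. The difference of the two
  sides is a solution, and a solution that vanishes at n = 0 vanishes for all n.\<close>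

lemma scattering_relation:
  assumes z: "norm z = 1"
  shows "fst (phiF a b n z) = scat_a z * fst (flip (psiF b a) n z) + scat_b z * fst (psiF a b n z)"
    and "snd (phiF a b n z) = scat_a z * snd (flip (psiF b a) n z) + scat_b z * snd (psiF a b n z)"
proof -
  define D where "D n z = (fst (phiF a b n z) - scat_a z * fst (flip (psiF b a) n z) - scat_b z * fst (psiF a b n z),
     snd (phiF a b n z) - scat_a z * snd (flip (psiF b a) n z) - scat_b z * snd (psiF a b n z))" for n z
  have z0: "z \<noteq> 0" using z by auto
  have "is_sol a b D z" unfolding is_sol_def
  proof
    fix n
    note s = circle_solutions[OF z, unfolded is_sol_def, THEN spec, of n]
    show "D n z = (z * fst (D (n + 1) z) + z * a n * snd (D (n + 1) z), b n * fst (D (n + 1) z) / z + snd (D (n + 1) z) / z)"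
      unfolding D_def fst_conv snd_conv prod.inject
      by (subst (1 2) s(1), subst (1 2) s(2), subst (1 2) s(3)) (simp add: algebra_simps diff_divide_distrib add_divide_distrib)
  qed
  moreover have "D 0 z = (0, 0)"
  proof -
    have k: "wronskian (flip (psiF b a) 0 z) (psiF a b 0 z) \<noteq> 0" using wronskian_0[OF z] wronskian_0_nonzero[OF z] by simp
    have A: "scat_a z = wronskian (phiF a b 0 z) (psiF a b 0 z) / wronskian (flip (psiF b a) 0 z) (psiF a b 0 z)"
      and B: "scat_b z = wronskian (flip (psiF b a) 0 z) (phiF a b 0 z) / wronskian (flip (psiF b a) 0 z) (psiF a b 0 z)" unfolding scat_a_def scat_b_def wronskian_0[OF z] by auto
    have A': "scat_a z * wronskian (flip (psiF b a) 0 z) (psiF a b 0 z) = wronskian (phiF a b 0 z) (psiF a b 0 z)"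
      and B': "scat_b z * wronskian (flip (psiF b a) 0 z) (psiF a b 0 z) = wronskian (flip (psiF b a) 0 z) (phiF a b 0 z)" unfolding A B using k by auto
    have "wronskian (flip (psiF b a) 0 z) (psiF a b 0 z) * fst (D 0 z) = wronskian (flip (psiF b a) 0 z) (psiF a b 0 z) * fst (phiF a b 0 z)
        - (scat_a z * wronskian (flip (psiF b a) 0 z) (psiF a b 0 z)) * fst (flip (psiF b a) 0 z) - (scat_b z * wronskian (flip (psiF b a) 0 z) (psiF a b 0 z)) * fst (psiF a b 0 z)"
      by (simp add: D_def algebra_simps)
    also have "\<dots> = 0" unfolding A' B' by (simp add: wronskian_def algebra_simps)
    finally have 1: "fst (D 0 z) = 0" using k by simp
    have "wronskian (flip (psiF b a) 0 z) (psiF a b 0 z) * snd (D 0 z) = wronskian (flip (psiF b a) 0 z) (psiF a b 0 z) * snd (phiF a b 0 z)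
        - (scat_a z * wronskian (flip (psiF b a) 0 z) (psiF a b 0 z)) * snd (flip (psiF b a) 0 z) - (scat_b z * wronskian (flip (psiF b a) 0 z) (psiF a b 0 z)) * snd (psiF a b 0 z)"
      by (simp add: D_def algebra_simps)
    also have "\<dots> = 0" unfolding A' B' by (simp add: wronskian_def algebra_simps)
    finally have 2: "snd (D 0 z) = 0" using k by simp
    from 1 2 show ?thesis by (simp add: prod_eq_iff)
  qed
  ultimately have "D n z = (0, 0)" using sol_zero z0 l1pair_nonzero[OF ab] by blast
  then show "fst (phiF a b n z) = scat_a z * fst (flip (psiF b a) n z) + scat_b z * fst (psiF a b n z)"
    and "snd (phiF a b n z) = scat_a z * snd (flip (psiF b a) n z) + scat_b z * snd (psiF a b n z)" by (simp_all add: D_def algebra_simps)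
qed

lemma psib_limits:
  assumes z: "norm z = 1"
  shows "((\<lambda>n. fst (flip (psiF b a) n z) * z powi n) \<longlongrightarrow> 1) at_top" "((\<lambda>n. snd (flip (psiF b a) n z)) \<longlongrightarrow> 0) at_top"
proof -
  have "norm (inverse z) = 1" using z by (simp add: norm_inverse)
  with psiF_is_psi[OF l1pair_summable(2)[OF ab]] 
  have "((\<lambda>n. fst (psiF b a n (inverse z))) \<longlongrightarrow> 0) at_top" "((\<lambda>n. snd (psiF b a n (inverse z)) / (inverse z) powi n) \<longlongrightarrow> 1) at_top"
    unfolding is_psi_def by blast+
  then show "((\<lambda>n. fst (flip (psiF b a) n z) * z powi n) \<longlongrightarrow> 1) at_top" "((\<lambda>n. snd (flip (psiF b a) n z)) \<longlongrightarrow> 0) at_top"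
    by (simp_all add: flip_def power_int_inverse divide_inverse)
qed

lemma psi_limits:
  assumes z: "norm z = 1"
  shows "((\<lambda>n. fst (psiF a b n z)) \<longlongrightarrow> 0) at_top" "((\<lambda>n. snd (psiF a b n z) / z powi n) \<longlongrightarrow> 1) at_top"
  using psiF_is_psi[OF l1pair_summable(1)[OF ab]] z by (simp_all add: is_psi_def)

lemma tendsto_mult_powi_zero:
  assumes "norm (z::complex) = 1" "(f \<longlongrightarrow> 0) F" shows "((\<lambda>n. f n * z powi n) \<longlongrightarrow> 0) F" "((\<lambda>n. f n / z powi n) \<longlongrightarrow> 0) F"
proof -
  note n = tendsto_norm_zero[OF assms(2)]
  show "((\<lambda>n. f n * z powi n) \<longlongrightarrow> 0) F"
    by (rule tendsto_norm_zero_cancel) (use n in \<open>simp add: norm_mult norm_powi_1[OF assms(1)]\<close>)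
  show "((\<lambda>n. f n / z powi n) \<longlongrightarrow> 0) F"
    by (rule tendsto_norm_zero_cancel) (use n in \<open>simp add: norm_divide norm_powi_1[OF assms(1)]\<close>)
qed

lemma inv_Tr_eq: assumes z: "norm z = 1" shows "inv_Tr a b z = scat_a z"
proof -
  have "((\<lambda>n. scat_a z * (fst (flip (psiF b a) n z) * z powi n) + scat_b z * (fst (psiF a b n z) * z powi n)) \<longlongrightarrow> scat_a z * 1 + scat_b z * 0) at_top"
    by (intro tendsto_intros psib_limits[OF z] tendsto_mult_powi_zero[OF z] psi_limits[OF z])
  then have "((\<lambda>n. fst (phiF a b n z) * z powi n) \<longlongrightarrow> scat_a z) at_top"
    by (simp add: scattering_relation[OF z] algebra_simps)
  then show ?thesis unfolding inv_Tr_def jost_phi_eq[OF ab] by (intro tendsto_Lim) simp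
qed

lemma Rr_eq: assumes z: "norm z = 1" shows "Rr a b z = scat_b z / scat_a z"
proof -
  have "((\<lambda>n. scat_a z * (snd (flip (psiF b a) n z) / z powi n) + scat_b z * (snd (psiF a b n z) / z powi n)) \<longlongrightarrow> scat_a z * 0 + scat_b z * 1) at_top"
    by (intro tendsto_intros psib_limits[OF z] tendsto_mult_powi_zero[OF z] psi_limits[OF z])
  then have "((\<lambda>n. snd (phiF a b n z) / z powi n) \<longlongrightarrow> scat_b z) at_top"
    by (simp add: scattering_relation[OF z] add_divide_distrib)
  then have "Lim at_top (\<lambda>n. snd (phiF a b n z) / z powi n) = scat_b z" by (intro tendsto_Lim) simp
  then show ?thesis unfolding Rr_def Tr_def inv_Tr_eq[OF z] jost_phi_eq[OF ab] by simp
qed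

lemma circle_identity:
  assumes z: "norm z = 1" and A: "scat_a z \<noteq> 0"
  shows "fst (phiF a b n z) / scat_a z = fst (flip (psiF b a) n z) + Rr a b z * fst (psiF a b n z)"
    and "snd (phiF a b n z) / scat_a z = snd (flip (psiF b a) n z) + Rr a b z * snd (psiF a b n z)"
  unfolding Rr_eq[OF z] scattering_relation[OF z] using A by (simp_all add: field_simps)

section \<open>Continuity on the circle and the extension of 1/T to the disc\<close>

lemma Jost_continuous:
  "continuous_on DI (psiF a b n)" "continuous_on DI (phiF a b n)" "continuous_on DO (flip (psiF b a) n)"
  using psiF_is_psi[OF l1pair_summable(1)[OF ab]] phiF_is_phi[OF ab] ext_in_flip[of "psiF b a"] psiF_ext_in[OF l1pair_summable(2)[OF ab]]
  by (auto simp: is_psi_def is_phi_def[OF ab] ext_in_def ext_out_def)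

lemma scat_a_continuous: "continuous_on (sphere 0 1) scat_a"
proof -
  have "sphere 0 1 \<subseteq> DI" by (auto simp: DI_def)
  then show ?thesis unfolding scat_a_def wronskian_def
    by (intro continuous_intros Jost_continuous[THEN continuous_on_subset]) (auto simp: wronskian_0_nonzero[of 1])
qed

lemma scat_b_continuous: "continuous_on (sphere 0 1) scat_b"
proof -
  have "sphere 0 1 \<subseteq> DI" "sphere 0 1 \<subseteq> DO" by (auto simp: DI_def DO_def)
  then show ?thesis unfolding scat_b_def wronskian_def
    by (intro continuous_intros Jost_continuous[THEN continuous_on_subset]) (auto simp: wronskian_0_nonzero[of 1])
qed

lemma Rr_continuous:
  assumes "\<And>z. norm z = 1 \<Longrightarrow> inv_Tr a b z \<noteq> 0" shows "continuous_on (sphere 0 1) (Rr a b)"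
proof -
  have "continuous_on (sphere 0 1) (\<lambda>z. scat_b z / scat_a z)"
    by (intro continuous_intros scat_a_continuous scat_b_continuous) (use assms inv_Tr_eq in auto)
  then show ?thesis by (rule continuous_on_eq) (simp add: Rr_eq)
qed

text \<open>The Wronskian of phi and psi at n = 0, where the powers z^n and z^(-n) disappear: the
  formula makes sense at z = 0 and is even in z. The value 0 outside the disc is the one demanded in
  \<open>inv_Tr_ext\<close>.\<close>

definition scat_a_ext :: "complex \<Rightarrow> complex" where
  "scat_a_ext z = (if norm z \<le> 1 then (JP (reflect b) (reflect a) 0 (z\<^sup>2) * JP a b 0 (z\<^sup>2)
     - JQ (reflect b) (reflect a) 0 (z\<^sup>2) * (z\<^sup>2 * JQ a b 0 (z\<^sup>2))) / (Dp a b (- 1) * wronskian_0) else 0)"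

lemma scat_a_ext_DI: "z \<in> DI \<Longrightarrow> scat_a_ext z = wronskian (phiF a b 0 z) (psiF a b 0 z) / wronskian_0"
  by (auto simp: scat_a_ext_def wronskian_def phiF_def[OF ab] psiF_def DI_def diff_divide_distrib)

lemma scat_a_ext_circle: "norm z = 1 \<Longrightarrow> scat_a_ext z = scat_a z"
  unfolding scat_a_def by (rule scat_a_ext_DI) (auto simp: DI_def)

lemma scat_a_ext_0: "scat_a_ext 0 \<noteq> 0" by (simp add: scat_a_ext_def Dp_nonzero[OF ab] wronskian_0_nonzero[of 1])

lemma scat_a_ext_minus: "scat_a_ext (- z) = scat_a_ext z" by (simp add: scat_a_ext_def)

lemma scat_a_ext_holomorphic: "scat_a_ext holomorphic_on ball 0 1"
proof -
  have "(\<lambda>z. (JP (reflect b) (reflect a) 0 (z\<^sup>2) * JP a b 0 (z\<^sup>2)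
     - JQ (reflect b) (reflect a) 0 (z\<^sup>2) * (z\<^sup>2 * JQ a b 0 (z\<^sup>2))) / (Dp a b (- 1) * wronskian_0)) holomorphic_on ball 0 1"
    by (intro holomorphic_intros JP2_holomorphic JQ2_holomorphic l1pair_summable[OF ab]) (simp add: Dp_nonzero[OF ab] wronskian_0_nonzero[of 1])
  then show ?thesis by (rule holomorphic_transform) (auto simp: scat_a_ext_def)
qed

lemma scat_a_ext_continuous: "continuous_on (cball 0 1) scat_a_ext"
proof -
  have "continuous_on (cball 0 1) (\<lambda>z. (JP (reflect b) (reflect a) 0 (z\<^sup>2) * JP a b 0 (z\<^sup>2)
     - JQ (reflect b) (reflect a) 0 (z\<^sup>2) * (z\<^sup>2 * JQ a b 0 (z\<^sup>2))) / (Dp a b (- 1) * wronskian_0))"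
    by (intro continuous_intros JP2_continuous JQ2_continuous l1pair_summable[OF ab]) (simp add: Dp_nonzero[OF ab] wronskian_0_nonzero[of 1])
  then show ?thesis by (rule continuous_on_eq) (auto simp: scat_a_ext_def)
qed

definition "is_ext g \<longleftrightarrow> g holomorphic_on ball 0 1 \<and> continuous_on (cball 0 1) g
      \<and> (\<forall>z. norm z = 1 \<longrightarrow> g z = inv_Tr a b z) \<and> (\<forall>z. 1 < norm z \<longrightarrow> g z = 0)"

lemma scat_a_ext_is_ext: "is_ext scat_a_ext"
  unfolding is_ext_def using scat_a_ext_holomorphic scat_a_ext_continuous by (auto simp: scat_a_ext_circle inv_Tr_eq) (simp add: scat_a_ext_def)

lemma is_ext_unique: assumes g: "is_ext g" shows "g = scat_a_ext"
proof
  fix z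
  define f where "f z = g z - scat_a_ext z" for z
  have h: "f holomorphic_on ball 0 1" unfolding f_def
    by (intro holomorphic_intros scat_a_ext_holomorphic) (use g in \<open>simp add: is_ext_def\<close>)
  have c: "continuous_on (cball 0 1) f" unfolding f_def
    by (intro continuous_intros scat_a_ext_continuous) (use g in \<open>simp add: is_ext_def\<close>)
  have DI: "f z = 0" if "z \<in> DI" for z
    by (rule boundary_vanish[OF holomorphic_on_subset[OF h] continuous_on_subset[OF c] _ that])
      (use g in \<open>auto simp: f_def is_ext_def inv_Tr_eq scat_a_ext_circle DI_def\<close>)
  \<comment> \<open>\<open>boundary_vanish\<close> covers only the punctured disc; at the origin
    continuity decides.\<close>
  have "f \<midarrow>0\<rightarrow> f 0" using h holomorphic_on_imp_continuous_on[OF h] by (simp add: continuous_on_eq_continuous_at isCont_def)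
  moreover have "f \<midarrow>0\<rightarrow> 0"
  proof (rule tendsto_eventually)
    have "eventually (\<lambda>z::complex. z \<in> ball 0 1 - {0}) (at 0)" by (intro eventually_at_in_open) auto
    then show "eventually (\<lambda>z. f z = 0) (at 0)" by eventually_elim (rule DI, auto simp: DI_def)
  qed
  ultimately have "f 0 = 0" by (rule LIM_unique)
  with DI[of z] show "g z = scat_a_ext z"
  proof (cases "norm z \<le> 1")
    case False then show ?thesis using g by (simp add: is_ext_def scat_a_ext_def)
  qed (auto simp: f_def DI_def)
qed

lemma inv_Tr_ext_eq: "inv_Tr_ext a b = scat_a_ext"
proof -
  have "inv_Tr_ext a b = (THE g. is_ext g)" by (simp add: inv_Tr_ext_def is_ext_def)
  also have "\<dots> = scat_a_ext" by (rule the_equality[where P = is_ext, OF scat_a_ext_is_ext is_ext_unique])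
  finally show ?thesis .
qed

lemma Tr_ext_eq: "Tr_ext a b z = 1 / scat_a_ext z" by (simp add: Tr_ext_def inv_Tr_ext_eq)

end

subsection \<open>Principal parts, dependency constants and residues\<close>

definition taylor_coeff :: "(complex \<Rightarrow> complex) \<Rightarrow> complex \<Rightarrow> nat \<Rightarrow> complex" where
  "taylor_coeff f z k = (deriv ^^ k) f z / fact k"

lemma taylor_coeff_0 [simp]: "taylor_coeff f z 0 = f z" by (simp add: taylor_coeff_def)

lemma taylor_coeff_mult:
  assumes "f analytic_on {z}" "g analytic_on {z}"
  shows "taylor_coeff (\<lambda>w. f w * g w) z k = (\<Sum>i\<le>k. taylor_coeff f z i * taylor_coeff g z (k - i))"
proof -
  have "taylor_coeff (\<lambda>w. f w * g w) z k = (\<Sum>i\<le>k. of_nat (k choose i) * (deriv ^^ i) f z * (deriv ^^ (k - i)) g z / fact k)"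
    unfolding taylor_coeff_def higher_deriv_mult_at[OF assms] by (simp add: sum_divide_distrib atMost_atLeast0)
  also have "\<dots> = (\<Sum>i\<le>k. taylor_coeff f z i * taylor_coeff g z (k - i))"
    unfolding taylor_coeff_def by (intro sum.cong refl) (simp add: binomial_fact field_simps)
  finally show ?thesis .
qed

lemma taylor_coeff_cong: assumes "eventually (\<lambda>w. f w = g w) (nhds z)" shows "taylor_coeff f z k = taylor_coeff g z k"
  unfolding taylor_coeff_def using higher_deriv_cong_ev[OF assms refl] by simp

lemma residue_over_power:
  assumes "H analytic_on {z}"
  shows "residue (\<lambda>w. H w / (w - z) ^ m) z = (if m = 0 then 0 else taylor_coeff H z (m - 1))"
proof -
  obtain S where S: "open S" "z \<in> S" "H holomorphic_on S" using assms by (auto simp: analytic_at)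
  show ?thesis
  proof (cases m)
    case 0 then show ?thesis using residue_holo[OF S] by simp
  next
    case (Suc n) then show ?thesis using residue_holomorphic_over_power[OF S, of n] by (simp add: taylor_coeff_def)
  qed
qed

text \<open>A local normal form from which the multiplicity, the Laurent coefficients
  \<open>tres\<close> and all residues of T times an analytic function can be read off as Taylor
  data of H.\<close>

definition pole_factor :: "(complex \<Rightarrow> complex) \<Rightarrow> complex \<Rightarrow> nat \<Rightarrow> (complex \<Rightarrow> complex) \<Rightarrow> bool" where
  "pole_factor T z m H \<longleftrightarrow> 0 < m \<and> H analytic_on {z} \<and> H z \<noteq> 0 \<and> (\<forall>\<^sub>F w in at z. T w = H w / (w - z) ^ m)"

lemma pole_factor_is_pole: assumes "pole_factor T z m H" shows "is_pole T z"
proof -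
  obtain S where S: "open S" "z \<in> S" "H holomorphic_on S" using assms by (auto simp: pole_factor_def analytic_at)
  have "is_pole (\<lambda>w. H w / (w - z) ^ m) z" using assms S by (intro is_pole_basic[of H S]) (auto simp: pole_factor_def)
  moreover have "is_pole T z \<longleftrightarrow> is_pole (\<lambda>w. H w / (w - z) ^ m) z"
    using assms by (intro is_pole_cong) (auto simp: pole_factor_def)
  ultimately show ?thesis by simp
qed

lemma pole_factor_mult: assumes "pole_factor T z m H" shows "mult T z = m"
proof -
  obtain S where S: "open S" "z \<in> S" "H holomorphic_on S" using assms by (auto simp: pole_factor_def analytic_at)
  have "zorder (\<lambda>w. H w / (w - z) ^ m) z = - int m"
    by (rule zorder_eqI[OF S(1,2,3)]) (use assms in \<open>auto simp: pole_factor_def power_int_minus divide_inverse\<close>)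
  moreover have "zorder T z = zorder (\<lambda>w. H w / (w - z) ^ m) z"
    using assms by (intro zorder_cong) (auto simp: pole_factor_def)
  ultimately show ?thesis by (simp add: mult_def)
qed

lemma pole_factor_tres:
  assumes "pole_factor T z m H" "1 \<le> k" shows "tres T z k = (if k \<le> m then taylor_coeff H z (m - k) else 0)"
proof -
  have H: "H analytic_on {z}" and T: "\<forall>\<^sub>F w in at z. T w = H w / (w - z) ^ m" using assms by (auto simp: pole_factor_def)
  have ne: "eventually (\<lambda>w. w \<noteq> z) (at z)" by (simp add: eventually_at_filter)
  show ?thesis
  proof (cases "k \<le> m")
    case True
    have "tres T z k = residue (\<lambda>w. H w / (w - z) ^ (m - (k - 1))) z"
      unfolding tres_def
    proof (rule residue_cong[OF _ refl])
      show "\<forall>\<^sub>F w in at z. (w - z) ^ (k - 1) * T w = H w / (w - z) ^ (m - (k - 1))"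
        using T ne by eventually_elim (use True in \<open>simp add: power_diff\<close>)
    qed
    then show ?thesis using True assms(2) by (simp add: residue_over_power[OF H])
  next
    case False
    have "tres T z k = residue (\<lambda>w. (H w * (w - z) ^ (k - 1 - m)) / (w - z) ^ 0) z"
      unfolding tres_def
    proof (rule residue_cong[OF _ refl])
      show "\<forall>\<^sub>F w in at z. (w - z) ^ (k - 1) * T w = (H w * (w - z) ^ (k - 1 - m)) / (w - z) ^ 0"
        using T ne by eventually_elim (use False in \<open>simp add: power_diff\<close>)
    qed
    also have "\<dots> = 0" by (subst residue_over_power) (auto intro!: analytic_intros H)
    finally show ?thesis using False by simp
  qed
qed

text \<open>Cauchy product of the Taylor expansions of h and H, at the coefficient of order m - 1;
  the coefficients of H are the Laurent coefficients of T in reverse order.\<close>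

lemma pole_factor_residue:
  assumes P: "pole_factor T z m H" and h: "h analytic_on {z}"
  shows "residue (\<lambda>w. T w * h w) z = (\<Sum>k<m. tres T z (k + 1) * taylor_coeff h z k)"
proof -
  have H: "H analytic_on {z}" and T: "\<forall>\<^sub>F w in at z. T w = H w / (w - z) ^ m" and m: "0 < m"
    using P by (auto simp: pole_factor_def)
  have "residue (\<lambda>w. T w * h w) z = residue (\<lambda>w. (h w * H w) / (w - z) ^ m) z"
    by (rule residue_cong[OF _ refl]) (use T in eventually_elim, simp)
  also have "\<dots> = (\<Sum>k\<le>m - 1. taylor_coeff h z k * taylor_coeff H z (m - 1 - k))"
    using m taylor_coeff_mult[OF h H, of "m - 1"] by (subst residue_over_power) (auto intro!: analytic_intros H h)
  also have "\<dots> = (\<Sum>k<m. tres T z (k + 1) * taylor_coeff h z k)"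
    using m by (intro sum.cong) (auto simp: pole_factor_tres[OF P])
  finally show ?thesis .
qed

lemma higher_deriv_power_int:
  fixes p :: int
  assumes "z \<noteq> 0"
  shows "(deriv ^^ i) (\<lambda>w::complex. w powi p) z = fact i * (of_int p gchoose i) * z powi (p - int i)"
  using assms
proof (induction i arbitrary: z)
  case (Suc i)
  have "(deriv ^^ Suc i) (\<lambda>w. w powi p) z = deriv ((deriv ^^ i) (\<lambda>w. w powi p)) z" by simp
  also have "\<dots> = deriv (\<lambda>z. fact i * (of_int p gchoose i) * z powi (p - int i)) z"
  proof (rule deriv_cong_ev[OF _ refl])
    have "eventually (\<lambda>x. x \<in> - {0}) (nhds z)" by (rule eventually_nhds_in_open) (use Suc.prems in auto)
    then show "\<forall>\<^sub>F x in nhds z. (deriv ^^ i) (\<lambda>w. w powi p) x = fact i * (of_int p gchoose i) * x powi (p - int i)"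
      by eventually_elim (rule Suc.IH, auto)
  qed
  also have "\<dots> = fact i * (of_int p gchoose i) * (of_int (p - int i) * z powi (p - int i - 1))"
    by (intro DERIV_imp_deriv DERIV_cmult) (use Suc.prems in \<open>auto intro!: derivative_eq_intros\<close>)
  also have "\<dots> = fact (Suc i) * (of_int p gchoose (Suc i)) * z powi (p - int (Suc i))"
  proof -
    have "of_nat (Suc i) * (of_int p gchoose (Suc i)) = (of_int p - of_nat i) * (of_int p gchoose i :: complex)"
      by (metis gbinomial_absorb_comp gbinomial_absorption)
    then have e: "(of_nat i + 1) * (of_int p gchoose (Suc i)) = (of_int p - of_nat i) * (of_int p gchoose i :: complex)" by (simp add: add.commute)
    have "fact (Suc i) * (of_int p gchoose (Suc i)) * z powi (p - int (Suc i))
      = fact i * ((of_nat i + 1) * (of_int p gchoose (Suc i))) * z powi (p - int (Suc i))"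
      by (simp add: algebra_simps)
    then show ?thesis unfolding e by (simp add: algebra_simps)
  qed
  finally show ?case .
qed simp

lemma taylor_coeff_power_int:
  "z \<noteq> 0 \<Longrightarrow> taylor_coeff (\<lambda>w. w powi p) z i = (of_int p gchoose i) * z powi (p - int i)"
  by (simp add: taylor_coeff_def higher_deriv_power_int)

lemma power_int_analytic: "z \<noteq> 0 \<Longrightarrow> (\<lambda>w. w powi p) analytic_on {z}"
  unfolding analytic_at by (intro exI[of _ "- {0}"]) (auto intro!: holomorphic_intros)

text \<open>For a single Jordan block the left-hand side is C A^p B up to the factor -2 or 2. The
  norming constants pair the Laurent coefficients of T with Taylor coefficients of G, and
  \<open>(of_int p gchoose k) * z powi (p - int k)\<close> is a Taylor coefficient of w^p. Grouping
  by j = k + l turns the double sum into the product expansion of G w * w^p, paired with T.\<close>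

lemma norming_sum:
  assumes P: "pole_factor T z m H" and G: "G analytic_on {z}" and z: "z \<noteq> 0"
  shows "(\<Sum>k<m. (\<Sum>l\<in>{0..m - 1 - k}. tres T z (k + 1 + l) * (if l < m then (deriv ^^ l) G z else 0) / fact l)
       * (of_int p gchoose k) * z powi (p - int k))
    = residue (\<lambda>w. T w * (G w * w powi p)) z"
proof -
  let ?q = "\<lambda>k. (of_int p gchoose k) * z powi (p - int k)"
  have "(\<Sum>k<m. (\<Sum>l\<in>{0..m - 1 - k}. tres T z (k + 1 + l) * (if l < m then (deriv ^^ l) G z else 0) / fact l)
       * (of_int p gchoose k) * z powi (p - int k))
     = (\<Sum>k<m. \<Sum>l<m - k. tres T z (k + l + 1) * (taylor_coeff G z l * ?q k))"
  proof (intro sum.cong refl)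
    fix k assume k: "k \<in> {..<m}"
    then have e: "{0..m - 1 - k} = {..<m - k}" by auto
    show "(\<Sum>l\<in>{0..m - 1 - k}. tres T z (k + 1 + l) * (if l < m then (deriv ^^ l) G z else 0) / fact l)
       * (of_int p gchoose k) * z powi (p - int k) = (\<Sum>l<m - k. tres T z (k + l + 1) * (taylor_coeff G z l * ?q k))"
      unfolding e sum_distrib_right by (intro sum.cong refl) (auto simp: taylor_coeff_def)
  qed
  also have "\<dots> = (\<Sum>(k, l)\<in>(SIGMA k:{..<m}. {..<m - k}). tres T z (k + l + 1) * (taylor_coeff G z l * ?q k))"
    by (subst sum.Sigma) auto
  also have "(SIGMA k:{..<m}. {..<m - k}) = {(k, l). k + l < m}" by auto
  also have "(\<Sum>(k, l)\<in>{(k, l). k + l < m}. tres T z (k + l + 1) * (taylor_coeff G z l * ?q k))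
      = (\<Sum>j<m. \<Sum>k\<le>j. tres T z (k + (j - k) + 1) * (taylor_coeff G z (j - k) * ?q k))"
    by (rule sum.triangle_reindex)
  also have "\<dots> = (\<Sum>j<m. tres T z (j + 1) * (\<Sum>k\<le>j. ?q k * taylor_coeff G z (j - k)))"
    unfolding sum_distrib_left by (intro sum.cong refl) (auto simp: mult_ac)
  also have "\<dots> = (\<Sum>j<m. tres T z (j + 1) * taylor_coeff (\<lambda>w. G w * w powi p) z j)"
    using taylor_coeff_mult[OF power_int_analytic[OF z, of p] G] by (simp add: taylor_coeff_power_int[OF z] mult.commute)
  also have "\<dots> = residue (\<lambda>w. T w * (G w * w powi p)) z"
    by (rule pole_factor_residue[OF P, symmetric]) (intro analytic_intros G power_int_analytic z)
  finally show ?thesis .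
qed

text \<open>Divisibility by (w - z)^m among germs at z. Thus m is only a lower bound for the order,
  the zero germ is included, and such germs form an ideal, which is what the propagation along the
  recursion uses.\<close>

definition vanish_order :: "nat \<Rightarrow> complex \<Rightarrow> (complex \<Rightarrow> complex) \<Rightarrow> bool" where
  "vanish_order m z f \<longleftrightarrow> (\<exists>h. h analytic_on {z} \<and> (\<forall>\<^sub>F w in nhds z. f w = (w - z) ^ m * h w))"

lemma vanish_order_cong: "vanish_order m z f \<Longrightarrow> (\<forall>\<^sub>F w in nhds z. f w = g w) \<Longrightarrow> vanish_order m z g"
proof -
  assume "vanish_order m z f" and e: "\<forall>\<^sub>F w in nhds z. f w = g w"
  then obtain h where h: "h analytic_on {z}" "\<forall>\<^sub>F w in nhds z. f w = (w - z) ^ m * h w" by (auto simp: vanish_order_def)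
  have "\<forall>\<^sub>F w in nhds z. g w = (w - z) ^ m * h w" using h(2) e by eventually_elim simp
  with h(1) show "vanish_order m z g" by (auto simp: vanish_order_def)
qed

lemma vanish_order_add: assumes "vanish_order m z f" "vanish_order m z g" shows "vanish_order m z (\<lambda>w. f w + g w)"
proof -
  obtain h where h: "h analytic_on {z}" "\<forall>\<^sub>F w in nhds z. f w = (w - z) ^ m * h w" using assms by (auto simp: vanish_order_def)
  obtain k where k: "k analytic_on {z}" "\<forall>\<^sub>F w in nhds z. g w = (w - z) ^ m * k w" using assms by (auto simp: vanish_order_def)
  have "\<forall>\<^sub>F w in nhds z. f w + g w = (w - z) ^ m * (h w + k w)" using h(2) k(2) by eventually_elim (simp add: algebra_simps)
  with h k show ?thesis unfolding vanish_order_def by (intro exI[of _ "\<lambda>w. h w + k w"]) (auto intro: analytic_intros)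
qed

lemma vanish_order_mult: assumes "vanish_order m z f" "g analytic_on {z}" shows "vanish_order m z (\<lambda>w. g w * f w)"
proof -
  obtain h where h: "h analytic_on {z}" "\<forall>\<^sub>F w in nhds z. f w = (w - z) ^ m * h w" using assms by (auto simp: vanish_order_def)
  have "\<forall>\<^sub>F w in nhds z. g w * f w = (w - z) ^ m * (g w * h w)" using h(2) by eventually_elim (simp add: algebra_simps)
  with h assms(2) show ?thesis unfolding vanish_order_def by (intro exI[of _ "\<lambda>w. g w * h w"]) (auto intro: analytic_intros)
qed

lemma vanish_order_0: "vanish_order m z (\<lambda>_. 0)"
  unfolding vanish_order_def by (intro exI[of _ "\<lambda>_. 0"]) auto

lemma vanish_order_residue: assumes P: "pole_factor T z m H" and f: "vanish_order m z f" shows "residue (\<lambda>w. T w * f w) z = 0"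
proof -
  obtain h where h: "h analytic_on {z}" "\<forall>\<^sub>F w in nhds z. f w = (w - z) ^ m * h w" using f by (auto simp: vanish_order_def)
  have H: "H analytic_on {z}" and T: "\<forall>\<^sub>F w in at z. T w = H w / (w - z) ^ m"
    using P by (auto simp: pole_factor_def)
  have h2: "\<forall>\<^sub>F w in at z. f w = (w - z) ^ m * h w" using h(2) by (simp add: eventually_at_filter eventually_mono)
  have ne: "eventually (\<lambda>w. w \<noteq> z) (at z)" by (simp add: eventually_at_filter)
  have "residue (\<lambda>w. T w * f w) z = residue (\<lambda>w. (H w * h w) / (w - z) ^ 0) z"
    by (rule residue_cong[OF _ refl]) (use T h2 ne in eventually_elim, simp)
  also have "\<dots> = 0" by (subst residue_over_power) (auto intro!: analytic_intros H h)
  finally show ?thesis .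
qed

lemma vanish_order_deriv: assumes "vanish_order m z f" "k < m" shows "(deriv ^^ k) f z = 0"
proof -
  obtain h where h: "h analytic_on {z}" "\<forall>\<^sub>F w in nhds z. f w = (w - z) ^ m * h w" using assms by (auto simp: vanish_order_def)
  have "taylor_coeff f z k = taylor_coeff (\<lambda>w. (w - z) ^ m * h w) z k" by (rule taylor_coeff_cong[OF h(2)])
  also have "\<dots> = (\<Sum>i\<le>k. taylor_coeff (\<lambda>w. (w - z) ^ m) z i * taylor_coeff h z (k - i))"
    by (rule taylor_coeff_mult) (auto intro!: analytic_intros h)
  also have "\<dots> = 0"
    by (rule sum.neutral) (use assms(2) in \<open>auto simp: taylor_coeff_def higher_deriv_power\<close>)
  finally show ?thesis by (simp add: taylor_coeff_def)
qed

text \<open>Existence: the derivatives of Phi - G Psi of order below m vanish at z, and Leibniz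
  gives the defining relations. Uniqueness: these relations are triangular in the constants, with a
  nonzero component of \<open>Psi n0 z\<close> on the diagonal; setting them to 0 from index m on
  fixes the rest.\<close>

lemma dep_eq:
  assumes an: "\<And>n. (\<lambda>w. fst (Psi n w)) analytic_on {z}" "\<And>n. (\<lambda>w. snd (Psi n w)) analytic_on {z}"
      "\<And>n. (\<lambda>w. fst (Phi n w)) analytic_on {z}" "\<And>n. (\<lambda>w. snd (Phi n w)) analytic_on {z}"
    and G: "G analytic_on {z}"
    and d1: "\<And>n. vanish_order m z (\<lambda>w. fst (Phi n w) - G w * fst (Psi n w))"
    and d2: "\<And>n. vanish_order m z (\<lambda>w. snd (Phi n w) - G w * snd (Psi n w))"
    and nz: "Psi n0 z \<noteq> (0, 0)"
  shows "dep Phi Psi m z = (\<lambda>l. if l < m then (deriv ^^ l) G z else 0)"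
proof -
  let ?g = "\<lambda>l. if l < m then (deriv ^^ l) G z else 0"
  let ?R = "\<lambda>(f :: complex \<times> complex \<Rightarrow> complex) g k n. (deriv ^^ k) (\<lambda>w. f (Phi n w)) z
        = (\<Sum>l\<le>k. of_nat (k choose l) * g (k - l) * (deriv ^^ l) (\<lambda>w. f (Psi n w)) z)"
  have ex: "?R f ?g k n" if k: "k < m" and f: "(\<lambda>w. f (Psi n w)) analytic_on {z}" "(\<lambda>w. f (Phi n w)) analytic_on {z}"
      and d: "vanish_order m z (\<lambda>w. f (Phi n w) - G w * f (Psi n w))" for f :: "complex \<times> complex \<Rightarrow> complex" and k n
  proof -
    have GP: "(\<lambda>w. G w * f (Psi n w)) analytic_on {z}" by (intro analytic_intros G f)
    have "0 = (deriv ^^ k) (\<lambda>w. f (Phi n w) - G w * f (Psi n w)) z" using vanish_order_deriv[OF d k] by simp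
    also have "\<dots> = (deriv ^^ k) (\<lambda>w. f (Phi n w)) z - (deriv ^^ k) (\<lambda>w. G w * f (Psi n w)) z"
      by (rule higher_deriv_diff_at[OF f(2) GP])
    finally have "(deriv ^^ k) (\<lambda>w. f (Phi n w)) z = (deriv ^^ k) (\<lambda>w. f (Psi n w) * G w) z" by (simp add: mult.commute)
    also have "\<dots> = (\<Sum>l\<le>k. of_nat (k choose l) * (deriv ^^ l) (\<lambda>w. f (Psi n w)) z * (deriv ^^ (k - l)) G z)"
      unfolding higher_deriv_mult_at[OF f(1) G] by (simp add: atMost_atLeast0)
    also have "\<dots> = (\<Sum>l\<le>k. of_nat (k choose l) * ?g (k - l) * (deriv ^^ l) (\<lambda>w. f (Psi n w)) z)"
      using k by (intro sum.cong refl) auto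
    finally show ?thesis .
  qed
  show ?thesis unfolding dep_def
  proof (rule the_equality)
    show "(\<forall>k\<ge>m. ?g k = 0) \<and> (\<forall>k<m. \<forall>n. ?R fst ?g k n \<and> ?R snd ?g k n)"
      using ex[of _ fst] ex[of _ snd] an d1 d2 by auto
    fix g assume g: "(\<forall>k\<ge>m. g k = 0) \<and> (\<forall>k<m. \<forall>n. ?R fst g k n \<and> ?R snd g k n)"
    obtain f :: "complex \<times> complex \<Rightarrow> complex" where f: "f = fst \<or> f = snd" and fnz: "f (Psi n0 z) \<noteq> 0"
      using nz by (metis prod.collapse)
    have "g k = ?g k" if "k < m" for k
      using that
    proof (induction k rule: less_induct)
      case (less k)
      have r1: "?R f g k n0" and r2: "?R f ?g k n0"
        using f g less.prems ex[of k fst n0] ex[of k snd n0] an d1 d2 by auto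
      have split: "(\<Sum>l\<le>k. of_nat (k choose l) * h (k - l) * (deriv ^^ l) (\<lambda>w. f (Psi n0 w)) z)
          = h k * f (Psi n0 z) + (\<Sum>l\<in>{1..k}. of_nat (k choose l) * h (k - l) * (deriv ^^ l) (\<lambda>w. f (Psi n0 w)) z)" for h :: "nat \<Rightarrow> complex"
      proof -
        have "{..k} = insert 0 {1..k}" by auto
        then show ?thesis by simp
      qed
      have "(\<Sum>l\<in>{1..k}. of_nat (k choose l) * g (k - l) * (deriv ^^ l) (\<lambda>w. f (Psi n0 w)) z)
          = (\<Sum>l\<in>{1..k}. of_nat (k choose l) * ?g (k - l) * (deriv ^^ l) (\<lambda>w. f (Psi n0 w)) z)"
        by (intro sum.cong refl) (use less in auto)
      moreover have "g k * f (Psi n0 z) + (\<Sum>l\<in>{1..k}. of_nat (k choose l) * g (k - l) * (deriv ^^ l) (\<lambda>w. f (Psi n0 w)) z)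
         = ?g k * f (Psi n0 z) + (\<Sum>l\<in>{1..k}. of_nat (k choose l) * ?g (k - l) * (deriv ^^ l) (\<lambda>w. f (Psi n0 w)) z)"
        using trans[OF r1[symmetric] r2] unfolding split[of g] split[of ?g] .
      ultimately have "g k * f (Psi n0 z) = ?g k * f (Psi n0 z)" by (simp only: add_right_cancel)
      then show ?case using fnz by simp
    qed
    then show "g = ?g" using g by (auto simp: fun_eq_iff)
  qed
qed

text \<open>The primitive is single-valued around z, so the integral over a small closed circle is
  0.\<close>

lemma residue_of_derivative:
  assumes U: "open U" "z \<in> U" and F: "\<And>w. w \<in> U - {z} \<Longrightarrow> (F has_field_derivative f w) (at w)"
  shows "residue f z = 0"
proof -
  have "open (U - {z})" using U by auto
  have FU: "F holomorphic_on (U - {z})" using F holomorphic_on_open[OF \<open>open (U - {z})\<close>] by blast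
  have "deriv F holomorphic_on (U - {z})" by (rule holomorphic_deriv[OF FU \<open>open (U - {z})\<close>])
  then have f: "f holomorphic_on (U - {z})"
    by (rule holomorphic_transform) (use F in \<open>auto intro: DERIV_imp_deriv\<close>)
  obtain e where e: "e > 0" "cball z e \<subseteq> U" using U open_contains_cball by blast
  have "(f has_contour_integral 2 * pi * \<i> * residue f z) (circlepath z e)"
    by (rule base_residue[OF U e(1) f e(2)])
  moreover have "(f has_contour_integral F (pathfinish (circlepath z e)) - F (pathstart (circlepath z e))) (circlepath z e)"
    by (rule contour_integral_primitive[of "U - {z}"])
      (use F e in \<open>auto intro: has_field_derivative_at_within\<close>)
  ultimately have "2 * pi * \<i> * residue f z = 0" using has_contour_integral_unique by fastforce
  then show ?thesis by simp
qed

text \<open>Only the simple-pole part of the integrand contributes: the other negative powers of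
  \<open>g w - g z\<close>, times \<open>deriv g w\<close>, have a primitive.\<close>

lemma residue_compose:
  assumes H: "H analytic_on {g z}" and g: "g analytic_on {z}" and g': "deriv g z \<noteq> 0"
  shows "residue (\<lambda>w. H (g w) / (g w - g z) ^ m * deriv g w) z = residue (\<lambda>v. H v / (v - g z) ^ m) (g z)"
proof -
  define v0 where "v0 = g z"
  obtain S where S: "open S" "v0 \<in> S" "H holomorphic_on S" using H by (auto simp: analytic_at v0_def)
  obtain V where V: "open V" "z \<in> V" "g holomorphic_on V" using g by (auto simp: analytic_at)
  \<comment> \<open>The difference quotient of g, continued analytically to z. It is nonzero at z
    because \<open>deriv g z\<close> is, so near z the only zero of g w - g z is z itself, and it is
    simple.\<close>
  define k where "k = (\<lambda>w. if w = z then deriv g z else (g w - g z) / (w - z))"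
  have kV: "k holomorphic_on V" unfolding k_def
    by (rule pole_lemma[OF V(3)]) (use V in \<open>simp add: interior_open\<close>)
  have gk: "g w - v0 = (w - z) * k w" for w by (simp add: k_def v0_def)
  define U where "U = V \<inter> g -` S \<inter> k -` (- {0})"
  have "open (V \<inter> g -` S)"
    by (rule continuous_open_preimage[OF holomorphic_on_imp_continuous_on[OF V(3)] V(1) S(1)])
  then have "open ((V \<inter> g -` S) \<inter> k -` (- {0}))"
    by (intro continuous_open_preimage[OF continuous_on_subset[OF holomorphic_on_imp_continuous_on[OF kV]]]) auto
  then have U: "open U" unfolding U_def .
  have zU: "z \<in> U" using V S g' by (auto simp: U_def v0_def k_def)
  have gU: "g holomorphic_on U" and kU: "k holomorphic_on U" and gS: "g ` U \<subseteq> S"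
    and ne: "\<And>w. w \<in> U \<Longrightarrow> k w \<noteq> 0"
    using holomorphic_on_subset[OF V(3), of U] holomorphic_on_subset[OF kV, of U] by (auto simp: U_def)
  have gne: "g w - v0 \<noteq> 0" if "w \<in> U - {z}" for w using ne[of w] that gk[of w] by auto
  have g'U: "deriv g holomorphic_on U" by (rule holomorphic_deriv[OF gU U])
  have gd: "(g has_field_derivative deriv g w) (at w)" if "w \<in> U" for w
    by (rule holomorphic_derivI[OF gU U that])
  have "residue (\<lambda>w. H (g w) / (g w - v0) ^ m * deriv g w) z = residue (\<lambda>v. H v / (v - v0) ^ m) v0"
    if "H holomorphic_on S" for H
    using that
  proof (induction m arbitrary: H)
    case (0 H)
    have "(H \<circ> g) holomorphic_on U" by (rule holomorphic_on_compose_gen[OF gU 0 gS])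
    then have "(\<lambda>w. H (g w) / (g w - v0) ^ 0 * deriv g w) holomorphic_on U"
      using g'U by (auto intro!: holomorphic_intros simp: o_def)
    from residue_holo[OF U zU this] residue_holo[OF S(1,2) 0] show ?case by simp
  next
    case (Suc m H)
    \<comment> \<open>The divided difference of H at \<open>v0\<close> lowers the power by one. What
      is split off is a constant multiple of a pure negative power; hence H is general in the
      induction.\<close>
    define H1 where "H1 = (\<lambda>v. if v = v0 then deriv H v0 else (H v - H v0) / (v - v0))"
    have H1: "H1 holomorphic_on S" unfolding H1_def
      by (rule pole_lemma[OF Suc.prems]) (use S in \<open>simp add: interior_open\<close>)
    have Heq: "H v = H v0 + (v - v0) * H1 v" for v by (simp add: H1_def)
    have "(H1 \<circ> g) holomorphic_on U" by (rule holomorphic_on_compose_gen[OF gU H1 gS])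
    then have h1: "(\<lambda>w. H1 (g w) / (g w - v0) ^ m * deriv g w) holomorphic_on U - {z}"
      using gne by (auto intro!: holomorphic_intros holomorphic_on_subset[OF g'U] holomorphic_on_subset[OF gU]
          simp: o_def elim: holomorphic_on_subset)
    have h0: "(\<lambda>w. deriv g w / (g w - v0) ^ Suc m) holomorphic_on U - {z}"
      using gne by (intro holomorphic_intros holomorphic_on_subset[OF g'U] holomorphic_on_subset[OF gU]) auto
    have k1: "(\<lambda>v. H1 v / (v - v0) ^ m) holomorphic_on S - {v0}"
      by (intro holomorphic_intros holomorphic_on_subset[OF H1]) auto
    have k0: "(\<lambda>v. 1 / (v - v0) ^ Suc m) holomorphic_on S - {v0}"
      by (intro holomorphic_intros) auto
    have L: "residue (\<lambda>w. H (g w) / (g w - v0) ^ Suc m * deriv g w) z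
       = H v0 * residue (\<lambda>w. deriv g w / (g w - v0) ^ Suc m) z
         + residue (\<lambda>w. H1 (g w) / (g w - v0) ^ m * deriv g w) z"
    proof -
      have "residue (\<lambda>w. H (g w) / (g w - v0) ^ Suc m * deriv g w) z
        = residue (\<lambda>w. H v0 * (deriv g w / (g w - v0) ^ Suc m) + H1 (g w) / (g w - v0) ^ m * deriv g w) z"
      proof (rule residue_cong[OF _ refl])
        have "\<forall>\<^sub>F w in at z. w \<in> U - {z}" using U zU by (intro eventually_at_in_open) auto
        then show "\<forall>\<^sub>F w in at z. H (g w) / (g w - v0) ^ Suc m * deriv g w
            = H v0 * (deriv g w / (g w - v0) ^ Suc m) + H1 (g w) / (g w - v0) ^ m * deriv g w"
        proof eventually_elim
          case (elim w)
          then show ?case using gne[of w] by (subst Heq) (simp add: field_simps)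
        qed
      qed
      also have "\<dots> = residue (\<lambda>w. H v0 * (deriv g w / (g w - v0) ^ Suc m)) z + residue (\<lambda>w. H1 (g w) / (g w - v0) ^ m * deriv g w) z"
        by (rule residue_add[OF U zU _ h1]) (intro holomorphic_intros h0)
      finally show ?thesis unfolding residue_lmul[OF U zU h0] .
    qed
    have R: "residue (\<lambda>v. H v / (v - v0) ^ Suc m) v0
       = H v0 * residue (\<lambda>v. 1 / (v - v0) ^ Suc m) v0 + residue (\<lambda>v. H1 v / (v - v0) ^ m) v0"
    proof -
      have "residue (\<lambda>v. H v / (v - v0) ^ Suc m) v0 = residue (\<lambda>v. H v0 * (1 / (v - v0) ^ Suc m) + H1 v / (v - v0) ^ m) v0"
      proof (rule residue_cong[OF _ refl])
        have "\<forall>\<^sub>F v in at v0. v \<noteq> v0" by (simp add: eventually_at_filter)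
        then show "\<forall>\<^sub>F v in at v0. H v / (v - v0) ^ Suc m = H v0 * (1 / (v - v0) ^ Suc m) + H1 v / (v - v0) ^ m"
          by eventually_elim (subst Heq, simp add: field_simps)
      qed
      also have "\<dots> = residue (\<lambda>v. H v0 * (1 / (v - v0) ^ Suc m)) v0 + residue (\<lambda>v. H1 v / (v - v0) ^ m) v0"
        by (rule residue_add[OF S(1,2) _ k1]) (intro holomorphic_intros k0)
      finally show ?thesis unfolding residue_lmul[OF S(1,2) k0] .
    qed
    have "residue (\<lambda>w. deriv g w / (g w - v0) ^ Suc m) z = residue (\<lambda>v. 1 / (v - v0) ^ Suc m) v0"
    proof (cases m)
      case 0
      \<comment> \<open>The logarithmic derivative at a simple zero: with g w - v0 = (w - z) * k w
        the integrand has a simple pole with residue deriv g z / k z = 1.\<close>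
      have "residue (\<lambda>w. deriv g w / (g w - v0) ^ Suc m) z = residue (\<lambda>w. (deriv g w / k w) / (w - z)) z"
        unfolding 0 gk by (simp add: mult.commute)
      also have "\<dots> = deriv g z / k z"
        by (rule residue_simple[OF U zU]) (intro holomorphic_intros g'U kU ne)
      also have "\<dots> = 1" using g' by (simp add: k_def)
      also have "1 = residue (\<lambda>v. 1 / (v - v0)) v0"
        by (subst residue_simple[of UNIV]) auto
      finally show ?thesis by (simp add: 0)
    next
      case (Suc j)
      have "residue (\<lambda>w. deriv g w / (g w - v0) ^ Suc m) z = 0"
      proof (rule residue_of_derivative[OF U zU, of "\<lambda>w. (- 1 / of_nat m) * inverse ((g w - v0) ^ m)"])
        fix w assume w: "w \<in> U - {z}"
        have X: "g w - v0 \<noteq> 0" by (rule gne[OF w])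
        have D: "((\<lambda>w. (g w - v0) ^ m) has_field_derivative of_nat m * ((deriv g w - 0) * (g w - v0) ^ (m - Suc 0))) (at w)"
          by (intro DERIV_power DERIV_diff gd DERIV_const) (use w in auto)
        have "(g w - v0) ^ m \<noteq> 0" using X by simp
        note DERIV_cmult[OF DERIV_inverse'[OF D this], of "- 1 / of_nat m"]
        moreover have "(- 1 / of_nat m) * - (inverse ((g w - v0) ^ m) * (of_nat m * ((deriv g w - 0) * (g w - v0) ^ (m - Suc 0))) * inverse ((g w - v0) ^ m))
          = deriv g w / (g w - v0) ^ Suc m"
        proof -
          have alg: "(- 1 / M) * - (inverse (Y * Z) * (M * ((d - 0) * Z)) * inverse (Y * Z)) = d / (Y * (Y * Z))"
            if "Y \<noteq> 0" "Z \<noteq> 0" "M \<noteq> 0" for Y Z M d :: complex using that by (simp add: field_simps)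
          have "(g w - v0) ^ j \<noteq> 0" using X by simp
          moreover have "(of_nat m :: complex) \<noteq> 0" unfolding of_nat_eq_0_iff using Suc by simp
          ultimately have "(- 1 / of_nat m) * - (inverse ((g w - v0) * (g w - v0) ^ j) * (of_nat m * ((deriv g w - 0) * (g w - v0) ^ j))
            * inverse ((g w - v0) * (g w - v0) ^ j)) = deriv g w / ((g w - v0) * ((g w - v0) * (g w - v0) ^ j))"
            by (rule alg[OF X])
          then show ?thesis unfolding Suc power_Suc diff_Suc_Suc minus_nat.diff_0 .
        qed
        ultimately show "((\<lambda>w. (- 1 / of_nat m) * inverse ((g w - v0) ^ m)) has_field_derivative deriv g w / (g w - v0) ^ Suc m) (at w)"
          by simp
      qed
      moreover have "residue (\<lambda>v. 1 / (v - v0) ^ Suc m) v0 = 0"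
        using residue_holomorphic_over_power[of UNIV v0 "\<lambda>_. 1" m] Suc by simp
      ultimately show ?thesis by simp
    qed
    then show ?case unfolding L R Suc.IH[OF H1] by simp
  qed
  from this[OF S(3)] show ?thesis by (simp add: v0_def)
qed

subsection \<open>Bound states\<close>

text \<open>\<open>jvec m z t\<close> is the column A ^ t * B for the Jordan block A of size m and eigenvalue z.\<close>

definition jvec :: "nat \<Rightarrow> complex \<Rightarrow> int \<Rightarrow> complex mat" where
  "jvec m z t = mat m 1 (\<lambda>(i, j). (of_int t gchoose (m - 1 - i)) * z powi (t - int (m - 1 - i)))"

lemma jvec_carrier [simp]: "jvec m z t \<in> carrier_mat m 1" by (simp add: jvec_def)

lemma jvec_0: "0 < m \<Longrightarrow> jvec m z 0 = colB m"
  by (rule eq_matI) (auto simp: jvec_def colB_def gbinomial_0_left)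

text \<open>Pascal's rule for the generalised binomial coefficients. It holds for every integer t,
  so the same vectors also describe the negative powers of the block.\<close>

lemma jordan_jvec:
  assumes z: "z \<noteq> 0" shows "jordan_block m z * jvec m z t = jvec m z (t + 1)"
proof (rule eq_matI)
  fix i j assume "i < dim_row (jvec m z (t + 1))" "j < dim_col (jvec m z (t + 1))"
  then have i: "i < m" and j: "j = 0" by (auto simp: jvec_def)
  have "(jordan_block m z * jvec m z t) $$ (i, j) = (\<Sum>k<m. (if i = k then z else if Suc i = k then 1 else 0) *
       ((of_int t gchoose (m - 1 - k)) * z powi (t - int (m - 1 - k))))"
    using i j by (simp add: scalar_prod_def jvec_def atLeast0LessThan)
  also have "\<dots> = (\<Sum>k<m. (if i = k then z * ((of_int t gchoose (m - 1 - i)) * z powi (t - int (m - 1 - i))) else 0)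
      + (if k = Suc i then (of_int t gchoose (m - 1 - Suc i)) * z powi (t - int (m - 1 - Suc i)) else 0))"
    by (intro sum.cong refl) auto
  also have "\<dots> = z * ((of_int t gchoose (m - 1 - i)) * z powi (t - int (m - 1 - i)))
      + (if Suc i < m then (of_int t gchoose (m - 1 - Suc i)) * z powi (t - int (m - 1 - Suc i)) else 0)"
    using i by (simp add: sum.distrib)
  also have "\<dots> = (of_int (t + 1) gchoose (m - 1 - i)) * z powi (t + 1 - int (m - 1 - i))"
  proof (cases "Suc i < m")
    case True
    then have e: "m - 1 - i = Suc (m - 1 - Suc i)" by auto
    have "z powi (t + 1 - int (m - 1 - i)) = z * z powi (t - int (m - 1 - i))"
      using z power_int_add[of z 1 "t - int (m - 1 - i)"] by (simp add: algebra_simps)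
    moreover have "t + 1 - int (m - 1 - i) = t - int (m - 1 - Suc i)" unfolding e by simp
    moreover have "(of_int (t + 1) gchoose (m - 1 - i)) = (of_int t gchoose (m - 1 - i)) + (of_int t gchoose (m - 1 - Suc i) :: complex)"
      unfolding e using gbinomial_Suc_Suc[of "of_int t :: complex" "m - 1 - Suc i"] by (simp add: add.commute)
    ultimately show ?thesis using True by (simp add: algebra_simps)
  next
    case False
    then have "m - 1 - i = 0" by auto
    with False show ?thesis using z by (simp add: power_int_add)
  qed
  finally show "(jordan_block m z * jvec m z t) $$ (i, j) = jvec m z (t + 1) $$ (i, j)"
    using i j by (simp add: jvec_def)
qed (auto simp: jvec_def)

text \<open>Applied with d = 1 to the Jordan block and with d = -1 to its inverse.\<close>

lemma pow_mat_jvec: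
  assumes M: "M \<in> carrier_mat m m" and s: "\<And>t. M * jvec m z t = jvec m z (t + d)"
  shows "M ^\<^sub>m k * jvec m z t = jvec m z (t + int k * d)"
proof (induction k arbitrary: t)
  case 0 then show ?case using M by (simp add: left_mult_one_mat[OF jvec_carrier])
next
  case (Suc k)
  have "M ^\<^sub>m Suc k * jvec m z t = M ^\<^sub>m k * (M * jvec m z t)"
    using assoc_mult_mat[OF pow_carrier_mat[OF M, of k] M jvec_carrier] by simp
  also have "\<dots> = jvec m z (t + int (Suc k) * d)" unfolding s Suc.IH by (simp add: algebra_simps)
  finally show ?case .
qed

lemma mat_powi_jordan_colB:
  assumes m: "0 < m" and z: "z \<noteq> 0" shows "mat_powi (jordan_block m z) t * colB m = jvec m z t"
    and "mat_powi (jordan_block m z) t \<in> carrier_mat m m"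
proof -
  let ?A = "jordan_block m z"
  have A: "?A \<in> carrier_mat m m" by simp
  have "Determinant.det ?A = prod_list (diag_mat ?A)"
    by (rule det_upper_triangular[OF _ A]) auto
  also have "\<dots> \<noteq> 0" using z by (auto simp: prod_list_zero_iff diag_mat_def)
  finally have U: "?A \<in> Units (ring_mat TYPE(complex) m ())" by (rule det_non_zero_imp_unit[OF A])
  obtain B where B: "mat_inverse ?A = Some B" using mat_inverse(1)[OF A, of "()"] U by (cases "mat_inverse ?A") auto
  then have BA: "B * ?A = 1\<^sub>m m" and Bc: "B \<in> carrier_mat m m" using mat_inverse(2)[OF A B] by auto
  have Bs: "B * jvec m z t = jvec m z (t + - 1)" for t
  proof -
    have "jvec m z t = ?A * jvec m z (t - 1)" using jordan_jvec[OF z, of m "t - 1"] by simp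
    then have "B * jvec m z t = (B * ?A) * jvec m z (t - 1)" using assoc_mult_mat[OF Bc A jvec_carrier] by simp
    then show ?thesis unfolding BA by (simp add: left_mult_one_mat[OF jvec_carrier])
  qed
  show "mat_powi ?A t * colB m = jvec m z t"
    unfolding mat_powi_def jvec_0[OF m, symmetric, of z]
    using pow_mat_jvec[OF A jordan_jvec[OF z], of "nat t" 0] pow_mat_jvec[OF Bc Bs, of "nat (- t)" 0] B by auto
  show "mat_powi ?A t \<in> carrier_mat m m" using B Bc by (auto simp: mat_powi_def)
qed

lemma jordan_CAB:
  assumes m: "0 < m" and z: "z \<noteq> 0"
  shows "(rowC m c * mat_powi (jordan_block m z) t * colB m) $$ (0, 0)
    = (\<Sum>k<m. c k * (of_int t gchoose k) * z powi (t - int k))"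
proof -
  have r: "rowC m c \<in> carrier_mat 1 m" and cB: "colB m \<in> carrier_mat m 1" by (auto simp: rowC_def colB_def)
  have "rowC m c * mat_powi (jordan_block m z) t * colB m = rowC m c * jvec m z t"
    using assoc_mult_mat[OF r mat_powi_jordan_colB(2)[OF m z] cB] mat_powi_jordan_colB(1)[OF m z] by simp
  also have "\<dots> $$ (0, 0) = (\<Sum>i<m. c (m - 1 - i) * ((of_int t gchoose (m - 1 - i)) * z powi (t - int (m - 1 - i))))"
    by (simp add: rowC_def jvec_def scalar_prod_def atLeast0LessThan)
  also have "\<dots> = (\<Sum>k<m. c k * ((of_int t gchoose k) * z powi (t - int k)))"
    by (rule sum.reindex_bij_witness[of _ "\<lambda>k. m - 1 - k" "\<lambda>k. m - 1 - k"]) auto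
  finally show ?thesis by (simp add: mult.assoc)
qed

text \<open>Change of variables in residues, used for z -> -z and z -> 1/z. The limit hypothesis
  keeps g w off the pole, so the factorisation of T, valid only near but not at g z, can be pulled
  back.\<close>

lemma residue_compose_pole_factor:
  assumes P: "pole_factor T (g z) m H" and h: "h analytic_on {g z}" and g: "g analytic_on {z}" and g': "deriv g z \<noteq> 0"
    and lim: "filterlim g (at (g z)) (at z)"
  shows "residue (\<lambda>w. T (g w) * h (g w) * deriv g w) z = residue (\<lambda>v. T v * h v) (g z)"
proof -
  have H: "H analytic_on {g z}" and T: "\<forall>\<^sub>F w in at (g z). T w = H w / (w - g z) ^ m"
    using P by (auto simp: pole_factor_def)
  have "residue (\<lambda>w. T (g w) * h (g w) * deriv g w) z = residue (\<lambda>w. (H (g w) * h (g w)) / (g w - g z) ^ m * deriv g w) z"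
  proof (rule residue_cong[OF _ refl])
    have "\<forall>\<^sub>F w in at z. T (g w) = H (g w) / (g w - g z) ^ m"
      using eventually_compose_filterlim[OF T lim] .
    then show "\<forall>\<^sub>F w in at z. T (g w) * h (g w) * deriv g w = (H (g w) * h (g w)) / (g w - g z) ^ m * deriv g w"
      by eventually_elim simp
  qed
  also have "\<dots> = residue (\<lambda>v. (H v * h v) / (v - g z) ^ m) (g z)"
    using residue_compose[of "\<lambda>v. H v * h v" g z m] g g' H h by (auto intro: analytic_intros)
  also have "\<dots> = residue (\<lambda>v. T v * h v) (g z)"
    by (rule residue_cong[OF _ refl]) (use T in eventually_elim, simp)
  finally show ?thesis .
qed

lemma pole_factor_residue_neg:
  assumes P: "pole_factor T z m H" and h: "h analytic_on {z}"
  shows "residue (\<lambda>w. T w * - h w) z = - residue (\<lambda>w. T w * h w) z"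
proof -
  have mh: "(\<lambda>w. - h w) analytic_on {z}" by (intro analytic_intros h)
  show ?thesis
    unfolding pole_factor_residue[OF P h] pole_factor_residue[OF P mh] taylor_coeff_def higher_deriv_uminus_at[OF h] by (simp add: sum_negf)
qed

lemma filterlim_at_inj:
  assumes "isCont g z" "inj g" shows "filterlim g (at (g z)) (at z)"
proof (rule filterlim_atI)
  show "g \<midarrow>z\<rightarrow> g z" using assms(1) by (simp add: isCont_def)
  have "\<forall>\<^sub>F x in at z. x \<noteq> z" by (simp add: eventually_at_filter)
  then show "\<forall>\<^sub>F x in at z. g x \<noteq> g z" by eventually_elim (use assms(2) in \<open>auto dest: injD\<close>)
qed

lemma reps_props:
  fixes S :: "complex set"
  assumes "0 \<notin> S" "\<And>z. z \<in> S \<Longrightarrow> - z \<in> S"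
  shows "reps S \<subseteq> S" "S = reps S \<union> uminus ` reps S" "reps S \<inter> uminus ` reps S = {}"
proof -
  \<comment> \<open>Half-plane Re > 0 together with the positive imaginary half-axis: it contains
    exactly one of z and -z for z nonzero, so the choice made in \<open>reps\<close> exists.\<close>
  let ?pos = "\<lambda>z::complex. 0 < Re z \<or> (Re z = 0 \<and> 0 < Im z)"
  have "\<exists>P. P \<subseteq> S \<and> S = P \<union> uminus ` P \<and> P \<inter> uminus ` P = {}"
  proof (intro exI conjI)
    let ?P = "{z \<in> S. ?pos z}"
    show "?P \<subseteq> S" by auto
    show "S = ?P \<union> uminus ` ?P"
    proof (intro equalityI subsetI)
      fix z assume z: "z \<in> S"
      then have "z \<noteq> 0" using assms(1) by auto
      then have "?pos z \<or> ?pos (- z)" by (auto simp: complex_eq_iff)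
      then show "z \<in> ?P \<union> uminus ` ?P"
      proof
        assume "?pos (- z)"
        then have "- z \<in> ?P" using assms(2)[OF z] by simp
        then have "- (- z) \<in> uminus ` ?P" by (rule imageI)
        then show ?thesis by simp
      qed (use z in simp)
    qed (use assms(2) in auto)
    show "?P \<inter> uminus ` ?P = {}" by auto
  qed
  from someI_ex[OF this] show "reps S \<subseteq> S" "S = reps S \<union> uminus ` reps S" "reps S \<inter> uminus ` reps S = {}"
    unfolding reps_def by blast+
qed

text \<open>Accounts for the factor 2 of the norming constants: they are attached to one pole of
  each pair z, -z, while the residue theorem sums over all poles.\<close>

lemma sum_reps:
  fixes F :: "complex \<Rightarrow> complex"
  assumes "0 \<notin> S" "\<And>z. z \<in> S \<Longrightarrow> - z \<in> S" "finite S" "\<And>z. z \<in> S \<Longrightarrow> F (- z) = F z"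
  shows "sum F S = 2 * sum F (reps S)"
proof -
  note r = reps_props[OF assms(1,2)]
  have fin: "finite (reps S)" using r(1) assms(3) by (rule finite_subset)
  have "sum F S = sum F (reps S) + sum F (uminus ` reps S)"
    using sum.union_disjoint[OF fin _ r(3), of F] fin r(2) by simp
  also have "sum F (uminus ` reps S) = (\<Sum>z\<in>reps S. F (- z))" by (subst sum.reindex) auto
  also have "\<dots> = sum F (reps S)" using r(1) assms(4) by (intro sum.cong) auto
  finally show ?thesis by simp
qed

lemma psiF_minus: "psiF a b 0 (- z) = psiF a b 0 z" by (simp add: psiF_def DI_def)

text \<open>A germ whose derivatives at the pole z are the dependency constants: \<open>\<phi> n - dep_germ * \<psi> n\<close>
  vanishes at z to the order of the pole, for \<open>n = 0\<close> because the Wronskian is a multiple of \<open>1 / T\<close>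
  and for the other n by the recursion.\<close>

definition dep_germ :: "(int \<Rightarrow> complex) \<Rightarrow> (int \<Rightarrow> complex) \<Rightarrow> complex \<Rightarrow> complex \<Rightarrow> complex" where
  "dep_germ a b z w = (if fst (psiF a b 0 z) \<noteq> 0 then fst (phiF a b 0 w) / fst (psiF a b 0 w)
     else snd (phiF a b 0 w) / snd (psiF a b 0 w))"

text \<open>The pole z contributes \<open>- 2 * bs_residue a b z t\<close> to C A ^ t B.\<close>

definition bs_residue :: "(int \<Rightarrow> complex) \<Rightarrow> (int \<Rightarrow> complex) \<Rightarrow> complex \<Rightarrow> int \<Rightarrow> complex" where
  "bs_residue a b z t = residue (\<lambda>w. Tr_ext a b w * (dep_germ a b z w * w powi t)) z"

section \<open>Poles of T, dependency constants and the residue form of C A^t B\<close>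

context fixes a b assumes ab: "l1pair a b" begin

lemma phiF_minus: "phiF a b 0 (- z) = phiF a b 0 z" by (simp add: phiF_def[OF ab] DI_def)

lemma dep_germ_minus: "dep_germ a b (- z) w = dep_germ a b z w" "dep_germ a b z (- w) = dep_germ a b z w"
  by (simp_all add: dep_germ_def psiF_minus phiF_minus)

lemma Jost_analytic:
  assumes "0 < norm z" "norm z < 1"
  shows "(\<lambda>w. fst (psiF a b n w)) analytic_on {z}" "(\<lambda>w. snd (psiF a b n w)) analytic_on {z}"
    "(\<lambda>w. fst (phiF a b n w)) analytic_on {z}" "(\<lambda>w. snd (phiF a b n w)) analytic_on {z}"
proof -
  have "open (ball 0 1 - {0 :: complex})" "z \<in> ball 0 1 - {0}" using assms by auto
  then show "(\<lambda>w. fst (psiF a b n w)) analytic_on {z}" "(\<lambda>w. snd (psiF a b n w)) analytic_on {z}"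
    "(\<lambda>w. fst (phiF a b n w)) analytic_on {z}" "(\<lambda>w. snd (phiF a b n w)) analytic_on {z}"
    using psiF_ext_in[OF l1pair_summable(1)[OF ab]] phiF_is_phi[OF ab]
    unfolding is_phi_def[OF ab] ext_in_def analytic_at by blast+
qed

text \<open>A zero at one index would, after shifting that index to 0, force the whole solution to
  vanish, whereas its second component divided by z^k tends to 1.\<close>

lemma psi_nonzero: assumes "0 < norm z" "norm z < 1" shows "psiF a b n z \<noteq> (0, 0)"
proof
  assume 0: "psiF a b n z = (0, 0)"
  have zD: "z \<in> DI" and z0: "z \<noteq> 0" using assms by (auto simp: DI_def)
  have z2: "norm (z\<^sup>2) \<le> 1" using assms by (simp add: norm_power power_le_one)
  define Y where "Y k z = psiF a b (n + k) z" for k z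
  have "is_sol (\<lambda>k. a (n + k)) (\<lambda>k. b (n + k)) Y z"
    unfolding is_sol_def Y_def
  proof
    fix k show "psiF a b (n + k) z = (z * fst (psiF a b (n + (k + 1)) z) + z * a (n + k) * snd (psiF a b (n + (k + 1)) z),
        b (n + k) * fst (psiF a b (n + (k + 1)) z) / z + snd (psiF a b (n + (k + 1)) z) / z)"
      using psiF_sol[OF l1pair_summable(1)[OF ab] zD, unfolded is_sol_def, THEN spec, of "n + k"] by (simp add: add.assoc)
  qed
  then have "Y k z = (0, 0)" for k
    by (rule sol_zero[OF _ z0]) (use l1pair_nonzero[OF ab] 0 in \<open>auto simp: Y_def\<close>)
  from this[of "k - n" for k] have "psiF a b k z = (0, 0)" for k by (simp add: Y_def)
  then have "JP a b k (z\<^sup>2) = 0" for k using zD z0 by (simp add: psiF_def)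
  then show False using JP_tendsto[OF l1pair_summable(1)[OF ab] z2] by (simp add: tendsto_const_iff)
qed

text \<open>The extension of 1/T is nonzero at 0, hence not identically zero, and every zero in the
  disc has finite order.\<close>

lemma pole_factor_ex:
  assumes z: "0 < norm z" "norm z < 1" and a0: "scat_a_ext a b z = 0"
  obtains m H where "pole_factor (Tr_ext a b) z m H"
proof -
  have zb: "z \<in> ball 0 1" using z by simp
  have "\<exists>w\<in>ball 0 1. scat_a_ext a b w \<noteq> 0" using scat_a_ext_0[OF ab] by (intro bexI[of _ 0]) auto
  from zorder_exist_zero[OF scat_a_ext_holomorphic[OF ab] open_ball connected_ball zb this] a0
  obtain e where m: "0 < zorder (scat_a_ext a b) z" and e: "e > 0"
    and h: "zor_poly (scat_a_ext a b) z holomorphic_on cball z e"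
    and eq: "\<And>w. w \<in> cball z e \<Longrightarrow> scat_a_ext a b w = zor_poly (scat_a_ext a b) z w * (w - z) ^ nat (zorder (scat_a_ext a b) z)
       \<and> zor_poly (scat_a_ext a b) z w \<noteq> 0" by auto
  have "pole_factor (Tr_ext a b) z (nat (zorder (scat_a_ext a b) z)) (\<lambda>w. 1 / zor_poly (scat_a_ext a b) z w)"
    unfolding pole_factor_def
  proof (intro conjI)
    show "(\<lambda>w. 1 / zor_poly (scat_a_ext a b) z w) analytic_on {z}" unfolding analytic_at
      by (intro exI[of _ "ball z e"]) (use e h eq in \<open>auto intro!: holomorphic_intros intro: holomorphic_on_subset\<close>)
    have "\<forall>\<^sub>F w in at z. w \<in> ball z e - {z}" using e by (intro eventually_at_in_open) auto
    then show "\<forall>\<^sub>F w in at z. Tr_ext a b w = 1 / zor_poly (scat_a_ext a b) z w / (w - z) ^ nat (zorder (scat_a_ext a b) z)"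
      by eventually_elim (simp add: Tr_ext_eq[OF ab] eq)
  qed (use m eq[of z] e in auto)
  then show ?thesis by (rule that)
qed

lemma poles_iff: "z \<in> poles a b \<longleftrightarrow> 0 < norm z \<and> norm z < 1 \<and> scat_a_ext a b z = 0"
proof (cases "0 < norm z \<and> norm z < 1")
  case z: True
  show ?thesis
  proof (cases "scat_a_ext a b z = 0")
    case True
    with z obtain m H where "pole_factor (Tr_ext a b) z m H" using pole_factor_ex by blast
    then show ?thesis using z True pole_factor_is_pole by (auto simp: poles_def)
  next
    case False
    define V where "V = ball 0 1 \<inter> scat_a_ext a b -` (- {0})"
    have "open V" unfolding V_def
      by (intro continuous_open_preimage holomorphic_on_imp_continuous_on[OF scat_a_ext_holomorphic[OF ab]]) auto
    moreover have "Tr_ext a b holomorphic_on V" unfolding Tr_ext_eq[OF ab, abs_def]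
      by (intro holomorphic_intros holomorphic_on_subset[OF scat_a_ext_holomorphic[OF ab]]) (auto simp: V_def)
    moreover have "z \<in> V" using z False by (auto simp: V_def)
    ultimately have "\<not> is_pole (Tr_ext a b) z" by (intro not_is_pole_holomorphic)
    then show ?thesis using False by (auto simp: poles_def)
  qed
qed (auto simp: poles_def)

lemma poles_minus: "z \<in> poles a b \<Longrightarrow> - z \<in> poles a b"
  by (simp add: poles_iff scat_a_ext_minus[OF ab])

lemma poles_0: "0 \<notin> poles a b" by (simp add: poles_iff)

lemma pole_data:
  assumes z: "z \<in> poles a b"
  obtains m H where "pole_factor (Tr_ext a b) z m H" "dep_germ a b z analytic_on {z}"
    "\<forall>n. vanish_order m z (\<lambda>w. fst (phiF a b n w) - dep_germ a b z w * fst (psiF a b n w))"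
    "\<forall>n. vanish_order m z (\<lambda>w. snd (phiF a b n w) - dep_germ a b z w * snd (psiF a b n w))"
proof -
  have z1: "0 < norm z" "norm z < 1" "scat_a_ext a b z = 0" using z by (auto simp: poles_iff)
  obtain m H where P: "pole_factor (Tr_ext a b) z m H" using pole_factor_ex[OF z1] .
  note an = Jost_analytic[OF z1(1,2)]
  have zD: "\<forall>\<^sub>F w in nhds z. w \<in> ball 0 1 - {0}" using z1 by (intro eventually_nhds_in_open) auto
  have ne: "\<forall>\<^sub>F w in nhds z. f w \<noteq> 0" if "f analytic_on {z}" "f z \<noteq> 0" for f :: "complex \<Rightarrow> complex"
    using that analytic_at_imp_isCont[OF that(1)]
    by (intro tendsto_imp_eventually_ne[of f "f z"]) (auto simp: isCont_def tendsto_at_iff_tendsto_nhds)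
  have H: "H analytic_on {z}" "H z \<noteq> 0" and m: "0 < m" and T: "\<forall>\<^sub>F w in at z. Tr_ext a b w = H w / (w - z) ^ m"
    using P by (auto simp: pole_factor_def)
  have aTd: "vanish_order m z (scat_a_ext a b)" unfolding vanish_order_def
  proof (intro exI conjI)
    show "(\<lambda>w. 1 / H w) analytic_on {z}" by (intro analytic_intros H) (use H in auto)
    have "\<forall>\<^sub>F w in nhds z. w \<noteq> z \<longrightarrow> Tr_ext a b w = H w / (w - z) ^ m" using T by (simp add: eventually_at_filter)
    then show "\<forall>\<^sub>F w in nhds z. scat_a_ext a b w = (w - z) ^ m * (1 / H w)"
      using ne[OF H]
    proof eventually_elim
      case (elim w)
      show ?case
      \<comment> \<open>The factorisation of T is known only off z. At z both sides vanish, the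
        right one because m > 0.\<close>
      proof (cases "w = z")
        case False
        then have "1 / scat_a_ext a b w = H w / (w - z) ^ m" using elim by (simp add: Tr_ext_eq[OF ab])
        then have "1 / (1 / scat_a_ext a b w) = 1 / (H w / (w - z) ^ m)" by simp
        then show ?thesis by simp
      qed (use z1 m in simp)
    qed
  qed
  have wronskian: "\<forall>\<^sub>F w in nhds z. wronskian (phiF a b 0 w) (psiF a b 0 w) = wronskian_0 a b * scat_a_ext a b w"
    using zD
  proof eventually_elim
    case (elim w)
    then show ?case using scat_a_ext_DI[OF ab, of w] wronskian_0_nonzero[OF ab, of 1] by (auto simp: DI_def)
  qed
  have G: "dep_germ a b z analytic_on {z}
     \<and> vanish_order m z (\<lambda>w. fst (phiF a b 0 w) - dep_germ a b z w * fst (psiF a b 0 w))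
     \<and> vanish_order m z (\<lambda>w. snd (phiF a b 0 w) - dep_germ a b z w * snd (psiF a b 0 w))"
  \<comment> \<open>The germ divides by a component of psi that is nonzero at z. In that component
    phi - germ * psi vanishes identically near z; in the other it is, up to sign, the Wronskian over
    the chosen component, hence an analytic multiple of 1/T.\<close>
  proof (cases "fst (psiF a b 0 z) = 0")
    case False
    then have Ge: "dep_germ a b z = (\<lambda>w. fst (phiF a b 0 w) / fst (psiF a b 0 w))" by (simp add: dep_germ_def fun_eq_iff)
    have "vanish_order m z (\<lambda>w. (- wronskian_0 a b / fst (psiF a b 0 w)) * scat_a_ext a b w)"
      by (intro vanish_order_mult aTd analytic_intros an) (use False in auto)
    then have "vanish_order m z (\<lambda>w. snd (phiF a b 0 w) - dep_germ a b z w * snd (psiF a b 0 w))"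
    proof (rule vanish_order_cong)
      show "\<forall>\<^sub>F w in nhds z. (- wronskian_0 a b / fst (psiF a b 0 w)) * scat_a_ext a b w = snd (phiF a b 0 w) - dep_germ a b z w * snd (psiF a b 0 w)"
        using wronskian ne[OF an(1) False]
      proof eventually_elim
        case (elim w)
        have "(- wronskian_0 a b / fst (psiF a b 0 w)) * scat_a_ext a b w = - wronskian (phiF a b 0 w) (psiF a b 0 w) / fst (psiF a b 0 w)"
          unfolding elim(1) by simp
        then show ?case using elim(2) unfolding Ge wronskian_def by (simp add: field_simps)
      qed
    qed
    moreover have "vanish_order m z (\<lambda>w. fst (phiF a b 0 w) - dep_germ a b z w * fst (psiF a b 0 w))"
    proof (rule vanish_order_cong[OF vanish_order_0])
      show "\<forall>\<^sub>F w in nhds z. 0 = fst (phiF a b 0 w) - dep_germ a b z w * fst (psiF a b 0 w)"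
        using ne[OF an(1) False] by eventually_elim (simp add: Ge)
    qed
    moreover have "dep_germ a b z analytic_on {z}" unfolding Ge by (intro analytic_intros an) (use False in auto)
    ultimately show ?thesis by blast
  next
    case True
    have F: "snd (psiF a b 0 z) \<noteq> 0" using True psi_nonzero[OF z1(1,2), of 0] by (auto simp: prod_eq_iff)
    have Ge: "dep_germ a b z = (\<lambda>w. snd (phiF a b 0 w) / snd (psiF a b 0 w))" using True by (simp add: dep_germ_def fun_eq_iff)
    have "vanish_order m z (\<lambda>w. (wronskian_0 a b / snd (psiF a b 0 w)) * scat_a_ext a b w)"
      by (intro vanish_order_mult aTd analytic_intros an) (use F in auto)
    then have "vanish_order m z (\<lambda>w. fst (phiF a b 0 w) - dep_germ a b z w * fst (psiF a b 0 w))"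
    proof (rule vanish_order_cong)
      show "\<forall>\<^sub>F w in nhds z. (wronskian_0 a b / snd (psiF a b 0 w)) * scat_a_ext a b w = fst (phiF a b 0 w) - dep_germ a b z w * fst (psiF a b 0 w)"
        using wronskian ne[OF an(2) F]
      proof eventually_elim
        case (elim w)
        have "(wronskian_0 a b / snd (psiF a b 0 w)) * scat_a_ext a b w = wronskian (phiF a b 0 w) (psiF a b 0 w) / snd (psiF a b 0 w)"
          unfolding elim(1) by simp
        then show ?case using elim(2) unfolding Ge wronskian_def by (simp add: field_simps)
      qed
    qed
    moreover have "vanish_order m z (\<lambda>w. snd (phiF a b 0 w) - dep_germ a b z w * snd (psiF a b 0 w))"
    proof (rule vanish_order_cong[OF vanish_order_0])
      show "\<forall>\<^sub>F w in nhds z. 0 = snd (phiF a b 0 w) - dep_germ a b z w * snd (psiF a b 0 w)"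
        using ne[OF an(2) F] by eventually_elim (simp add: Ge)
    qed
    moreover have "dep_germ a b z analytic_on {z}" unfolding Ge by (intro analytic_intros an) (use F in auto)
    ultimately show ?thesis by blast
  qed
  define d1 where "d1 n w = fst (phiF a b n w) - dep_germ a b z w * fst (psiF a b n w)" for n w
  define d2 where "d2 n w = snd (phiF a b n w) - dep_germ a b z w * snd (psiF a b n w)" for n w
  have rec: "d1 n w = w * d1 (n + 1) w + w * a n * d2 (n + 1) w" "d2 n w = b n * d1 (n + 1) w / w + d2 (n + 1) w / w"
    if "w \<in> ball 0 1 - {0}" for n w
  proof -
    have wD: "w \<in> DI" using that by (auto simp: DI_def)
    note s1 = psiF_sol[OF l1pair_summable(1)[OF ab] wD, unfolded is_sol_def, THEN spec, of n]
    note s2 = phiF_sol[OF ab wD, unfolded is_sol_def, THEN spec, of n]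
    show "d1 n w = w * d1 (n + 1) w + w * a n * d2 (n + 1) w" "d2 n w = b n * d1 (n + 1) w / w + d2 (n + 1) w / w"
      unfolding d1_def d2_def
      by (subst s1, subst s2, simp add: algebra_simps diff_divide_distrib add_divide_distrib)+
  qed
  have z0: "z \<noteq> 0" using z1 by auto
  have "vanish_order m z (d1 n) \<and> vanish_order m z (d2 n)" for n
  proof (induction n rule: int_induct[where k = 0])
    case base
    then show ?case using G unfolding d1_def[abs_def] d2_def[abs_def] by simp
  next
    case (step1 n)
    note inv = l1pair_nonzero[OF ab, of n]
    \<comment> \<open>Coefficients of the inverse transfer matrix; they are analytic at z because z
      is nonzero.\<close>
    have "vanish_order m z (\<lambda>w. 1 / ((1 - a n * b n) * w) * d1 n w + (- a n * w / (1 - a n * b n)) * d2 n w)"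
      by (intro vanish_order_add vanish_order_mult analytic_intros) (use step1 z0 inv in auto)
    then have 1: "vanish_order m z (d1 (n + 1))"
    proof (rule vanish_order_cong)
      show "\<forall>\<^sub>F w in nhds z. 1 / ((1 - a n * b n) * w) * d1 n w + (- a n * w / (1 - a n * b n)) * d2 n w = d1 (n + 1) w"
        using zD
      proof eventually_elim
        case (elim w)
        then show ?case using inv unfolding rec[OF elim, of n] by (simp add: divide_simps) (simp add: algebra_simps)
      qed
    qed
    have "vanish_order m z (\<lambda>w. (- b n / ((1 - a n * b n) * w)) * d1 n w + (w / (1 - a n * b n)) * d2 n w)"
      by (intro vanish_order_add vanish_order_mult analytic_intros) (use step1 z0 inv in auto)
    then have 2: "vanish_order m z (d2 (n + 1))"
    proof (rule vanish_order_cong)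
      show "\<forall>\<^sub>F w in nhds z. (- b n / ((1 - a n * b n) * w)) * d1 n w + (w / (1 - a n * b n)) * d2 n w = d2 (n + 1) w"
        using zD
      proof eventually_elim
        case (elim w)
        then show ?case using inv unfolding rec[OF elim, of n] by (simp add: divide_simps) (simp add: algebra_simps)
      qed
    qed
    from 1 2 show ?case by blast
  next
    case (step2 n)
    have "vanish_order m z (\<lambda>w. w * d1 n w + (w * a (n - 1)) * d2 n w)"
      by (intro vanish_order_add vanish_order_mult analytic_intros) (use step2 in auto)
    then have 1: "vanish_order m z (d1 (n - 1))"
    proof (rule vanish_order_cong)
      show "\<forall>\<^sub>F w in nhds z. w * d1 n w + (w * a (n - 1)) * d2 n w = d1 (n - 1) w"
        using zD by eventually_elim (use rec(1)[of _ "n - 1"] in simp)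
    qed
    have "vanish_order m z (\<lambda>w. (b (n - 1) / w) * d1 n w + (1 / w) * d2 n w)"
      by (intro vanish_order_add vanish_order_mult analytic_intros) (use step2 z0 in auto)
    then have 2: "vanish_order m z (d2 (n - 1))"
    proof (rule vanish_order_cong)
      show "\<forall>\<^sub>F w in nhds z. (b (n - 1) / w) * d1 n w + (1 / w) * d2 n w = d2 (n - 1) w"
        using zD by eventually_elim (use rec(2)[of _ "n - 1"] in simp)
    qed
    from 1 2 show ?case by blast
  qed
  then show ?thesis using G P that[of m H] unfolding d1_def[abs_def] d2_def[abs_def] by blast
qed

lemma CAB_residue: "CAB a b t = (\<Sum>z\<in>reps (poles a b). - 2 * bs_residue a b z t)"
  unfolding CAB_def
proof (intro sum.cong refl)
  fix z assume "z \<in> reps (poles a b)"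
  then have z: "z \<in> poles a b" using reps_props(1)[OF poles_0 poles_minus] by blast
  then have z1: "0 < norm z" "norm z < 1" by (auto simp: poles_iff)
  obtain m H where P: "pole_factor (Tr_ext a b) z m H" and G: "dep_germ a b z analytic_on {z}"
    and d: "\<forall>n. vanish_order m z (\<lambda>w. fst (phiF a b n w) - dep_germ a b z w * fst (psiF a b n w))"
     "\<forall>n. vanish_order m z (\<lambda>w. snd (phiF a b n w) - dep_germ a b z w * snd (psiF a b n w))"
    using pole_data[OF z] by blast
  have mm: "mult (Tr_ext a b) z = m" by (rule pole_factor_mult[OF P])
  have m0: "0 < m" using P by (simp add: pole_factor_def)
  have dep: "dep (jost_phi a b) (jost_psi a b) m z = (\<lambda>l. if l < m then (deriv ^^ l) (dep_germ a b z) z else 0)"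
    unfolding jost_phi_eq[OF ab] jost_psi_eq[OF l1pair_summable(1)[OF ab]]
    by (rule dep_eq[where Phi = "phiF a b" and Psi = "psiF a b" and z = z and G = "dep_germ a b z" and m = m,
          OF Jost_analytic[OF z1] G d[THEN spec] psi_nonzero[OF z1, of 0]])
  define e where "e k = (\<Sum>l\<in>{0..m - 1 - k}. tres (Tr_ext a b) z (k + 1 + l)
      * (if l < m then (deriv ^^ l) (dep_germ a b z) z else 0) / fact l)" for k
  have cn: "cnorm a b z k = - 2 * e k" for k
    by (simp only: cnorm_def Let_def mm dep e_def)
  have z0: "z \<noteq> 0" using z1 by auto
  have "(\<Sum>k<m. e k * (of_int t gchoose k) * z powi (t - int k)) = bs_residue a b z t"
    unfolding e_def bs_residue_def by (rule norming_sum[OF P G z0])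
  then show "(let m = mult (Tr_ext a b) z in (rowC m (cnorm a b z) * mat_powi (jordan_block m z) t * colB m) $$ (0, 0))
     = - 2 * bs_residue a b z t"
    unfolding Let_def mm jordan_CAB[OF m0 z0] cn by (simp add: sum_negf mult.assoc flip: sum_distrib_left)
qed

text \<open>T and the germ are even, so for odd t the sign of (-w)^t cancels the sign coming from
  the derivative of w -> -w.\<close>

lemma bs_residue_minus:
  assumes z: "z \<in> poles a b" and t: "odd t" shows "bs_residue a b (- z) t = bs_residue a b z t"
proof -
  obtain m H where P: "pole_factor (Tr_ext a b) z m H" and G: "dep_germ a b z analytic_on {z}"
    using pole_data[OF z] by metis
  have z0: "z \<noteq> 0" using z poles_0 by auto
  have d: "deriv uminus x = - 1" for x :: complex by (rule DERIV_imp_deriv) (auto intro!: derivative_eq_intros)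
  have "residue (\<lambda>w. Tr_ext a b (- w) * (dep_germ a b z (- w) * (- w) powi t) * deriv uminus w) (- z)
     = residue (\<lambda>v. Tr_ext a b v * (dep_germ a b z v * v powi t)) (- (- z))"
    using P G z0 by (intro residue_compose_pole_factor[where m = m and H = H] filterlim_at_inj)
      (auto intro!: analytic_intros power_int_analytic simp: d inj_def)
  moreover have "(\<lambda>w. Tr_ext a b (- w) * (dep_germ a b z (- w) * (- w) powi t) * deriv uminus w)
    = (\<lambda>w. Tr_ext a b w * (dep_germ a b (- z) w * w powi t))"
    using t by (simp add: d Tr_ext_eq[OF ab] scat_a_ext_minus[OF ab] dep_germ_minus power_int_minus_left fun_eq_iff)
  ultimately show ?thesis by (simp add: bs_residue_def)
qed

lemma CAB_odd:
  assumes fin: "finite (poles a b)" and t: "odd t"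
  shows "CAB a b t = - (\<Sum>z\<in>poles a b. bs_residue a b z t)"
  using sum_reps[of "poles a b" "\<lambda>z. bs_residue a b z t", OF poles_0 poles_minus fin bs_residue_minus[OF _ t]]
  by (simp add: CAB_residue sum_distrib_left sum_negf)

end

text \<open>With z = 1/v one has 1/w - v = (w - z) / (- w / v). The denominator is analytic and
  nonzero at z, so it can be absorbed into H without changing the order.\<close>

lemma pole_factor_inverse:
  assumes P: "pole_factor T v m H" and v: "v \<noteq> 0"
  shows "pole_factor (\<lambda>w. T (inverse w)) (inverse v) m (\<lambda>w. H (inverse w) * (- w / v) ^ m)"
proof -
  define z where "z = inverse v"
  have z: "z \<noteq> 0" "inverse z = v" using v by (auto simp: z_def)
  have H: "H analytic_on {inverse z}" "H v \<noteq> 0" and m: "0 < m" and T: "\<forall>\<^sub>F w in at (inverse z). T w = H w / (w - v) ^ m"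
    using P z by (auto simp: pole_factor_def)
  have i: "inverse analytic_on {z}" using z by (intro analytic_intros) auto
  have "(H \<circ> inverse) analytic_on {z}"
    by (rule analytic_on_compose[OF i]) (use H in simp)
  then have a: "(\<lambda>w. H (inverse w) * (- w / v) ^ m) analytic_on {z}"
    using v by (auto intro!: analytic_intros simp: o_def)
  have lim: "filterlim inverse (at (inverse z)) (at z)"
    by (rule filterlim_at_inj) (use z in \<open>auto intro!: continuous_intros inj_onI\<close>)
  have "\<forall>\<^sub>F w in at z. w \<in> - {0}" using z by (intro eventually_at_in_open') auto
  moreover have "\<forall>\<^sub>F w in at z. T (inverse w) = H (inverse w) / (inverse w - v) ^ m"
    by (rule eventually_compose_filterlim[OF T lim])
  ultimately have "\<forall>\<^sub>F w in at z. T (inverse w) = H (inverse w) * (- w / v) ^ m / (w - z) ^ m"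
  proof eventually_elim
    case (elim w)
    have "inverse w - v = (w - z) / (- w / v)" using elim z v by (simp add: z_def field_simps)
    then have "H (inverse w) / (inverse w - v) ^ m = H (inverse w) / ((w - z) ^ m / (- w / v) ^ m)" by (simp only: power_divide)
    then show ?case using elim by simp
  qed
  then show ?thesis using a H m z v unfolding pole_factor_def z_def[symmetric] by simp
qed

section \<open>The barred scattering data as scattering data of the swapped pair\<close>

context fixes a b assumes ab: "l1pair a b" begin

lemma l1pair_swap: "l1pair b a" using ab l1pair_commute by blast

lemma inv_Trb_eq: "inv_Trb a b z = inv_Tr b a (inverse z)"
  unfolding inv_Trb_def inv_Tr_def jost_phib_eq[OF l1pair_swap] flip_def
  by (simp add: power_int_inverse divide_inverse)

lemma Trb_eq: "Trb a b z = Tr b a (inverse z)"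
  by (simp add: Trb_def Tr_def inv_Trb_eq)

lemma Rrb_eq: "Rrb a b z = Rr b a (inverse z)"
  unfolding Rrb_def Rr_def Trb_eq jost_phib_eq[OF l1pair_swap] flip_def
  by (simp add: power_int_inverse divide_inverse)

lemma scat_a_ext_flip_holomorphic: "(\<lambda>z. scat_a_ext b a (inverse z)) holomorphic_on {z. 1 < norm z}"
proof -
  have "(scat_a_ext b a \<circ> inverse) holomorphic_on {z. 1 < norm z}"
    by (rule holomorphic_on_compose_gen[OF _ scat_a_ext_holomorphic[OF l1pair_swap]])
      (auto intro!: holomorphic_intros simp: norm_inverse inverse_less_1_iff)
  then show ?thesis by (simp add: o_def)
qed

lemma inv_Trb_ext_eq: "inv_Trb_ext a b = (\<lambda>z. if norm z < 1 then 0 else scat_a_ext b a (inverse z))"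
proof -
  let ?g = "\<lambda>z. if norm z < 1 then 0 else scat_a_ext b a (inverse z)"
  have *: "norm (inverse z) = 1" if "norm z = 1" for z :: complex using that by (simp add: norm_inverse)
  show ?thesis unfolding inv_Trb_ext_def
  proof (rule the_equality)
    have "?g holomorphic_on {z. 1 < norm z}"
      by (rule holomorphic_transform[OF scat_a_ext_flip_holomorphic]) auto
    moreover have "continuous_on DO ?g"
    proof -
      have "continuous_on DO (\<lambda>z. scat_a_ext b a (inverse z))"
        by (rule continuous_on_compose2[OF scat_a_ext_continuous[OF l1pair_swap]])
          (auto intro!: continuous_intros simp: DO_def norm_inverse inverse_le_1_iff)
      then show ?thesis by (rule continuous_on_eq) (auto simp: DO_def)
    qed
    ultimately show "?g holomorphic_on {z. 1 < norm z} \<and> continuous_on DO ?g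
      \<and> (\<forall>z. norm z = 1 \<longrightarrow> ?g z = inv_Trb a b z) \<and> (\<forall>z. norm z < 1 \<longrightarrow> ?g z = 0)"
      by (auto simp: inv_Trb_eq inv_Tr_eq[OF l1pair_swap] scat_a_ext_circle[OF l1pair_swap] *)
    fix g assume g: "g holomorphic_on {z. 1 < norm z} \<and> continuous_on DO g
      \<and> (\<forall>z. norm z = 1 \<longrightarrow> g z = inv_Trb a b z) \<and> (\<forall>z. norm z < 1 \<longrightarrow> g z = 0)"
    show "g = ?g"
    proof
      fix z
      show "g z = ?g z"
      proof (cases "norm z < 1")
        case False
        then have zD: "inverse z \<in> DI" by (simp add: inverse_DI_iff DO_def)
        have "(g \<circ> inverse) holomorphic_on (ball 0 1 - {0})"
          by (rule holomorphic_on_compose_gen[of _ _ _ "{z. 1 < norm z}"])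
            (use g in \<open>auto intro!: holomorphic_intros simp: norm_inverse one_less_inverse_iff\<close>)
        then have h: "(\<lambda>w. g (inverse w) - scat_a_ext b a w) holomorphic_on (ball 0 1 - {0})"
          by (intro holomorphic_intros holomorphic_on_subset[OF scat_a_ext_holomorphic[OF l1pair_swap]]) (auto simp: o_def)
        have "continuous_on DI (\<lambda>w. g (inverse w))"
          by (rule continuous_on_compose2[where g = g and t = DO])
            (use g in \<open>auto intro!: continuous_intros simp: inverse_DO_iff\<close>, auto simp: DI_def)
        then have c: "continuous_on DI (\<lambda>w. g (inverse w) - scat_a_ext b a w)"
          by (intro continuous_intros continuous_on_subset[OF scat_a_ext_continuous[OF l1pair_swap]]) (auto simp: DI_def)
        have "g (inverse (inverse z)) - scat_a_ext b a (inverse z) = 0"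
          by (rule boundary_vanish[OF h c _ zD]) (use g in \<open>simp add: inv_Trb_eq inv_Tr_eq[OF l1pair_swap] scat_a_ext_circle[OF l1pair_swap] *\<close>)
        then show ?thesis using False by simp
      qed (use g in simp)
    qed
  qed
qed

lemma Trb_ext_eq: "1 \<le> norm z \<Longrightarrow> Trb_ext a b z = Tr_ext b a (inverse z)"
  by (simp add: Trb_ext_def inv_Trb_ext_eq Tr_ext_eq[OF l1pair_swap])

lemma Trb_ext_ev: "1 < norm z \<Longrightarrow> \<forall>\<^sub>F w in at z. Trb_ext a b w = Tr_ext b a (inverse w)"
proof -
  assume z: "1 < norm z"
  have "open {z :: complex. 1 < norm z}" by (intro open_Collect_less continuous_intros)
  then have "\<forall>\<^sub>F w in at z. w \<in> {z. 1 < norm z}" using z by (intro eventually_at_in_open') auto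
  then show ?thesis by eventually_elim (auto intro: Trb_ext_eq)
qed

lemma pole_factor_Trb_ext:
  assumes z: "1 < norm z" and P: "pole_factor (Tr_ext b a) (inverse z) m H"
  shows "pole_factor (Trb_ext a b) z m (\<lambda>w. H (inverse w) * (- w / inverse z) ^ m)"
proof -
  have "z \<noteq> 0" using z by auto
  with pole_factor_inverse[OF P] Trb_ext_ev[OF z] show ?thesis
    unfolding pole_factor_def by (auto elim: eventually_elim2)
qed

lemma polesb_iff: "z \<in> polesb a b \<longleftrightarrow> inverse z \<in> poles b a"
proof (cases "1 < norm z")
  case z: True
  then have iz: "0 < norm (inverse z)" "norm (inverse z) < 1" by (auto simp: norm_inverse inverse_less_1_iff)
  show ?thesis
  proof (cases "scat_a_ext b a (inverse z) = 0")
    case True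
    obtain m H where "pole_factor (Tr_ext b a) (inverse z) m H" using pole_factor_ex[OF l1pair_swap iz True] .
    from pole_factor_is_pole[OF pole_factor_Trb_ext[OF z this]] show ?thesis using z iz True by (simp add: polesb_def poles_iff[OF l1pair_swap])
  next
    case False
    let ?D = "{z. 1 < norm z}"
    define V where "V = ?D \<inter> (\<lambda>z. scat_a_ext b a (inverse z)) -` (- {0})"
    have "open ?D" by (intro open_Collect_less continuous_intros)
    then have "open V" unfolding V_def
      by (intro continuous_open_preimage holomorphic_on_imp_continuous_on[OF scat_a_ext_flip_holomorphic]) auto
    moreover have "(\<lambda>z. 1 / scat_a_ext b a (inverse z)) holomorphic_on V"
      by (intro holomorphic_intros holomorphic_on_subset[OF scat_a_ext_flip_holomorphic]) (auto simp: V_def)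
    then have "Trb_ext a b holomorphic_on V"
      by (rule holomorphic_transform) (auto simp: V_def Trb_ext_eq Tr_ext_eq[OF l1pair_swap])
    moreover have "z \<in> V" using z False by (auto simp: V_def)
    ultimately have "\<not> is_pole (Trb_ext a b) z" by (intro not_is_pole_holomorphic)
    then show ?thesis using False by (auto simp: polesb_def poles_iff[OF l1pair_swap])
  qed
next
  case False
  then show ?thesis by (auto simp: polesb_def poles_iff[OF l1pair_swap] norm_inverse inverse_less_1_iff)
qed

lemma polesb_eq: "polesb a b = inverse ` poles b a"
proof (intro equalityI subsetI)
  fix z assume "z \<in> polesb a b"
  then have "inverse z \<in> poles b a" by (simp only: polesb_iff)
  then have "inverse (inverse z) \<in> inverse ` poles b a" by (rule imageI)
  then show "z \<in> inverse ` poles b a" by simp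
next
  fix z assume "z \<in> inverse ` poles b a"
  then obtain w where "w \<in> poles b a" "z = inverse w" by blast
  then show "z \<in> polesb a b" by (simp add: polesb_iff)
qed

lemma polesb_minus: "z \<in> polesb a b \<Longrightarrow> - z \<in> polesb a b"
  by (simp add: polesb_iff poles_minus[OF l1pair_swap])

lemma polesb_0: "0 \<notin> polesb a b" by (simp add: polesb_iff poles_0[OF l1pair_swap])

text \<open>Substituting w = 1/x turns w^t dw into - x^(- t - 2) dx, which explains the exponent.
  The minus sign converts the factor 2 of \<open>cnormb\<close> into the -2 of
  \<open>cnorm\<close>.\<close>

lemma CABb_residue: "CABb a b t = (\<Sum>z\<in>reps (polesb a b). - 2 * bs_residue b a (inverse z) (- t - 2))"
  unfolding CABb_def
proof (intro sum.cong refl)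
  fix z assume "z \<in> reps (polesb a b)"
  then have zb: "z \<in> polesb a b" using reps_props(1)[OF polesb_0 polesb_minus] by blast
  then have z: "1 < norm z" by (simp add: polesb_def)
  define v where "v = inverse z"
  have v: "v \<in> poles b a" using zb by (simp add: polesb_iff v_def)
  then have v1: "0 < norm v" "norm v < 1" by (auto simp: poles_iff[OF l1pair_swap])
  have z0: "z \<noteq> 0" using z by auto
  obtain m H where P: "pole_factor (Tr_ext b a) v m H" and G: "dep_germ b a v analytic_on {v}"
    and d: "\<forall>n. vanish_order m v (\<lambda>w. fst (phiF b a n w) - dep_germ b a v w * fst (psiF b a n w))"
     "\<forall>n. vanish_order m v (\<lambda>w. snd (phiF b a n w) - dep_germ b a v w * snd (psiF b a n w))"
    using pole_data[OF l1pair_swap v] by blast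
  define G' where "G' w = dep_germ b a v (inverse w)" for w
  note P' = pole_factor_Trb_ext[OF z P[unfolded v_def]]
  have mm: "mult (Trb_ext a b) z = m" by (rule pole_factor_mult[OF P'])
  have m0: "0 < m" using P by (simp add: pole_factor_def)
  have inv: "inverse analytic_on {z}" using z0 by (intro analytic_intros) auto
  have ac: "(\<lambda>w. f (inverse w)) analytic_on {z}" if "f analytic_on {v}" for f
    using analytic_on_compose[OF inv, of f] that by (simp add: v_def o_def)
  have lim: "filterlim inverse (nhds v) (nhds z)"
    using analytic_at_imp_isCont[OF inv] by (simp add: v_def isCont_def tendsto_at_iff_tendsto_nhds)
  have G'a: "G' analytic_on {z}" unfolding G'_def[abs_def] by (rule ac[OF G])
  have cd: "vanish_order m z (\<lambda>w. f (inverse w))" if f: "vanish_order m v f" for f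
  proof -
    obtain h where h: "h analytic_on {v}" "\<forall>\<^sub>F w in nhds v. f w = (w - v) ^ m * h w" using f by (auto simp: vanish_order_def)
    have "\<forall>\<^sub>F w in nhds z. w \<in> - {0}" using z0 by (intro eventually_nhds_in_open) auto
    moreover have "\<forall>\<^sub>F w in nhds z. f (inverse w) = (inverse w - v) ^ m * h (inverse w)"
      by (rule eventually_compose_filterlim[OF h(2) lim])
    ultimately have "\<forall>\<^sub>F w in nhds z. f (inverse w) = (w - z) ^ m * ((- v / w) ^ m * h (inverse w))"
    proof eventually_elim
      case (elim w)
      have "inverse w - v = (w - z) * (- v / w)" using elim z0 by (simp add: v_def field_simps)
      then have "(inverse w - v) ^ m = (w - z) ^ m * (- v / w) ^ m" by (simp only: power_mult_distrib)
      then show ?case unfolding elim(2) by (simp only: mult.assoc)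
    qed
    moreover have "(\<lambda>w. (- v / w) ^ m * h (inverse w)) analytic_on {z}"
      using z0 by (intro analytic_intros ac h) auto
    ultimately show ?thesis unfolding vanish_order_def by blast
  qed
  have dep: "dep (jost_phib a b) (jost_psib a b) m z = (\<lambda>l. if l < m then (deriv ^^ l) G' z else 0)"
    unfolding jost_phib_eq[OF l1pair_swap] jost_psib_eq[OF l1pair_summable(1)[OF l1pair_swap]] jost_phi_eq[OF l1pair_swap] jost_psi_eq[OF l1pair_summable(1)[OF l1pair_swap]]
  proof (rule dep_eq[where z = z and G = G' and m = m and Phi = "flip (phiF b a)" and Psi = "flip (psiF b a)"])
    show "\<And>n. (\<lambda>w. fst (flip (psiF b a) n w)) analytic_on {z}" "\<And>n. (\<lambda>w. snd (flip (psiF b a) n w)) analytic_on {z}"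
      "\<And>n. (\<lambda>w. fst (flip (phiF b a) n w)) analytic_on {z}" "\<And>n. (\<lambda>w. snd (flip (phiF b a) n w)) analytic_on {z}"
      unfolding flip_def fst_swap snd_swap using ac[OF Jost_analytic(1)[OF l1pair_swap v1]] ac[OF Jost_analytic(2)[OF l1pair_swap v1]]
       ac[OF Jost_analytic(3)[OF l1pair_swap v1]] ac[OF Jost_analytic(4)[OF l1pair_swap v1]] by auto
    show "\<And>n. vanish_order m z (\<lambda>w. fst (flip (phiF b a) n w) - G' w * fst (flip (psiF b a) n w))"
      "\<And>n. vanish_order m z (\<lambda>w. snd (flip (phiF b a) n w) - G' w * snd (flip (psiF b a) n w))"
      unfolding flip_def fst_swap snd_swap G'_def using cd[OF d(2)[THEN spec]] cd[OF d(1)[THEN spec]] by auto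
    show "flip (psiF b a) 0 z \<noteq> (0, 0)" using psi_nonzero[OF l1pair_swap v1, of 0]
      by (auto simp: flip_def v_def prod_eq_iff)
  qed (rule G'a)
  define e where "e k = (\<Sum>l\<in>{0..m - 1 - k}. tres (Trb_ext a b) z (k + 1 + l)
      * (if l < m then (deriv ^^ l) G' z else 0) / fact l)" for k
  have cn: "cnormb a b z k = 2 * e k" for k
    by (simp only: cnormb_def Let_def mm dep e_def)
  have Gp: "(\<lambda>x. dep_germ b a v x * x powi (- t - 2)) analytic_on {v}"
    using v1 by (intro analytic_intros G power_int_analytic) auto
  have "residue (\<lambda>w. Trb_ext a b w * (G' w * w powi t)) z
      = residue (\<lambda>w. Tr_ext b a (inverse w) * - (dep_germ b a v (inverse w) * inverse w powi (- t - 2)) * deriv inverse w) z"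
  proof (rule residue_cong[OF _ refl])
    have "\<forall>\<^sub>F w in at z. w \<in> - {0}" using z0 by (intro eventually_at_in_open') auto
    with Trb_ext_ev[OF z] show "\<forall>\<^sub>F w in at z. Trb_ext a b w * (G' w * w powi t)
        = Tr_ext b a (inverse w) * - (dep_germ b a v (inverse w) * inverse w powi (- t - 2)) * deriv inverse w"
    proof eventually_elim
      case (elim w)
      then have w: "w \<noteq> 0" by simp
      have "deriv inverse w = - (inverse w * 1 * inverse w)"
        by (intro DERIV_imp_deriv DERIV_inverse' DERIV_ident w)
      moreover have "inverse w powi (- t - 2) = w powi (t + 2)"
        by (simp add: power_int_inverse add.commute flip: power_int_minus)
      moreover have "w powi (t + 2) = w powi t * (w * w)" using power_int_add[of w t 2] w by (simp add: power2_eq_square)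
      ultimately show ?case using elim w by (simp add: G'_def field_simps)
    qed
  qed
  also have "\<dots> = residue (\<lambda>x. Tr_ext b a x * - (dep_germ b a v x * x powi (- t - 2))) (inverse z)"
  proof (rule residue_compose_pole_factor[where m = m and H = H and g = inverse and T = "Tr_ext b a" and h = "\<lambda>x. - (dep_germ b a v x * x powi (- t - 2))"])
    show "(\<lambda>x. - (dep_germ b a v x * x powi (- t - 2))) analytic_on {inverse z}"
      using analytic_on_neg[OF Gp] by (simp add: v_def)
    have "(inverse has_field_derivative - (inverse z * 1 * inverse z)) (at z)"
      by (intro DERIV_inverse' DERIV_ident z0)
    then show "deriv inverse z \<noteq> 0" using z0 by (simp add: DERIV_imp_deriv)
    show "filterlim inverse (at (inverse z)) (at z)"
      by (rule filterlim_at_inj) (use z0 in \<open>auto intro!: continuous_intros inj_onI\<close>)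
  qed (use P inv in \<open>simp_all add: v_def\<close>)
  also have "\<dots> = - bs_residue b a v (- t - 2)"
    unfolding bs_residue_def v_def[symmetric] by (rule pole_factor_residue_neg[OF P Gp])
  finally have res: "residue (\<lambda>w. Trb_ext a b w * (G' w * w powi t)) z = - bs_residue b a v (- t - 2)" .
  have "(\<Sum>k<m. e k * (of_int t gchoose k) * z powi (t - int k)) = residue (\<lambda>w. Trb_ext a b w * (G' w * w powi t)) z"
    unfolding e_def by (rule norming_sum[OF P' G'a z0])
  then show "(let m = mult (Trb_ext a b) z in (rowC m (cnormb a b z) * mat_powi (jordan_block m z) t * colB m) $$ (0, 0))
     = - 2 * bs_residue b a (inverse z) (- t - 2)"
    unfolding Let_def mm jordan_CAB[OF m0 z0] cn res v_def by (simp add: sum_negf mult.assoc flip: sum_distrib_left)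
qed

text \<open>For t = - k - 1 the exponent - t - 2 is k - 1, so the bound-state parts of
  \<open>Omegab a b k\<close> and \<open>Omega b a k\<close> agree when k is even.\<close>

lemma CABb_odd:
  assumes fin: "finite (polesb a b)" and t: "odd t"
  shows "CABb a b t = CAB b a (- t - 2)"
proof -
  have t': "odd (- t - 2)" using t by simp
  have finp: "finite (poles b a)" using fin unfolding polesb_eq by (rule finite_imageD) (auto intro: inj_onI)
  define F where "F z = bs_residue b a (inverse z) (- t - 2)" for z
  have "CABb a b t = - (2 * sum F (reps (polesb a b)))"
    unfolding CABb_residue F_def by (simp add: sum_distrib_left sum_negf)
  also have "2 * sum F (reps (polesb a b)) = sum F (polesb a b)"
    by (rule sum_reps[OF polesb_0 polesb_minus fin, symmetric]) (simp_all add: F_def bs_residue_minus[OF l1pair_swap _ t'] polesb_iff)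
  also have "sum F (polesb a b) = (\<Sum>z\<in>poles b a. bs_residue b a z (- t - 2))"
    unfolding polesb_eq by (subst sum.reindex) (auto intro: inj_onI simp: F_def)
  finally show ?thesis unfolding CAB_odd[OF l1pair_swap finp t'] .
qed

end

subsection \<open>Contour integrals over the unit circle\<close>

lemma circlepath_vector_derivative:
  "vector_derivative (circlepath z r) (at x) = 2 * of_real pi * \<i> * of_real r * exp (2 * of_real pi * \<i> * of_real x)"
proof (rule vector_derivative_at)
  have "((\<lambda>w. z + of_real r * exp (2 * of_real pi * \<i> * w)) has_field_derivative
      2 * of_real pi * \<i> * of_real r * exp (2 * of_real pi * \<i> * of_real x)) (at (of_real x))"
    by (auto intro!: derivative_eq_intros)
  from has_vector_derivative_real_field[OF this]
  show "(circlepath z r has_vector_derivative 2 * of_real pi * \<i> * of_real r * exp (2 * of_real pi * \<i> * of_real x)) (at x)"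
    unfolding circlepath .
qed

lemma circ_int_cong: "(\<And>z. norm z = 1 \<Longrightarrow> f z = g z) \<Longrightarrow> circ_int f = circ_int g"
  unfolding circ_int_def by (intro arg_cong2[where f = "(/)"] contour_integral_cong refl) auto

text \<open>Inversion traverses the unit circle backwards, and this sign cancels the one in the
  derivative - 1/z^2.\<close>

lemma circ_int_inverse: "circ_int (\<lambda>z. g (inverse z) * (inverse z)\<^sup>2) = circ_int g"
proof -
  let ?c = "circlepath 0 1 :: real \<Rightarrow> complex" and ?e = "\<lambda>t. exp (2 * of_real pi * \<i> * of_real t) :: complex"
  have rc: "reversepath ?c = (\<lambda>t. inverse (?e t))"
  proof
    fix t
    have e: "2 * of_real pi * \<i> * of_real (1 - t) = 2 * of_real pi * \<i> - 2 * of_real pi * \<i> * complex_of_real t"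
      by (simp add: algebra_simps)
    show "reversepath ?c t = inverse (?e t)"
      unfolding reversepath_def circlepath e exp_diff by (simp add: inverse_eq_divide)
  qed
  have vd: "vector_derivative (reversepath ?c) (at t) = - (2 * of_real pi * \<i> * inverse (?e t))" for t
  proof (rule vector_derivative_at)
    have "((\<lambda>w. exp (- (2 * of_real pi * \<i> * w))) has_field_derivative
       exp (- (2 * of_real pi * \<i> * of_real t)) * - (2 * of_real pi * \<i>)) (at (of_real t))"
      by (auto intro!: derivative_eq_intros)
    from has_vector_derivative_real_field[OF this]
    have "((\<lambda>t. exp (- (2 * of_real pi * \<i> * of_real t))) has_vector_derivative
       exp (- (2 * of_real pi * \<i> * of_real t)) * - (2 * of_real pi * \<i>)) (at t)" .
    then show "(reversepath ?c has_vector_derivative - (2 * of_real pi * \<i> * inverse (?e t))) (at t)"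
      unfolding rc by (simp add: exp_minus mult.commute)
  qed
  have "- contour_integral ?c g = contour_integral (reversepath ?c) g"
    by (simp add: contour_integral_reversepath)
  also have "\<dots> = integral {0..1} (\<lambda>t. g (inverse (?e t)) * - (2 * of_real pi * \<i> * inverse (?e t)))"
    unfolding contour_integral_integral vd unfolding rc ..
  also have "\<dots> = integral {0..1} (\<lambda>t. - (g (inverse (?c t)) * (inverse (?c t))\<^sup>2 * vector_derivative ?c (at t)))"
  proof (rule integral_cong)
    fix t
    have alg: "G * - (c * inverse X) = - (G * (inverse X)\<^sup>2 * (c * of_real 1 * X))" if "X \<noteq> 0" for G c X :: complex
      using that by (simp add: power2_eq_square)
    have "circlepath 0 1 t = ?e t" by (simp add: circlepath)
    then show "g (inverse (?e t)) * - (2 * of_real pi * \<i> * inverse (?e t))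
      = - (g (inverse (?c t)) * (inverse (?c t))\<^sup>2 * vector_derivative ?c (at t))"
      unfolding circlepath_vector_derivative by (simp only: alg[OF exp_not_eq_zero])
  qed
  also have "\<dots> = - contour_integral ?c (\<lambda>z. g (inverse z) * (inverse z)\<^sup>2)"
    unfolding contour_integral_integral by (simp add: integral_neg)
  finally show ?thesis by (simp add: circ_int_def)
qed

lemma circ_int_powi: "circ_int (\<lambda>z. z powi j) = (if j = - 1 then 1 else 0)"
proof (cases "j = - 1")
  case True
  then show ?thesis using contour_integral_circlepath[of 1 0] by (simp add: circ_int_def power_int_minus divide_inverse)
next
  case False
  have "((\<lambda>z. z powi j) has_contour_integral
      (\<lambda>z. z powi (j + 1) / of_int (j + 1)) (pathfinish (circlepath 0 1)) - (\<lambda>z. z powi (j + 1) / of_int (j + 1)) (pathstart (circlepath 0 1))) (circlepath 0 1)"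
  proof (rule contour_integral_primitive[of "- {0}"])
    have nz: "(of_int (j + 1) :: complex) \<noteq> 0" using False by (simp only: of_int_eq_0_iff)
    fix z :: complex assume "z \<in> - {0}"
    then have "((\<lambda>z. z powi (j + 1)) has_field_derivative of_int (j + 1) * z powi (j + 1 - 1)) (at z within - {0})"
      by (auto intro!: derivative_eq_intros)
    from DERIV_cdivide[OF this, of "of_int (j + 1)"] nz
    show "((\<lambda>z. z powi (j + 1) / of_int (j + 1)) has_field_derivative z powi j) (at z within - {0})"
      by simp
  qed auto
  then have "((\<lambda>z. z powi j) has_contour_integral 0) (circlepath 0 1)" by simp
  then show ?thesis using False by (simp add: circ_int_def contour_integral_unique)
qed

text \<open>Uniform convergence on the circle, by the M-test against B * norm (c k). The circle is
  left general because the lemma serves both the unit circle and small circles around poles.\<close>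

lemma circle_sums:
  assumes c: "summable (\<lambda>k. norm (c k))" and F: "continuous_on (sphere z0 r) F" and r: "0 < r"
    and sub: "sphere z0 r \<subseteq> cball 0 1"
  shows "(\<lambda>k. c k * contour_integral (circlepath z0 r) (\<lambda>w. F w * w ^ k)) sums
    contour_integral (circlepath z0 r) (\<lambda>w. F w * power_sum c w)"
proof -
  have "compact (F ` sphere z0 r)" by (intro compact_continuous_image F) auto
  then obtain B where B: "\<And>w. w \<in> sphere z0 r \<Longrightarrow> norm (F w) \<le> B"
    by (meson bounded_iff compact_imp_bounded imageI)
  have int: "(\<lambda>w. c k * (F w * w ^ k)) contour_integrable_on circlepath z0 r"
    "(\<lambda>w. F w * w ^ k) contour_integrable_on circlepath z0 r" for k
    using r by (auto intro!: contour_integrable_continuous_circlepath continuous_intros F)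
  have ul: "uniform_limit (sphere z0 r) (\<lambda>n w. \<Sum>k<n. c k * (F w * w ^ k)) (\<lambda>w. \<Sum>k. c k * (F w * w ^ k)) sequentially"
  proof (rule Weierstrass_m_test)
    show "summable (\<lambda>k. B * norm (c k))" by (intro summable_mult c)
    fix k w assume w: "w \<in> sphere z0 r"
    then have w1: "norm w \<le> 1" using sub by auto
    have "norm (c k * (F w * w ^ k)) = norm (F w) * norm (c k * w ^ k)" by (simp add: norm_mult)
    also have "\<dots> \<le> B * norm (c k)"
      using B[OF w] power_sum_term_le[OF c w1, of k] order_trans[OF norm_ge_zero B[OF w]] by (intro mult_mono) simp_all
    finally show "norm (c k * (F w * w ^ k)) \<le> B * norm (c k)" .
  qed
  have "(\<lambda>n. contour_integral (circlepath z0 r) (\<lambda>w. \<Sum>k<n. c k * (F w * w ^ k)))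
      \<longlonglongrightarrow> contour_integral (circlepath z0 r) (\<lambda>w. \<Sum>k. c k * (F w * w ^ k))"
  proof (rule contour_integral_uniform_limit_circlepath(2)[OF _ ul _ r])
    show "\<forall>\<^sub>F n in sequentially. (\<lambda>w. \<Sum>k<n. c k * (F w * w ^ k)) contour_integrable_on circlepath z0 r"
      by (rule always_eventually) (simp add: contour_integrable_sum int(1))
  qed simp
  moreover have "contour_integral (circlepath z0 r) (\<lambda>w. \<Sum>k<n. c k * (F w * w ^ k))
      = (\<Sum>k<n. c k * contour_integral (circlepath z0 r) (\<lambda>w. F w * w ^ k))" for n
  proof -
    have "contour_integral (circlepath z0 r) (\<lambda>w. \<Sum>k<n. c k * (F w * w ^ k))
      = (\<Sum>k<n. contour_integral (circlepath z0 r) (\<lambda>w. c k * (F w * w ^ k)))"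
      by (rule contour_integral_sum) (simp_all add: int(1))
    then show ?thesis by (simp only: contour_integral_lmul[OF int(2)])
  qed
  moreover have "contour_integral (circlepath z0 r) (\<lambda>w. \<Sum>k. c k * (F w * w ^ k)) = contour_integral (circlepath z0 r) (\<lambda>w. F w * power_sum c w)"
  proof (rule contour_integral_cong[OF refl])
    fix w assume "w \<in> path_image (circlepath z0 r)"
    then have w1: "norm w \<le> 1" using sub r by auto
    show "(\<Sum>k. c k * (F w * w ^ k)) = F w * power_sum c w"
      unfolding power_sum_def suminf_mult[OF power_sum_summable[OF c w1], symmetric] by (simp add: mult_ac)
  qed
  ultimately show ?thesis by (simp add: sums_def)
qed

text \<open>The integral over the circle of radius \<open>s < 1\<close> is constant for s close to 1 and continuous
  up to \<open>s = 1\<close>.\<close>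

lemma residue_theorem_closed_disc:
  assumes P: "finite P" "P \<subseteq> ball 0 1" and h: "F holomorphic_on ball 0 1 - P" and c: "continuous_on (cball 0 1 - P) F"
  shows "circ_int F = (\<Sum>p\<in>P. residue F p)"
proof -
  \<comment> \<open>The largest modulus of a pole; the inserted 0 covers the case of no poles. Every
    circle of radius at least \<rho>, the midpoint between \<rho>0 and 1, then encloses all of
    P.\<close>
  define \<rho>0 where "\<rho>0 = Max (insert 0 (norm ` P))"
  have \<rho>0: "0 \<le> \<rho>0" "\<rho>0 < 1" "\<And>p. p \<in> P \<Longrightarrow> norm p \<le> \<rho>0" unfolding \<rho>0_def using P by auto
  define \<rho> where "\<rho> = (1 + \<rho>0) / 2"
  have \<rho>: "\<rho>0 < \<rho>" "\<rho> < 1" "0 < \<rho>" using \<rho>0 by (auto simp: \<rho>_def)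
  define I where "I s = contour_integral (circlepath 0 s) F" for s
  let ?e = "\<lambda>t. exp (2 * of_real pi * \<i> * of_real t) :: complex"
  have Iint: "I s = integral (cbox 0 1) (\<lambda>t. F (of_real s * ?e t) * (2 * of_real pi * \<i> * of_real s * ?e t))" for s
    unfolding I_def contour_integral_integral circlepath_vector_derivative by (simp add: circlepath)
  have "continuous_on ({\<rho>..1} \<times> cbox 0 1) (\<lambda>(s, t). F (of_real s * ?e t) * (2 * of_real pi * \<i> * of_real s * ?e t))"
    unfolding split_def
  proof (intro continuous_intros continuous_on_compose2[OF c])
    show "(\<lambda>x. complex_of_real (fst x) * ?e (snd x)) ` ({\<rho>..1} \<times> cbox 0 1) \<subseteq> cball 0 1 - P"
    proof
      fix y assume "y \<in> (\<lambda>x. complex_of_real (fst x) * ?e (snd x)) ` ({\<rho>..1} \<times> cbox 0 1)"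
      then obtain x where "x \<in> {\<rho>..1} \<times> cbox 0 1" "y = complex_of_real (fst x) * ?e (snd x)" by blast
      then obtain s t where st: "s \<in> {\<rho>..1}" "y = complex_of_real s * ?e t" by (cases x) auto
      then have "norm y = s" using \<rho> by (simp add: norm_mult norm_exp_eq_Re)
      then show "y \<in> cball 0 1 - P" using st(1) \<rho> \<rho>0(3)[of y] by auto
    qed
  qed
  from integral_continuous_on_param[OF this] have cI: "continuous_on {\<rho>..1} I" unfolding Iint .
  have Is: "I s = 2 * pi * \<i> * (\<Sum>p\<in>P. residue F p)" if s: "s \<in> {\<rho>..<1}" for s
  proof -
    have "I s = of_real (2 * pi) * \<i> * (\<Sum>p\<in>P. winding_number (circlepath 0 s) p * residue F p)"
      unfolding I_def
    proof (rule Residue_theorem[of "ball 0 1"])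
      show "path_image (circlepath 0 s) \<subseteq> ball 0 1 - P" using s \<rho> \<rho>0(3) by fastforce
      show "\<forall>z. z \<notin> ball 0 1 \<longrightarrow> winding_number (circlepath 0 s) z = 0"
        using s \<rho> by (auto intro!: winding_number_zero_outside[of _ "cball 0 s"])
    qed (use P h in auto)
    also have "(\<Sum>p\<in>P. winding_number (circlepath 0 s) p * residue F p) = (\<Sum>p\<in>P. residue F p)"
    proof (intro sum.cong refl)
      fix p assume "p \<in> P"
      then have "norm (p - 0) < s" using \<rho>0(3)[of p] \<rho> s by auto
      then show "winding_number (circlepath 0 s) p * residue F p = residue F p" by (simp add: winding_number_circlepath)
    qed
    finally show ?thesis by simp
  qed
  have "(I \<longlongrightarrow> I 1) (at 1 within {\<rho>..1})" using cI \<rho> by (auto simp: continuous_on_def)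
  then have l: "(I \<longlongrightarrow> I 1) (at 1 within {\<rho>..<1})" by (rule tendsto_within_subset) auto
  have "eventually (\<lambda>s. I s = 2 * pi * \<i> * (\<Sum>p\<in>P. residue F p)) (at 1 within {\<rho>..<1})"
  proof -
    have "\<forall>x. x \<noteq> 1 \<longrightarrow> x \<in> {\<rho>..<1} \<longrightarrow> I x = 2 * pi * \<i> * (\<Sum>p\<in>P. residue F p)" using Is by blast
    then show ?thesis by (simp only: eventually_at_filter always_eventually)
  qed
  then have l2: "(I \<longlongrightarrow> 2 * pi * \<i> * (\<Sum>p\<in>P. residue F p)) (at 1 within {\<rho>..<1})" by (rule tendsto_eventually)
  have "at 1 within {\<rho>..<1} \<noteq> bot"
  proof -
    have "at_left (1::real) \<noteq> bot" by simp
    moreover have "at 1 within {\<rho>..<1} = at_left (1::real)" using \<rho> by (intro at_within_nhd[of 1 "{\<rho><..}"]) auto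
    ultimately show ?thesis by simp
  qed
  then have "I 1 = 2 * pi * \<i> * (\<Sum>p\<in>P. residue F p)" by (rule tendsto_unique[OF _ l l2])
  then show ?thesis by (simp add: circ_int_def I_def)
qed

text \<open>The coefficients of \<open>z powi (n + int i)\<close> in \<open>\<psi> n\<close>.\<close>

definition psi_coeff :: "(int \<Rightarrow> complex) \<Rightarrow> (int \<Rightarrow> complex) \<Rightarrow> int \<Rightarrow> nat \<Rightarrow> complex \<times> complex" where
  "psi_coeff a b n i = (if even i \<and> 2 \<le> i then jq a b (i div 2 - 1) n else 0, if even i then jp a b (i div 2) n else 0)"

lemma psi_coeff_odd: "odd i \<Longrightarrow> psi_coeff a b n i = (0, 0)" by (simp add: psi_coeff_def)
lemma psi_coeff_0: "psi_coeff a b n 0 = (0, 1)" by (simp add: psi_coeff_def)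

context fixes a b assumes ab: "right_summable a b" begin

text \<open>Series in w = z^2 are spread over the even exponents of z by the reindexings k -> 2 k
  and, for the first component with its extra factor w, k -> 2 k + 2. The last bound leaves out the
  leading coefficient 1 and becomes small for large n.\<close>

lemma psi_coeff_props:
  "summable (\<lambda>i. norm (fst (psi_coeff a b n i)))" "summable (\<lambda>i. norm (snd (psi_coeff a b n i)))"
  "norm z \<le> 1 \<Longrightarrow> power_sum (\<lambda>i. fst (psi_coeff a b n i)) z = z\<^sup>2 * JQ a b n (z\<^sup>2)"
  "norm z \<le> 1 \<Longrightarrow> power_sum (\<lambda>i. snd (psi_coeff a b n i)) z = JP a b n (z\<^sup>2)"
  "(\<Sum>i. norm (snd (psi_coeff a b n (Suc i)))) \<le> exp (tail_mass a b n) - 1"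
proof -
  have m1: "strict_mono (\<lambda>k::nat. 2 * k + 2)" "strict_mono (\<lambda>k::nat. 2 * k)" by (auto simp: strict_mono_def)
  have r1: "i \<notin> range (\<lambda>k::nat. 2 * k + 2) \<Longrightarrow> fst (psi_coeff a b n i) = 0" for i
  proof (rule ccontr)
    assume i: "i \<notin> range (\<lambda>k::nat. 2 * k + 2)" and "fst (psi_coeff a b n i) \<noteq> 0"
    then have "even i" "2 \<le> i" by (auto simp: psi_coeff_def split: if_splits)
    then have "i = 2 * (i div 2 - 1) + 2" by auto
    with i show False by blast
  qed
  have r2: "i \<notin> range (\<lambda>k::nat. 2 * k) \<Longrightarrow> snd (psi_coeff a b n i) = 0" for i
    by (auto simp: psi_coeff_def image_iff elim!: evenE)
  have e1: "fst (psi_coeff a b n (2 * k + 2)) = jq a b k n" and e2: "snd (psi_coeff a b n (2 * k)) = jp a b k n" for k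
    by (simp_all add: psi_coeff_def)
  show s1: "summable (\<lambda>i. norm (fst (psi_coeff a b n i)))"
  proof -
    have "summable (\<lambda>k. norm (fst (psi_coeff a b n (2 * k + 2))))" unfolding e1 by (rule jq_norm_summable[OF ab])
    then show ?thesis
      by (subst (asm) summable_mono_reindex[OF m1(1), of "\<lambda>i. norm (fst (psi_coeff a b n i))"]) (use r1 in auto)
  qed
  show s2: "summable (\<lambda>i. norm (snd (psi_coeff a b n i)))"
  proof -
    have "summable (\<lambda>k. norm (snd (psi_coeff a b n (2 * k))))" unfolding e2 by (rule jp_norm_summable[OF ab])
    then show ?thesis
      by (subst (asm) summable_mono_reindex[OF m1(2), of "\<lambda>i. norm (snd (psi_coeff a b n i))"]) (use r2 in auto)
  qed
  show "power_sum (\<lambda>i. fst (psi_coeff a b n i)) z = z\<^sup>2 * JQ a b n (z\<^sup>2)" if z: "norm z \<le> 1"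
  proof -
    have z2: "norm (z\<^sup>2) \<le> 1" using z by (simp add: norm_power power_le_one)
    have "(\<lambda>k. z\<^sup>2 * (jq a b k n * (z\<^sup>2) ^ k)) sums (z\<^sup>2 * JQ a b n (z\<^sup>2))"
      unfolding JQ_def power_sum_def by (intro sums_mult summable_sums power_sum_summable[OF jq_norm_summable[OF ab] z2])
    then have "(\<lambda>k. fst (psi_coeff a b n (2 * k + 2)) * z ^ (2 * k + 2)) sums (z\<^sup>2 * JQ a b n (z\<^sup>2))"
    proof (rule sums_cong[THEN iffD1, rotated])
      fix k
      have "z ^ (2 * k + 2) = z\<^sup>2 * (z\<^sup>2) ^ k" by (subst power_add, subst power_mult, rule mult.commute)
      then show "z\<^sup>2 * (jq a b k n * (z\<^sup>2) ^ k) = fst (psi_coeff a b n (2 * k + 2)) * z ^ (2 * k + 2)"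
        unfolding e1 by simp
    qed
    then have "(\<lambda>i. fst (psi_coeff a b n i) * z ^ i) sums (z\<^sup>2 * JQ a b n (z\<^sup>2))"
      by (subst (asm) sums_mono_reindex[OF m1(1), of "\<lambda>i. fst (psi_coeff a b n i) * z ^ i"]) (use r1 in auto)
    then show ?thesis unfolding power_sum_def by (rule sums_unique[symmetric])
  qed
  show "power_sum (\<lambda>i. snd (psi_coeff a b n i)) z = JP a b n (z\<^sup>2)" if z: "norm z \<le> 1"
  proof -
    have z2: "norm (z\<^sup>2) \<le> 1" using z by (simp add: norm_power power_le_one)
    have "(\<lambda>k. (jp a b k n * (z\<^sup>2) ^ k)) sums (JP a b n (z\<^sup>2))"
      unfolding JP_def power_sum_def by (intro summable_sums power_sum_summable[OF jp_norm_summable[OF ab] z2])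
    then have "(\<lambda>k. snd (psi_coeff a b n (2 * k)) * z ^ (2 * k)) sums (JP a b n (z\<^sup>2))"
      unfolding e2 by (simp add: power_mult)
    then have "(\<lambda>i. snd (psi_coeff a b n i) * z ^ i) sums (JP a b n (z\<^sup>2))"
      by (subst (asm) sums_mono_reindex[OF m1(2), of "\<lambda>i. snd (psi_coeff a b n i) * z ^ i"]) (use r2 in auto)
    then show ?thesis unfolding power_sum_def by (rule sums_unique[symmetric])
  qed
  have "(\<lambda>k. norm (snd (psi_coeff a b n (2 * k)))) sums (\<Sum>k. norm (jp a b k n))"
    unfolding e2 by (rule summable_sums[OF jp_norm_summable[OF ab]])
  then have "(\<lambda>i. norm (snd (psi_coeff a b n i))) sums (\<Sum>k. norm (jp a b k n))"
    by (subst (asm) sums_mono_reindex[OF m1(2), of "\<lambda>i. norm (snd (psi_coeff a b n i))"]) (use r2 in auto)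
  then have "(\<Sum>i. norm (snd (psi_coeff a b n i))) = (\<Sum>k. norm (jp a b k n))" by (rule sums_unique[symmetric])
  moreover have "(\<Sum>i. norm (snd (psi_coeff a b n (Suc i)))) = (\<Sum>i. norm (snd (psi_coeff a b n i))) - 1"
    using suminf_split_head[OF s2] by (simp add: psi_coeff_0)
  moreover have "(\<Sum>k. norm (jp a b k n)) \<le> exp (tail_mass a b n)"
    using jc_suminf_le[OF ab, of n] suminf_nonneg[OF jq_norm_summable[OF ab, of n]] by simp
  ultimately show "(\<Sum>i. norm (snd (psi_coeff a b n (Suc i)))) \<le> exp (tail_mass a b n) - 1" by simp
qed

lemma psiF_power_series:
  assumes "z \<in> DI"
  shows "fst (psiF a b n z) = z powi n * power_sum (\<lambda>i. fst (psi_coeff a b n i)) z"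
    and "snd (psiF a b n z) = z powi n * power_sum (\<lambda>i. snd (psi_coeff a b n i)) z"
proof -
  have "norm z \<le> 1" using assms by (auto simp: DI_def)
  then show "fst (psiF a b n z) = z powi n * power_sum (\<lambda>i. fst (psi_coeff a b n i)) z"
    and "snd (psiF a b n z) = z powi n * power_sum (\<lambda>i. snd (psi_coeff a b n i)) z"
    using assms by (simp_all add: psiF_def psi_coeff_props mult.assoc)
qed

lemma coefficient_extraction:
  assumes c: "summable (\<lambda>k. norm (c k))"
  shows "circ_int (\<lambda>z. (z powi n * power_sum c z) * z powi (- m - 1)) = (if n \<le> m then c (nat (m - n)) else 0)"
proof -
  have "(\<lambda>k. c k * contour_integral (circlepath 0 1) (\<lambda>w. w powi (n - m - 1) * w ^ k)) sums
    contour_integral (circlepath 0 1) (\<lambda>w. w powi (n - m - 1) * power_sum c w)"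
    by (rule circle_sums[OF c]) (auto intro!: continuous_intros)
  from sums_divide[OF this, of "2 * pi * \<i>"]
  have s: "(\<lambda>k. c k * circ_int (\<lambda>w. w powi (n - m - 1) * w ^ k)) sums circ_int (\<lambda>w. w powi (n - m - 1) * power_sum c w)"
    by (simp add: circ_int_def)
  have e: "circ_int (\<lambda>w. w powi (n - m - 1) * w ^ k) = (if int k = m - n then 1 else 0)" for k
  proof -
    have "circ_int (\<lambda>w. w powi (n - m - 1) * w ^ k) = circ_int (\<lambda>w. w powi (n - m - 1 + int k))"
    proof (rule circ_int_cong)
      fix z :: complex assume "norm z = 1"
      then have "z \<noteq> 0" by auto
      then show "z powi (n - m - 1) * z ^ k = z powi (n - m - 1 + int k)" by (simp add: power_int_add)
    qed
    then show ?thesis unfolding circ_int_powi by auto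
  qed
  have eq: "circ_int (\<lambda>z. (z powi n * power_sum c z) * z powi (- m - 1)) = circ_int (\<lambda>w. w powi (n - m - 1) * power_sum c w)"
  proof (rule circ_int_cong)
    fix z :: complex assume "norm z = 1"
    then have "z \<noteq> 0" by auto
    moreover have "n - m - 1 = n + (- m - 1)" by simp
    ultimately have "z powi (n - m - 1) = z powi n * z powi (- m - 1)" by (simp only: power_int_add simp_thms)
    then show "(z powi n * power_sum c z) * z powi (- m - 1) = z powi (n - m - 1) * power_sum c z" by simp
  qed
  have s2: "(\<lambda>k. c k * (if int k = m - n then 1 else 0)) sums (if n \<le> m then c (nat (m - n)) else 0)"
  proof (cases "n \<le> m")
    case True
    then have "int k = m - n \<longleftrightarrow> k = nat (m - n)" for k by auto
    then have "(\<lambda>k. c k * (if int k = m - n then 1 else 0)) = (\<lambda>k. if k = nat (m - n) then c k else 0)"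
      by (intro ext) simp
    then show ?thesis using True sums_single[of "nat (m - n)" c] by simp
  next
    case False
    then have "int k \<noteq> m - n" for k by auto
    then have "(\<lambda>k. c k * (if int k = m - n then 1 else 0)) = (\<lambda>k. 0)" by (intro ext) simp
    then show ?thesis using False by simp
  qed
  show ?thesis unfolding eq by (rule sums_unique2[OF s[unfolded e] s2])
qed

text \<open>Since psi is z^n times a power series, the Fourier integral picks out the coefficient at
  m - n, and nothing below n.\<close>

lemma KK_eq: "KK a b n m = (if n \<le> m then psi_coeff a b n (nat (m - n)) else (0, 0))"
proof -
  have D: "z \<in> DI" if "norm z = 1" for z :: complex using that by (auto simp: DI_def)
  have "fst (KK a b n m) = circ_int (\<lambda>z. (z powi n * power_sum (\<lambda>i. fst (psi_coeff a b n i)) z) * z powi (- m - 1))"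
    unfolding KK_def fst_conv jost_psi_eq[OF ab] by (rule circ_int_cong) (simp add: psiF_power_series D)
  moreover have "snd (KK a b n m) = circ_int (\<lambda>z. (z powi n * power_sum (\<lambda>i. snd (psi_coeff a b n i)) z) * z powi (- m - 1))"
    unfolding KK_def snd_conv jost_psi_eq[OF ab] by (rule circ_int_cong) (simp add: psiF_power_series D)
  ultimately show ?thesis unfolding coefficient_extraction[OF psi_coeff_props(1)] coefficient_extraction[OF psi_coeff_props(2)]
    by (auto simp: prod_eq_iff)
qed

lemma KKb_eq: "KKb b a n m = prod.swap (KK a b n m)"
proof -
  have *: "circ_int (\<lambda>z. f (psiF a b n (inverse z)) * z powi (m - 1)) = circ_int (\<lambda>z. f (psiF a b n z) * z powi (- m - 1))" for f
  proof -
    have "circ_int (\<lambda>z. f (psiF a b n (inverse z)) * z powi (m - 1))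
      = circ_int (\<lambda>z. (\<lambda>w. f (psiF a b n w) * w powi (- m - 1)) (inverse z) * (inverse z)\<^sup>2)"
    proof (rule circ_int_cong)
      fix z :: complex assume "norm z = 1"
      then have z: "z \<noteq> 0" by auto
      have "inverse z powi (- m - 1) * (inverse z)\<^sup>2 = inverse z powi (- m - 1 + 2)"
        using power_int_add[of "inverse z" "- m - 1" 2] z by simp
      also have "- m - 1 + 2 = - (m - 1)" by simp
      also have "inverse z powi (- (m - 1)) = z powi (m - 1)" by (simp only: power_int_minus power_int_inverse inverse_inverse_eq)
      finally show "f (psiF a b n (inverse z)) * z powi (m - 1) = f (psiF a b n (inverse z)) * inverse z powi (- m - 1) * (inverse z)\<^sup>2"
        by (simp add: mult.assoc)
    qed
    then show ?thesis unfolding circ_int_inverse[of "\<lambda>w. f (psiF a b n w) * w powi (- m - 1)"] .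
  qed
  show ?thesis unfolding KKb_def KK_def jost_psib_eq[OF ab] jost_psi_eq[OF ab] flip_def fst_swap snd_swap * by simp
qed

end

lemma Rhatb_eq: assumes "l1pair a b" shows "Rhatb a b k = Rhat b a k"
proof -
  have "Rhatb a b k = circ_int (\<lambda>z. (\<lambda>w. Rr b a w * w powi (k - 1)) (inverse z) * (inverse z)\<^sup>2)"
    unfolding Rhatb_def Rrb_eq[OF assms]
  proof (rule circ_int_cong)
    fix z :: complex assume "norm z = 1"
    then have z: "z \<noteq> 0" by auto
    have "inverse z powi (k - 1) * (inverse z)\<^sup>2 = inverse z powi (k - 1 + 2)"
      using power_int_add[of "inverse z" "k - 1" 2] z by simp
    also have "k - 1 + 2 = - (- k - 1)" by simp
    also have "inverse z powi (- (- k - 1)) = z powi (- k - 1)" by (simp only: power_int_minus power_int_inverse inverse_inverse_eq)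
    finally show "Rr b a (inverse z) * z powi (- k - 1) = Rr b a (inverse z) * inverse z powi (k - 1) * (inverse z)\<^sup>2"
      by (simp add: mult.assoc)
  qed
  then show ?thesis unfolding circ_int_inverse[of "\<lambda>w. Rr b a w * w powi (k - 1)"] Rhat_def .
qed

lemma Omegab_eq: assumes "l1pair a b" "finite (polesb a b)" shows "Omegab a b k = Omega b a k"
proof (cases "even k")
  case True
  then show ?thesis using CABb_odd[OF assms, of "- k - 1"] by (simp add: Omegab_def Omega_def Rhatb_eq[OF assms(1)])
qed (simp add: Omegab_def Omega_def)

lemma pole_factor_residue_add:
  assumes P: "pole_factor T z m H" and h: "h1 analytic_on {z}" "h2 analytic_on {z}"
  shows "residue (\<lambda>w. T w * (h1 w + h2 w)) z = residue (\<lambda>w. T w * h1 w) z + residue (\<lambda>w. T w * h2 w) z"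
proof -
  have h12: "(\<lambda>w. h1 w + h2 w) analytic_on {z}" by (intro analytic_intros h)
  show ?thesis
    unfolding pole_factor_residue[OF P h(1)] pole_factor_residue[OF P h(2)] pole_factor_residue[OF P h12] taylor_coeff_def higher_deriv_add_at[OF h]
    by (simp add: add_divide_distrib distrib_left sum.distrib)
qed

subsection \<open>The Marchenko equation\<close>

text \<open>Absence of spectral singularities: 1/T has no zero on the circle and finitely many in
  the disc. The corresponding conditions on the barred data of (a, b) are those of
  \<open>nonsing b a\<close>.\<close>

definition nonsing :: "(int \<Rightarrow> complex) \<Rightarrow> (int \<Rightarrow> complex) \<Rightarrow> bool" where
  "nonsing a b \<longleftrightarrow> l1pair a b \<and> finite (poles a b) \<and> (\<forall>z. norm z = 1 \<longrightarrow> inv_Tr a b z \<noteq> 0)"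

context fixes a b assumes ns: "nonsing a b" begin

lemma nonsing_l1pair: "l1pair a b" and nonsing_finite: "finite (poles a b)" and nonsing_inv_Tr: "norm z = 1 \<Longrightarrow> inv_Tr a b z \<noteq> 0"
  using ns by (auto simp: nonsing_def)

lemma nonsing_l1pair_swap: "l1pair b a" using nonsing_l1pair l1pair_commute by blast

lemma scat_a_ext_nonzero: assumes "z \<in> cball 0 1 - poles a b" shows "scat_a_ext a b z \<noteq> 0"
proof -
  consider "z = 0" | "norm z = 1" | "0 < norm z" "norm z < 1" using assms by force
  then show ?thesis
  proof cases
    case 2
    then show ?thesis using nonsing_inv_Tr[OF 2] by (simp add: scat_a_ext_circle[OF nonsing_l1pair] inv_Tr_eq[OF nonsing_l1pair])
  qed (use assms scat_a_ext_0[OF nonsing_l1pair] in \<open>auto simp: poles_iff[OF nonsing_l1pair]\<close>)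
qed

lemma phi_component:
  assumes f: "f = fst \<or> f = snd"
  obtains X where "X holomorphic_on ball 0 1" "continuous_on (cball 0 1) X"
    "\<And>z. z \<in> DI \<Longrightarrow> f (phiF a b n z) = z powi (- n) * X z"
proof -
  from f show ?thesis
  proof
    assume f: "f = fst"
    show ?thesis
    proof (rule that[of "\<lambda>z. JP (reflect b) (reflect a) (- n) (z\<^sup>2) / Dp a b (n - 1)"])
      show "(\<lambda>z. JP (reflect b) (reflect a) (- n) (z\<^sup>2) / Dp a b (n - 1)) holomorphic_on ball 0 1"
        by (intro holomorphic_intros JP2_holomorphic[OF l1pair_summable(3)[OF nonsing_l1pair]]) (simp add: Dp_nonzero[OF nonsing_l1pair])
      show "continuous_on (cball 0 1) (\<lambda>z. JP (reflect b) (reflect a) (- n) (z\<^sup>2) / Dp a b (n - 1))"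
        by (intro continuous_intros JP2_continuous[OF l1pair_summable(3)[OF nonsing_l1pair]]) (simp add: Dp_nonzero[OF nonsing_l1pair])
    qed (simp add: f phiF_def[OF nonsing_l1pair])
  next
    assume f: "f = snd"
    show ?thesis
    proof (rule that[of "\<lambda>z. JQ (reflect b) (reflect a) (- n) (z\<^sup>2) / Dp a b (n - 1)"])
      show "(\<lambda>z. JQ (reflect b) (reflect a) (- n) (z\<^sup>2) / Dp a b (n - 1)) holomorphic_on ball 0 1"
        by (intro holomorphic_intros JQ2_holomorphic[OF l1pair_summable(3)[OF nonsing_l1pair]]) (simp add: Dp_nonzero[OF nonsing_l1pair])
      show "continuous_on (cball 0 1) (\<lambda>z. JQ (reflect b) (reflect a) (- n) (z\<^sup>2) / Dp a b (n - 1))"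
        by (intro continuous_intros JQ2_continuous[OF l1pair_summable(3)[OF nonsing_l1pair]]) (simp add: Dp_nonzero[OF nonsing_l1pair])
    qed (simp add: f phiF_def[OF nonsing_l1pair])
  qed
qed

lemma psi_coeff_summable: "f = fst \<or> f = snd \<Longrightarrow> summable (\<lambda>i. norm (f (psi_coeff a b n i)))"
  using psi_coeff_props(1,2)[OF l1pair_summable(1)[OF nonsing_l1pair]] by auto

lemma psi_power_series: "f = fst \<or> f = snd \<Longrightarrow> z \<in> DI \<Longrightarrow> f (psiF a b n z) = z powi n * power_sum (\<lambda>i. f (psi_coeff a b n i)) z"
  using psiF_power_series[OF l1pair_summable(1)[OF nonsing_l1pair]] by auto

lemma pole_circle:
  assumes p: "p \<in> poles a b"
  obtains s r where "open s" "p \<in> s" "0 < r" "cball p r \<subseteq> s" "s \<subseteq> ball 0 1 - {0}"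
    "Tr_ext a b holomorphic_on s - {p}" "dep_germ a b p holomorphic_on s"
proof -
  obtain m H where "pole_factor (Tr_ext a b) p m H" and G: "dep_germ a b p analytic_on {p}"
    using pole_data[OF nonsing_l1pair p] by metis
  obtain S where S: "open S" "p \<in> S" "dep_germ a b p holomorphic_on S" using G by (auto simp: analytic_at)
  define s where "s = S \<inter> (ball 0 1 - {0}) - (poles a b - {p})"
  have s: "open s" unfolding s_def using S(1) nonsing_finite by (intro open_Diff open_Int finite_imp_closed) auto
  have p_in_s: "p \<in> s" using S p by (auto simp: s_def poles_iff[OF nonsing_l1pair])
  have "Tr_ext a b holomorphic_on s - {p}"
    unfolding Tr_ext_eq[OF nonsing_l1pair, abs_def]
    by (intro holomorphic_intros holomorphic_on_subset[OF scat_a_ext_holomorphic[OF nonsing_l1pair]] scat_a_ext_nonzero) (auto simp: s_def)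
  moreover have "dep_germ a b p holomorphic_on s" by (rule holomorphic_on_subset[OF S(3)]) (auto simp: s_def)
  moreover obtain r where "0 < r" "cball p r \<subseteq> s" using s p_in_s open_contains_cball by blast
  ultimately show ?thesis using that[of s r] s p_in_s by (auto simp: s_def)
qed

lemma bs_residue_contour:
  assumes s: "open s" "p \<in> s" "0 < r" "cball p r \<subseteq> s" "s \<subseteq> ball 0 1 - {0}"
    "Tr_ext a b holomorphic_on s - {p}" "dep_germ a b p holomorphic_on s"
  shows "contour_integral (circlepath p r) (\<lambda>w. Tr_ext a b w * (dep_germ a b p w * w powi t)) = 2 * pi * \<i> * bs_residue a b p t"
proof -
  have "((\<lambda>w. Tr_ext a b w * (dep_germ a b p w * w powi t)) has_contour_integral 2 * pi * \<i> * bs_residue a b p t) (circlepath p r)"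
    unfolding bs_residue_def
    by (rule base_residue[OF s(1,2,3) _ s(4)], intro holomorphic_intros s(6) holomorphic_on_subset[OF s(7)])
      (use s(5) in auto)
  then show ?thesis by (rule contour_integral_unique)
qed

text \<open>A residue is an integral over a small circle inside the disc, where the power series
  converges uniformly, so it can be taken term by term.\<close>

lemma residue_sums:
  assumes p: "p \<in> poles a b" and c: "summable (\<lambda>k. norm (c k))"
  shows "(\<lambda>i. c i * bs_residue a b p (t + int i)) sums residue (\<lambda>w. Tr_ext a b w * (dep_germ a b p w * (w powi t * power_sum c w))) p"
proof -
  obtain s r where s: "open s" "p \<in> s" "0 < r" "cball p r \<subseteq> s" "s \<subseteq> ball 0 1 - {0}"
    "Tr_ext a b holomorphic_on s - {p}" "dep_germ a b p holomorphic_on s"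
    by (rule pole_circle[OF p])
  let ?F = "\<lambda>w. Tr_ext a b w * (dep_germ a b p w * w powi t)"
  have sub: "sphere p r \<subseteq> s - {p}" using s(3,4) by auto
  have hF: "?F holomorphic_on s - {p}"
    by (intro holomorphic_intros s(6) holomorphic_on_subset[OF s(7)]) (use s(5) in auto)
  have "(\<lambda>k. c k * contour_integral (circlepath p r) (\<lambda>w. ?F w * w ^ k)) sums
    contour_integral (circlepath p r) (\<lambda>w. ?F w * power_sum c w)"
    by (rule circle_sums[OF c continuous_on_subset[OF holomorphic_on_imp_continuous_on[OF hF] sub] s(3)])
      (use sub s(5) in auto)
  moreover have "contour_integral (circlepath p r) (\<lambda>w. ?F w * w ^ k) = 2 * pi * \<i> * bs_residue a b p (t + int k)" for k
  proof -
    have "contour_integral (circlepath p r) (\<lambda>w. ?F w * w ^ k)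
      = contour_integral (circlepath p r) (\<lambda>w. Tr_ext a b w * (dep_germ a b p w * w powi (t + int k)))"
    proof (rule contour_integral_cong[OF refl])
      fix w assume "w \<in> path_image (circlepath p r)"
      then have "w \<in> sphere p r" using s(3) by simp
      then have "w \<noteq> 0" using sub s(5) by blast
      then show "?F w * w ^ k = Tr_ext a b w * (dep_germ a b p w * w powi (t + int k))" by (simp add: power_int_add)
    qed
    then show ?thesis unfolding bs_residue_contour[OF s] .
  qed
  moreover have "contour_integral (circlepath p r) (\<lambda>w. ?F w * power_sum c w)
      = 2 * pi * \<i> * residue (\<lambda>w. Tr_ext a b w * (dep_germ a b p w * (w powi t * power_sum c w))) p"
  proof -
    have "(\<lambda>w. Tr_ext a b w * (dep_germ a b p w * (w powi t * power_sum c w))) holomorphic_on s - {p}"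
      by (intro holomorphic_intros s(6) holomorphic_on_subset[OF s(7)] holomorphic_on_subset[OF power_sum_holomorphic[OF c]])
        (use s(5) in auto)
    from base_residue[OF s(1,2,3) this s(4)] show ?thesis
      by (intro contour_integral_unique) (simp add: mult.assoc)
  qed
  ultimately have *: "(\<lambda>k. c k * (2 * pi * \<i> * bs_residue a b p (t + int k))) sums
     (2 * pi * \<i> * residue (\<lambda>w. Tr_ext a b w * (dep_germ a b p w * (w powi t * power_sum c w))) p)" by simp
  define K where "K = 2 * complex_of_real pi * \<i>"
  have K0: "K \<noteq> 0" by (simp add: K_def)
  from * have "(\<lambda>k. c k * (K * bs_residue a b p (t + int k))) sums
     (K * residue (\<lambda>w. Tr_ext a b w * (dep_germ a b p w * (w powi t * power_sum c w))) p)" by (simp add: K_def)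
  then have "(\<lambda>k. K * (c k * bs_residue a b p (t + int k))) sums
     (K * residue (\<lambda>w. Tr_ext a b w * (dep_germ a b p w * (w powi t * power_sum c w))) p)" by (simp only: mult.left_commute)
  then show ?thesis by (simp only: sums_mult_iff[OF K0])
qed

lemma scattering_sums:
  assumes c: "summable (\<lambda>k. norm (c k))"
  shows "(\<lambda>i. c i * Rhat a b (t + 1 + int i)) sums circ_int (\<lambda>w. Rr a b w * (w powi t * power_sum c w))"
proof -
  have R: "continuous_on (sphere 0 1) (Rr a b)" by (rule Rr_continuous[OF nonsing_l1pair nonsing_inv_Tr])
  have "(\<lambda>k. c k * contour_integral (circlepath 0 1) (\<lambda>w. (Rr a b w * w powi t) * w ^ k)) sums
    contour_integral (circlepath 0 1) (\<lambda>w. (Rr a b w * w powi t) * power_sum c w)"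
    by (rule circle_sums[OF c]) (auto intro!: continuous_intros R)
  from sums_divide[OF this, of "2 * pi * \<i>"]
  have "(\<lambda>k. c k * circ_int (\<lambda>w. (Rr a b w * w powi t) * w ^ k)) sums circ_int (\<lambda>w. (Rr a b w * w powi t) * power_sum c w)"
    by (simp add: circ_int_def)
  moreover have "circ_int (\<lambda>w. (Rr a b w * w powi t) * w ^ k) = Rhat a b (t + 1 + int k)" for k
    unfolding Rhat_def
  proof (rule circ_int_cong)
    fix z :: complex assume "norm z = 1"
    then have "z \<noteq> 0" by auto
    moreover have "t + 1 + int k - 1 = t + int k" by simp
    ultimately show "(Rr a b z * z powi t) * z ^ k = Rr a b z * z powi (t + 1 + int k - 1)" by (simp add: power_int_add)
  qed
  ultimately show ?thesis by (simp add: mult.assoc)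
qed

text \<open>Under the residue phi may be replaced by germ times psi, because the difference vanishes
  to the order of the pole of T.\<close>

lemma Jost_residue:
  assumes f: "f = fst \<or> f = snd" and p: "p \<in> poles a b"
  shows "residue (\<lambda>w. Tr_ext a b w * (f (phiF a b n w) * w powi t)) p
    = residue (\<lambda>w. Tr_ext a b w * (dep_germ a b p w * (w powi (n + t) * power_sum (\<lambda>i. f (psi_coeff a b n i)) w))) p"
proof -
  obtain m H where P: "pole_factor (Tr_ext a b) p m H" and G: "dep_germ a b p analytic_on {p}"
    and d: "\<forall>n. vanish_order m p (\<lambda>w. fst (phiF a b n w) - dep_germ a b p w * fst (psiF a b n w))"
     "\<forall>n. vanish_order m p (\<lambda>w. snd (phiF a b n w) - dep_germ a b p w * snd (psiF a b n w))"
    using pole_data[OF nonsing_l1pair p] by blast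
  have p1: "0 < norm p" "norm p < 1" using p by (auto simp: poles_iff[OF nonsing_l1pair])
  then have p0: "p \<noteq> 0" by auto
  note an = Jost_analytic[OF nonsing_l1pair p1]
  have fa: "(\<lambda>w. f (phiF a b n w)) analytic_on {p}" "(\<lambda>w. f (psiF a b n w)) analytic_on {p}"
    and fd: "vanish_order m p (\<lambda>w. f (phiF a b n w) - dep_germ a b p w * f (psiF a b n w))"
    using f an d by auto
  note pa = power_int_analytic[OF p0, of t]
  have "residue (\<lambda>w. Tr_ext a b w * (f (phiF a b n w) * w powi t)) p
     = residue (\<lambda>w. Tr_ext a b w * (dep_germ a b p w * f (psiF a b n w) * w powi t
         + w powi t * (f (phiF a b n w) - dep_germ a b p w * f (psiF a b n w)))) p"
    by (simp add: algebra_simps)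
  also have "\<dots> = residue (\<lambda>w. Tr_ext a b w * (dep_germ a b p w * f (psiF a b n w) * w powi t)) p
       + residue (\<lambda>w. Tr_ext a b w * (w powi t * (f (phiF a b n w) - dep_germ a b p w * f (psiF a b n w)))) p"
    by (rule pole_factor_residue_add[OF P]) (intro analytic_intros fa G pa)+
  also have "residue (\<lambda>w. Tr_ext a b w * (w powi t * (f (phiF a b n w) - dep_germ a b p w * f (psiF a b n w)))) p = 0"
    by (rule vanish_order_residue[OF P vanish_order_mult[OF fd pa]])
  also have "residue (\<lambda>w. Tr_ext a b w * (dep_germ a b p w * f (psiF a b n w) * w powi t)) p
     = residue (\<lambda>w. Tr_ext a b w * (dep_germ a b p w * (w powi (n + t) * power_sum (\<lambda>i. f (psi_coeff a b n i)) w))) p"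
  proof (rule residue_cong[OF _ refl])
    have "\<forall>\<^sub>F w in at p. w \<in> ball 0 1 - {0}" using p1 by (intro eventually_at_in_open') auto
    then show "\<forall>\<^sub>F w in at p. Tr_ext a b w * (dep_germ a b p w * f (psiF a b n w) * w powi t)
        = Tr_ext a b w * (dep_germ a b p w * (w powi (n + t) * power_sum (\<lambda>i. f (psi_coeff a b n i)) w))"
    proof eventually_elim
      case (elim w)
      then have "w \<in> DI" "w \<noteq> 0" by (auto simp: DI_def)
      then show ?case by (simp add: psi_power_series[OF f] power_int_add)
    qed
  qed
  finally show ?thesis by simp
qed

text \<open>The integrand T * phi * z^(m - 1) behaves at 0 like z^(m - 1 - n). For m > n it is
  analytic there, so that only the poles of T contribute.\<close>

lemma marchenko_contour:
  assumes f: "f = fst \<or> f = snd" and mn: "n < m"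
  shows "f (KKb a b n m) + circ_int (\<lambda>w. Rr a b w * (w powi (n + m - 1) * power_sum (\<lambda>i. f (psi_coeff a b n i)) w))
    = (\<Sum>p\<in>poles a b. residue (\<lambda>w. Tr_ext a b w * (f (phiF a b n w) * w powi (m - 1))) p)"
proof -
  obtain X where X: "X holomorphic_on ball 0 1" "continuous_on (cball 0 1) X"
    and Xe: "\<And>z. z \<in> DI \<Longrightarrow> f (phiF a b n z) = z powi (- n) * X z"
    using phi_component[OF f, of n] by blast
  \<comment> \<open>The exponent left over after z^(-n) from phi has been cancelled; it is
    nonnegative by n < m.\<close>
  define N where "N = nat (m - 1 - n)"
  define F where "F w = X w * w ^ N / scat_a_ext a b w" for w
  have F: "F w = f (phiF a b n w) * w powi (m - 1) / scat_a_ext a b w" if "w \<in> DI" for w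
  proof -
    have w: "w \<noteq> 0" using that by (auto simp: DI_def)
    have "m - 1 = n + int N" using mn by (simp add: N_def)
    then have "w powi (m - 1) = w powi n * w ^ N" using w by (simp add: power_int_add)
    then show ?thesis unfolding F_def Xe[OF that] using w by (simp add: power_int_minus)
  qed
  have sD: "z \<in> DI" "inverse z \<in> DI" "z \<noteq> 0" if "norm z = 1" for z using that by (auto simp: DI_def norm_inverse)
  have "circ_int F = (\<Sum>p\<in>poles a b. residue F p)"
  proof (rule residue_theorem_closed_disc[OF nonsing_finite])
    show "poles a b \<subseteq> ball 0 1" by (auto simp: poles_iff[OF nonsing_l1pair])
    show "F holomorphic_on ball 0 1 - poles a b"
      unfolding F_def[abs_def] by (intro holomorphic_intros holomorphic_on_subset[OF X(1)] holomorphic_on_subset[OF scat_a_ext_holomorphic[OF nonsing_l1pair]])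
        (use scat_a_ext_nonzero in auto)
    show "continuous_on (cball 0 1 - poles a b) F"
      unfolding F_def[abs_def] by (intro continuous_intros continuous_on_subset[OF X(2)] continuous_on_subset[OF scat_a_ext_continuous[OF nonsing_l1pair]])
        (use scat_a_ext_nonzero in auto)
  qed
  also have "\<dots> = (\<Sum>p\<in>poles a b. residue (\<lambda>w. Tr_ext a b w * (f (phiF a b n w) * w powi (m - 1))) p)"
  proof (intro sum.cong refl residue_cong)
    fix p assume "p \<in> poles a b"
    then have "\<forall>\<^sub>F w in at p. w \<in> ball 0 1 - {0}"
      by (intro eventually_at_in_open') (auto simp: poles_iff[OF nonsing_l1pair])
    then show "\<forall>\<^sub>F w in at p. F w = Tr_ext a b w * (f (phiF a b n w) * w powi (m - 1))"
      by eventually_elim (subst F, auto simp: DI_def Tr_ext_eq[OF nonsing_l1pair])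
  qed
  finally have 1: "circ_int F = (\<Sum>p\<in>poles a b. residue (\<lambda>w. Tr_ext a b w * (f (phiF a b n w) * w powi (m - 1))) p)" .
  have "circ_int F = circ_int (\<lambda>z. f (flip (psiF b a) n z) * z powi (m - 1)
      + Rr a b z * (z powi (n + m - 1) * power_sum (\<lambda>i. f (psi_coeff a b n i)) z))"
  proof (rule circ_int_cong)
    fix z :: complex assume z: "norm z = 1"
    have "scat_a a b z \<noteq> 0" using nonsing_inv_Tr[OF z] inv_Tr_eq[OF nonsing_l1pair z] by simp
    from circle_identity[OF nonsing_l1pair z this, of n]
    have e: "f (phiF a b n z) / scat_a a b z = f (flip (psiF b a) n z) + Rr a b z * f (psiF a b n z)" using f by auto
    have "F z = (f (phiF a b n z) / scat_a a b z) * z powi (m - 1)" using F[OF sD(1)[OF z]] scat_a_ext_circle[OF nonsing_l1pair z] by simp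
    also have "\<dots> = f (flip (psiF b a) n z) * z powi (m - 1) + Rr a b z * ((z powi n * z powi (m - 1)) * power_sum (\<lambda>i. f (psi_coeff a b n i)) z)"
      unfolding e psi_power_series[OF f sD(1)[OF z]] by (simp add: algebra_simps)
    also have "z powi n * z powi (m - 1) = z powi (n + m - 1)" using power_int_add[of z n "m - 1"] sD(3)[OF z] by (simp add: add_diff_eq)
    finally show "F z = f (flip (psiF b a) n z) * z powi (m - 1) + Rr a b z * (z powi (n + m - 1) * power_sum (\<lambda>i. f (psi_coeff a b n i)) z)" .
  qed
  also have "\<dots> = circ_int (\<lambda>z. f (flip (psiF b a) n z) * z powi (m - 1))
      + circ_int (\<lambda>z. Rr a b z * (z powi (n + m - 1) * power_sum (\<lambda>i. f (psi_coeff a b n i)) z))"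
  proof -
    have s: "sphere 0 1 \<subseteq> DO" "sphere 0 1 \<subseteq> (cball 0 1 :: complex set)" by (auto simp: DO_def)
    have "continuous_on (sphere 0 1) (flip (psiF b a) n)"
      by (rule continuous_on_subset[OF Jost_continuous(3)[OF nonsing_l1pair] s(1)])
    then have "continuous_on (sphere 0 1) (\<lambda>z. f (flip (psiF b a) n z))" using f by (auto intro!: continuous_intros)
    then have i1: "(\<lambda>z. f (flip (psiF b a) n z) * z powi (m - 1)) contour_integrable_on circlepath 0 1"
      by (intro contour_integrable_continuous_circlepath) (auto intro!: continuous_intros)
    have i2: "(\<lambda>z. Rr a b z * (z powi (n + m - 1) * power_sum (\<lambda>i. f (psi_coeff a b n i)) z)) contour_integrable_on circlepath 0 1"
      using Rr_continuous[OF nonsing_l1pair nonsing_inv_Tr] continuous_on_subset[OF power_sum_continuous[OF psi_coeff_summable[OF f, of n]] s(2)]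
      by (intro contour_integrable_continuous_circlepath) (auto intro!: continuous_intros)
    show ?thesis unfolding circ_int_def contour_integral_add[OF i1 i2] add_divide_distrib ..
  qed
  also have "circ_int (\<lambda>z. f (flip (psiF b a) n z) * z powi (m - 1)) = f (KKb a b n m)"
    using f by (auto simp: KKb_def jost_psib_eq[OF l1pair_summable(1)[OF nonsing_l1pair_swap]] jost_psi_eq[OF l1pair_summable(1)[OF nonsing_l1pair_swap]])
  finally show ?thesis using 1 by simp
qed

lemma marchenko:
  assumes f: "f = fst \<or> f = snd" and mn: "n < m"
  shows "(\<lambda>i. f (psi_coeff a b n i) * Omega a b (n + m + int i)) sums (- f (KKb a b n m))"
\<comment> \<open>For odd n + m both sides vanish: psi has only even coefficients, Omega only even
  indices, and \<open>KKb\<close> vanishes at odd m - n. For even n + m only even i matter, and then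
  the matrix exponent n + m - 1 + i is odd, as \<open>CAB_odd\<close> requires.\<close>
proof (cases "even (n + m)")
  case False
  have z1: "f (psi_coeff a b n i) * Omega a b (n + m + int i) = 0" for i
    using f False by (cases "even i") (auto simp: psi_coeff_odd Omega_def)
  have z2: "f (KKb a b n m) = 0"
  proof -
    have "odd (nat (m - n))" using False mn by (simp add: even_nat_iff)
    then show ?thesis using f mn unfolding KKb_eq[OF l1pair_summable(1)[OF nonsing_l1pair_swap]] KK_eq[OF l1pair_summable(1)[OF nonsing_l1pair_swap]] by (auto simp: psi_coeff_odd)
  qed
  show ?thesis unfolding z1 z2 by simp
next
  case True
  let ?c = "\<lambda>i. f (psi_coeff a b n i)"
  have "(\<lambda>i. ?c i * Rhat a b (n + m - 1 + 1 + int i)) sums circ_int (\<lambda>w. Rr a b w * (w powi (n + m - 1) * power_sum ?c w))"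
    by (rule scattering_sums[OF psi_coeff_summable[OF f]])
  moreover have "(\<lambda>i. \<Sum>p\<in>poles a b. ?c i * bs_residue a b p (n + m - 1 + int i)) sums
      (\<Sum>p\<in>poles a b. residue (\<lambda>w. Tr_ext a b w * (dep_germ a b p w * (w powi (n + m - 1) * power_sum ?c w))) p)"
    by (rule sums_sum) (rule residue_sums[OF _ psi_coeff_summable[OF f]])
  ultimately have "(\<lambda>i. ?c i * Rhat a b (n + m - 1 + 1 + int i) - (\<Sum>p\<in>poles a b. ?c i * bs_residue a b p (n + m - 1 + int i)))
     sums (circ_int (\<lambda>w. Rr a b w * (w powi (n + m - 1) * power_sum ?c w))
       - (\<Sum>p\<in>poles a b. residue (\<lambda>w. Tr_ext a b w * (dep_germ a b p w * (w powi (n + m - 1) * power_sum ?c w))) p))"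
    by (rule sums_diff)
  moreover have "circ_int (\<lambda>w. Rr a b w * (w powi (n + m - 1) * power_sum ?c w))
       - (\<Sum>p\<in>poles a b. residue (\<lambda>w. Tr_ext a b w * (dep_germ a b p w * (w powi (n + m - 1) * power_sum ?c w))) p) = - f (KKb a b n m)"
  proof -
    have "(\<Sum>p\<in>poles a b. residue (\<lambda>w. Tr_ext a b w * (dep_germ a b p w * (w powi (n + m - 1) * power_sum ?c w))) p)
       = (\<Sum>p\<in>poles a b. residue (\<lambda>w. Tr_ext a b w * (f (phiF a b n w) * w powi (m - 1))) p)"
      by (intro sum.cong refl) (simp add: Jost_residue[OF f] add_diff_eq)
    then show ?thesis using marchenko_contour[OF f mn] by (simp add: algebra_simps)
  qed
  moreover have "?c i * Rhat a b (n + m - 1 + 1 + int i) - (\<Sum>p\<in>poles a b. ?c i * bs_residue a b p (n + m - 1 + int i))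
      = ?c i * Omega a b (n + m + int i)" for i
  proof (cases "even i")
    case False
    then show ?thesis using f by (auto simp: psi_coeff_odd)
  next
    case i: True
    have e: "n + m + int i - 1 = n + m - 1 + int i" "n + m - 1 + 1 + int i = n + m + int i" by auto
    have o: "odd (n + m - 1 + int i)" using i True by simp
    have "Omega a b (n + m + int i) = Rhat a b (n + m + int i) - (\<Sum>p\<in>poles a b. bs_residue a b p (n + m - 1 + int i))"
      using i True by (simp add: Omega_def e CAB_odd[OF nonsing_l1pair nonsing_finite o])
    then show ?thesis unfolding e sum_distrib_left[symmetric] right_diff_distrib[symmetric] by simp
  qed
  ultimately show ?thesis by simp
qed

end

section \<open>Absolute summability of Omega\<close>

lemma summable_int_shift:
  fixes f :: "int \<Rightarrow> real"
  assumes S: "summable (\<lambda>i. f (M + int i))" shows "summable (\<lambda>i. f (N + int i))"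
proof (cases "N \<le> M")
  case True
  have "summable (\<lambda>i. f (N + int (i + nat (M - N))))"
    using S True by (simp add: algebra_simps)
  then show ?thesis by (subst (asm) summable_iff_shift)
next
  case False
  then have eq: "(\<lambda>i. f (N + int i)) = (\<lambda>i. f (M + int (i + nat (N - M))))"
    by (simp add: algebra_simps)
  show ?thesis unfolding eq by (rule summable_ignore_initial_segment[OF S])
qed

text \<open>Iterating the inequality gives \<open>w \<le> h + C / 2 ^ N\<close> with \<open>suminf h \<le> 2 * suminf g\<close> for every N.\<close>

lemma summable_of_contraction:
  fixes w g \<kappa> :: "nat \<Rightarrow> real"
  assumes w0: "\<And>k. 0 \<le> w k" and wC: "\<And>k. w k \<le> C" and g0: "\<And>k. 0 \<le> g k" and g: "summable g"
    and k0: "\<And>i. 0 \<le> \<kappa> i" and k: "summable \<kappa>" "suminf \<kappa> \<le> 1 / 2"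
    and le: "\<And>j. w j \<le> g j + (\<Sum>i. \<kappa> i * w (j + i + 1))"
  shows "summable w"
proof -
  have C0: "0 \<le> C" using w0[of 0] wC[of 0] by simp
  have step: "\<exists>h. (\<forall>j. 0 \<le> h j) \<and> summable h \<and> suminf h \<le> 2 * suminf g \<and> (\<forall>j. w j \<le> h j + C / 2 ^ N)" for N
  proof (induction N)
    case 0
    then show ?case using wC suminf_nonneg[OF g g0] by (intro exI[of _ "\<lambda>_. 0"]) simp
  next
    case (Suc N)
    then obtain h where h: "\<And>j. 0 \<le> h j" "summable h" "suminf h \<le> 2 * suminf g" "\<And>j. w j \<le> h j + C / 2 ^ N" by blast
    have hb: "h j \<le> suminf h" for j using sum_le_suminf[OF h(2), of "{j}"] h(1) by simp
    have hs: "summable (\<lambda>i. \<kappa> i * h (j + i + 1))" for j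
      by (rule summable_comparison_test'[OF summable_mult2[OF k(1), of "suminf h"], of 0])
        (use h(1) hb k0 in \<open>simp add: mult_left_mono\<close>)
    have ws: "summable (\<lambda>i. \<kappa> i * w (j + i + 1))" for j
      by (rule summable_comparison_test'[OF summable_mult2[OF k(1), of C], of 0])
        (use w0 wC k0 in \<open>simp add: mult_left_mono\<close>)
    \<comment> \<open>One iteration of the inequality. The bound 2 * suminf g reproduces itself,
      since the new sum is at most suminf g + (1/2) * (2 * suminf g), while the error C / 2^N is
      halved.\<close>
    define h' where "h' j = g j + (\<Sum>i. \<kappa> i * h (j + i + 1))" for j
    have h'0: "0 \<le> h' j" for j unfolding h'_def by (intro add_nonneg_nonneg g0 suminf_nonneg hs mult_nonneg_nonneg k0 h(1))
    have part: "(\<Sum>j<K. h' j) \<le> 2 * suminf g" for K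
    proof -
      have "(\<Sum>j<K. \<Sum>i. \<kappa> i * h (j + i + 1)) = (\<Sum>i. \<Sum>j<K. \<kappa> i * h (j + i + 1))"
        by (rule suminf_sum[symmetric]) (rule hs)
      also have "\<dots> \<le> (\<Sum>i. \<kappa> i * suminf h)"
      proof (rule suminf_le)
        fix i
        have "(\<Sum>j<K. h (j + i + 1)) \<le> (\<Sum>j. h (j + (i + 1)))"
          using sum_le_suminf[OF summable_ignore_initial_segment[OF h(2), of "i + 1"], of "{..<K}"] h(1) by (simp add: add.assoc)
        also have "\<dots> \<le> suminf h"
          unfolding suminf_minus_initial_segment[OF h(2)] using sum_nonneg[of "{..<i + 1}" h] h(1) by simp
        finally show "(\<Sum>j<K. \<kappa> i * h (j + i + 1)) \<le> \<kappa> i * suminf h"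
          unfolding sum_distrib_left[symmetric] by (rule mult_left_mono[OF _ k0])
      qed (intro summable_sum hs summable_mult2 k(1))+
      also have "\<dots> = suminf \<kappa> * suminf h" by (rule suminf_mult2[OF k(1), symmetric])
      also have "\<dots> \<le> (1 / 2) * (2 * suminf g)"
        by (intro mult_mono k(2) h(3) suminf_nonneg h(1,2)) simp
      finally have "(\<Sum>j<K. \<Sum>i. \<kappa> i * h (j + i + 1)) \<le> suminf g" by simp
      moreover have "(\<Sum>j<K. g j) \<le> suminf g" by (rule sum_le_suminf[OF g]) (use g0 in auto)
      ultimately show ?thesis by (simp add: h'_def sum.distrib)
    qed
    have sh': "summable h'" by (rule summableI_nonneg_bounded[OF h'0 part])
    have "w j \<le> h' j + C / 2 ^ Suc N" for j
    proof -
      have "w j \<le> g j + (\<Sum>i. \<kappa> i * w (j + i + 1))" by (rule le)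
      also have "(\<Sum>i. \<kappa> i * w (j + i + 1)) \<le> (\<Sum>i. \<kappa> i * h (j + i + 1) + \<kappa> i * (C / 2 ^ N))"
      proof (rule suminf_le[OF _ ws summable_add[OF hs summable_mult2[OF k(1)]]])
        fix i show "\<kappa> i * w (j + i + 1) \<le> \<kappa> i * h (j + i + 1) + \<kappa> i * (C / 2 ^ N)"
          using mult_left_mono[OF h(4)[of "j + i + 1"] k0[of i]] by (simp add: distrib_left)
      qed
      also have "\<dots> = (\<Sum>i. \<kappa> i * h (j + i + 1)) + suminf \<kappa> * (C / 2 ^ N)"
        by (simp only: suminf_add[OF hs summable_mult2[OF k(1)], symmetric] suminf_mult2[OF k(1)])
      also have "suminf \<kappa> * (C / 2 ^ N) \<le> (1 / 2) * (C / 2 ^ N)"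
        by (rule mult_right_mono[OF k(2)]) (use C0 in simp)
      finally show ?thesis by (simp add: h'_def)
    qed
    moreover have "suminf h' \<le> 2 * suminf g" by (rule suminf_le_const[OF sh' part])
    ultimately show ?case using h'0 sh' by blast
  qed
  \<comment> \<open>The majorants h depend on N, so N tends to infinity with the partial sum of K
    terms held fixed.\<close>
  have "(\<Sum>j<K. w j) \<le> 2 * suminf g" for K
  proof -
    have "(\<Sum>j<K. w j) \<le> 2 * suminf g + real K * (C / 2 ^ N)" for N
    proof -
      obtain h where h: "\<And>j. 0 \<le> h j" "summable h" "suminf h \<le> 2 * suminf g" "\<And>j. w j \<le> h j + C / 2 ^ N" using step[of N] by blast
      have "(\<Sum>j<K. w j) \<le> (\<Sum>j<K. h j + C / 2 ^ N)" by (rule sum_mono) (rule h(4))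
      also have "\<dots> = (\<Sum>j<K. h j) + real K * (C / 2 ^ N)" by (simp add: sum.distrib)
      also have "(\<Sum>j<K. h j) \<le> suminf h" by (rule sum_le_suminf[OF h(2)]) (use h(1) in auto)
      finally show ?thesis using h(3) by simp
    qed
    moreover have "(\<lambda>N. 2 * suminf g + real K * (C / 2 ^ N)) \<longlonglongrightarrow> 2 * suminf g + real K * 0"
      by (intro tendsto_intros LIMSEQ_divide_realpow_zero) simp
    ultimately show ?thesis by (intro LIMSEQ_le_const[of "\<lambda>N. 2 * suminf g + real K * (C / 2 ^ N)"]) auto
  qed
  then show ?thesis by (rule summableI_nonneg_bounded[OF w0])
qed

context fixes a b assumes ns: "nonsing a b" begin

text \<open>R is bounded on the circle, and each residue is an integral over a circle inside the
  unit disc, where |w^t| <= 1 for t >= 0. The exponent is j - 1, whence the restriction to j >=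
  1.\<close>

lemma Omega_bounded: "\<exists>C. \<forall>j\<ge>1. norm (Omega a b j) \<le> C"
proof -
  note ab = nonsing_l1pair[OF ns]
  obtain B where B: "\<And>z. norm z = 1 \<Longrightarrow> norm (Rr a b z) \<le> B"
  proof -
    have "compact (Rr a b ` sphere 0 1)" by (intro compact_continuous_image Rr_continuous[OF ab nonsing_inv_Tr[OF ns]]) auto
    then have "bounded (Rr a b ` sphere 0 1)" by (rule compact_imp_bounded)
    then obtain B where "\<forall>x\<in>Rr a b ` sphere 0 1. norm x \<le> B" by (auto simp: bounded_iff)
    then show ?thesis by (intro that[of B]) auto
  qed
  have B0: "0 \<le> B" using order_trans[OF norm_ge_zero B[of 1]] by simp
  have R: "norm (Rhat a b j) \<le> B" for j
  proof -
    have "(\<lambda>z. Rr a b z * z powi (j - 1)) contour_integrable_on circlepath 0 1"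
      by (intro contour_integrable_continuous_circlepath) (auto intro!: continuous_intros Rr_continuous[OF ab nonsing_inv_Tr[OF ns]])
    from has_contour_integral_bound_circlepath[OF has_contour_integral_integral[OF this] B0]
    have "norm (contour_integral (circlepath 0 1) (\<lambda>z. Rr a b z * z powi (j - 1))) \<le> B * (2 * pi * 1)"
      using B by (auto simp: norm_mult norm_powi_1)
    then show ?thesis unfolding Rhat_def circ_int_def by (simp add: norm_divide norm_mult field_simps)
  qed
  have RSb: "\<exists>D. \<forall>t\<ge>0. norm (bs_residue a b p t) \<le> D" if p: "p \<in> poles a b" for p
  proof -
    obtain s r where s: "open s" "p \<in> s" "0 < r" "cball p r \<subseteq> s" "s \<subseteq> ball 0 1 - {0}"
      "Tr_ext a b holomorphic_on s - {p}" "dep_germ a b p holomorphic_on s"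
      by (rule pole_circle[OF ns p])
    have sub: "sphere p r \<subseteq> s - {p}" using s(3,4) by auto
    have h: "continuous_on (sphere p r) (\<lambda>w. Tr_ext a b w * dep_germ a b p w)"
      by (intro continuous_on_subset[OF holomorphic_on_imp_continuous_on sub] holomorphic_intros s(6) holomorphic_on_subset[OF s(7)]) auto
    have "bounded ((\<lambda>w. Tr_ext a b w * dep_germ a b p w) ` sphere p r)"
      by (intro compact_imp_bounded compact_continuous_image h) auto
    then obtain M where "\<forall>x\<in>(\<lambda>w. Tr_ext a b w * dep_germ a b p w) ` sphere p r. norm x \<le> M" by (auto simp: bounded_iff)
    then have M: "\<And>w. w \<in> sphere p r \<Longrightarrow> norm (Tr_ext a b w * dep_germ a b p w) \<le> M" by blast
    obtain w where "w \<in> sphere p r" using s(3) by (metis ex_in_conv sphere_eq_empty not_less_iff_gr_or_eq)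
    then have M0: "0 \<le> M" using order_trans[OF norm_ge_zero M] by blast
    have "norm (bs_residue a b p t) \<le> M * r" if t: "t \<ge> 0" for t
    proof -
      have "continuous_on (sphere p r) (\<lambda>w. Tr_ext a b w * (dep_germ a b p w * w powi t))"
        unfolding mult.assoc[symmetric] by (intro continuous_intros h) (use sub s(5) in auto)
      then have "(\<lambda>w. Tr_ext a b w * (dep_germ a b p w * w powi t)) contour_integrable_on circlepath p r"
        using s(3) by (intro contour_integrable_continuous_circlepath) auto
      note bound = has_contour_integral_bound_circlepath[OF has_contour_integral_integral[OF this] M0 s(3)]
      have "norm (contour_integral (circlepath p r) (\<lambda>w. Tr_ext a b w * (dep_germ a b p w * w powi t))) \<le> M * (2 * pi * r)"
      proof (rule bound)
        fix w assume "norm (w - p) = r"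
        then have w: "w \<in> sphere p r" by (simp add: dist_norm norm_minus_commute)
        then have "w \<in> ball 0 1" using sub s(5) by blast
        then have "norm (w powi t) \<le> 1" using t by (cases t) (auto simp: norm_power power_le_one)
        then have "norm (Tr_ext a b w * dep_germ a b p w) * norm (w powi t) \<le> M * 1"
          using M[OF w] M0 by (intro mult_mono) auto
        then show "norm (Tr_ext a b w * (dep_germ a b p w * w powi t)) \<le> M" by (simp add: norm_mult mult.assoc)
      qed
      then show ?thesis unfolding bs_residue_contour[OF ns s] by (simp add: norm_mult)
    qed
    then show ?thesis by blast
  qed
  then obtain D where D: "\<And>p t. p \<in> poles a b \<Longrightarrow> t \<ge> 0 \<Longrightarrow> norm (bs_residue a b p t) \<le> D p" by metis
  have "norm (Omega a b j) \<le> B + (\<Sum>p\<in>poles a b. D p)" if j: "j \<ge> 1" for j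
  proof (cases "even j")
    case True
    then have o: "odd (j - 1)" by simp
    have "norm (Omega a b j) \<le> norm (Rhat a b j) + norm (\<Sum>p\<in>poles a b. bs_residue a b p (j - 1))"
      using True norm_triangle_ineq4[of "Rhat a b j" "\<Sum>p\<in>poles a b. bs_residue a b p (j - 1)"]
      by (simp add: Omega_def CAB_odd[OF ab nonsing_finite[OF ns] o])
    also have "\<dots> \<le> B + (\<Sum>p\<in>poles a b. D p)"
      by (intro add_mono R order_trans[OF norm_sum] sum_mono D) (use j in auto)
    finally show ?thesis .
  next
    case False
    have "0 \<le> D p" if "p \<in> poles a b" for p using order_trans[OF norm_ge_zero D[OF that order_refl]] .
    then show ?thesis using False B0 by (auto simp: Omega_def intro!: add_nonneg_nonneg sum_nonneg)
  qed
  then show ?thesis by blast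
qed

text \<open>For large n the off-diagonal mass of the second component of K is below 1/2, so the Marchenko
  equation expresses the bounded sequence \<open>Omega a b\<close> by a summable one plus a contraction.\<close>

lemma Omega_summable: "summable (\<lambda>i. norm (Omega a b (N + int i)))"
proof -
  note ab = nonsing_l1pair[OF ns]
  have ba: "l1pair b a" by (rule nonsing_l1pair_swap[OF ns])
  obtain C where C: "\<And>j. j \<ge> 1 \<Longrightarrow> norm (Omega a b j) \<le> C" using Omega_bounded by blast
  have "eventually (\<lambda>n. exp (tail_mass a b n) - 1 < 1 / 2) at_top"
    using order_tendstoD(2)[OF exp_tail_mass_tendsto[OF l1pair_summable(1)[OF ab]], of "1 / 2"] by simp
  then have "eventually (\<lambda>n. exp (tail_mass a b n) - 1 < 1 / 2 \<and> n \<ge> 1) at_top"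
    using eventually_ge_at_top[of 1] by eventually_elim simp
  then obtain n where n: "exp (tail_mass a b n) - 1 < 1 / 2" "n \<ge> 1"
    using eventually_happens'[OF trivial_limit_at_top_linorder] by blast
  \<comment> \<open>The Marchenko equation at m = n + 1 + j involves Omega from index n + m = 2 n +
    1 + j on. As n >= 1, these indices lie in the range where Omega is bounded.\<close>
  define w where "w k = norm (Omega a b (2 * n + 1 + int k))" for k
  define \<kappa> where "\<kappa> i = norm (snd (psi_coeff a b n (Suc i)))" for i
  have ks: "summable \<kappa>" unfolding \<kappa>_def
    using psi_coeff_props(2)[OF l1pair_summable(1)[OF ab], of n] by (subst summable_Suc_iff)
  have "summable w"
  proof (rule summable_of_contraction[where \<kappa> = \<kappa> and C = C and g = "\<lambda>k. norm (fst (psi_coeff b a n (Suc k)))"])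
    show "w k \<le> C" for k unfolding w_def by (rule C) (use n in auto)
    show "summable (\<lambda>k. norm (fst (psi_coeff b a n (Suc k))))"
      using psi_coeff_props(1)[OF l1pair_summable(1)[OF ba], of n] by (subst summable_Suc_iff)
    show "summable \<kappa>" by (rule ks)
    show "suminf \<kappa> \<le> 1 / 2" unfolding \<kappa>_def using psi_coeff_props(5)[OF l1pair_summable(1)[OF ab], of n] n(1) by simp
    fix j
    define m where "m = n + 1 + int j"
    have mn: "n < m" by (simp add: m_def)
    have K: "snd (KKb a b n m) = fst (psi_coeff b a n (Suc j))"
      unfolding KKb_eq[OF l1pair_summable(1)[OF ba]] KK_eq[OF l1pair_summable(1)[OF ba]] using mn by (simp add: m_def nat_add_distrib)
    have s: "(\<lambda>i. snd (psi_coeff a b n i) * Omega a b (n + m + int i)) sums (- snd (KKb a b n m))"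
      by (rule marchenko[OF ns _ mn]) simp
    \<comment> \<open>In the second component the leading coefficient of psi is 1, so Omega (n + m)
      itself can be isolated; this fails for the first component, whose leading coefficient is
      0.\<close>
    from suminf_split_head[OF sums_summable[OF s]] sums_unique[OF s]
    have e: "Omega a b (n + m) = - snd (KKb a b n m) - (\<Sum>i. snd (psi_coeff a b n (Suc i)) * Omega a b (n + m + int (Suc i)))"
      by (simp add: psi_coeff_0 algebra_simps)
    have wi: "norm (Omega a b (n + m + int (Suc i))) = w (j + i + 1)" for i
      by (simp add: w_def m_def algebra_simps)
    have sm: "summable (\<lambda>i. norm (snd (psi_coeff a b n (Suc i)) * Omega a b (n + m + int (Suc i))))"
      unfolding norm_mult wi
      by (rule summable_comparison_test'[OF summable_mult2[OF ks, of C], of 0])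
        (auto simp: \<kappa>_def w_def intro!: mult_left_mono C, use n in linarith)
    have "w j = norm (Omega a b (n + m))" by (simp add: w_def m_def algebra_simps)
    also have "\<dots> \<le> norm (snd (KKb a b n m)) + norm (\<Sum>i. snd (psi_coeff a b n (Suc i)) * Omega a b (n + m + int (Suc i)))"
      unfolding e using norm_triangle_ineq4[of "- snd (KKb a b n m)"] by simp
    also have "norm (\<Sum>i. snd (psi_coeff a b n (Suc i)) * Omega a b (n + m + int (Suc i))) \<le> (\<Sum>i. \<kappa> i * w (j + i + 1))"
      using summable_norm[OF sm] unfolding norm_mult wi \<kappa>_def .
    finally show "w j \<le> norm (fst (psi_coeff b a n (Suc j))) + (\<Sum>i. \<kappa> i * w (j + i + 1))" unfolding K by simp
  qed (simp_all add: w_def \<kappa>_def)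
  then have S: "summable (\<lambda>i. norm (Omega a b (2 * n + 1 + int i)))" unfolding w_def .
  then show ?thesis by (rule summable_int_shift[of "\<lambda>k. norm (Omega a b k)"])
qed

end

subsection \<open>Summation of the Marchenko equations\<close>

lemma suminf_tail_tendsto_0:
  fixes f :: "nat \<Rightarrow> 'a::{banach, real_normed_vector}"
  assumes "summable f" shows "(\<lambda>k. \<Sum>i. f (k + i)) \<longlonglongrightarrow> 0"
proof -
  have "(\<lambda>k. suminf f - sum f {..<k}) \<longlonglongrightarrow> suminf f - suminf f"
    by (intro tendsto_intros summable_LIMSEQ assms)
  then show ?thesis using suminf_minus_initial_segment[OF assms] by (simp add: add.commute)
qed

lemma suminf_tail_step:
  fixes f :: "nat \<Rightarrow> 'a::{banach, real_normed_vector}"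
  assumes "summable f" shows "(\<Sum>i. f (k + i)) = f k + (\<Sum>i. f (k + 1 + i))"
proof -
  have "summable (\<lambda>i. f (k + i))" using summable_ignore_initial_segment[OF assms, of k] by (simp add: add.commute)
  from suminf_split_head[OF this] show ?thesis by simp
qed

text \<open>The relation is summed over all indices from k on. No double series is interchanged: the
  tails satisfy g l = \<omega> l + g (l + 1), and after J such steps the remainder is at most the l1
  norm of \<alpha> times the tail of |\<omega>| from k + J.\<close>

lemma tail_correlation_sums:
  fixes \<alpha> \<omega> \<beta> :: "nat \<Rightarrow> complex"
  assumes \<alpha>: "summable (\<lambda>i. norm (\<alpha> i))" and \<omega>: "summable (\<lambda>i. norm (\<omega> i))"
    and rel: "\<And>j. (\<Sum>i. \<alpha> i * \<omega> (k + j + i)) = - \<beta> (k + j)" and \<beta>: "summable \<beta>"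
  shows "(\<lambda>i. \<alpha> i * (\<Sum>j. \<omega> (k + i + j))) sums (- (\<Sum>j. \<beta> (k + j)))"
proof -
  define g where "g l = (\<Sum>j. \<omega> (l + j))" for l
  define T where "T l = (\<Sum>j. norm (\<omega> (l + j)))" for l
  have w: "summable \<omega>" by (rule summable_norm_cancel[OF \<omega>])
  have ws: "summable (\<lambda>j. norm (\<omega> (l + j)))" for l
    using summable_ignore_initial_segment[OF \<omega>, of l] by (simp add: add.commute)
  have gT: "norm (g l) \<le> T l" for l unfolding g_def T_def by (rule summable_norm[OF ws])
  have Tmono: "T (l + i) \<le> T l" for l i
  proof (induction i)
    case (Suc i)
    have "T (l + i) = norm (\<omega> (l + i)) + T (l + i + 1)" unfolding T_def by (rule suminf_tail_step[OF \<omega>])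
    then have "T (l + Suc i) \<le> T (l + i)" using norm_ge_zero[of "\<omega> (l + i)"] by simp
    then show ?case using Suc by simp
  qed simp
  have gT': "norm (g (l + i)) \<le> T l" for l i by (rule order_trans[OF gT Tmono])
  have ags: "summable (\<lambda>i. norm (\<alpha> i * g (l + i)))" for l
    by (rule summable_comparison_test'[OF summable_mult2[OF \<alpha>, of "T l"], of 0])
      (simp_all add: norm_mult mult_left_mono gT')
  have aws: "summable (\<lambda>i. norm (\<alpha> i * \<omega> (l + i)))" for l
  proof (rule summable_comparison_test'[OF summable_mult2[OF \<alpha>, of "T l"], of 0])
    fix i
    have "norm (\<omega> (l + i)) \<le> T l" unfolding T_def using sum_le_suminf[OF ws, of "{i}" l] by simp
    then show "norm (norm (\<alpha> i * \<omega> (l + i))) \<le> norm (\<alpha> i) * T l" by (simp add: norm_mult mult_left_mono)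
  qed
  have step: "(\<Sum>i. \<alpha> i * g (l + i)) = (\<Sum>i. \<alpha> i * \<omega> (l + i)) + (\<Sum>i. \<alpha> i * g (l + 1 + i))" for l
  proof -
    have "\<alpha> i * g (l + i) = \<alpha> i * \<omega> (l + i) + \<alpha> i * g (l + 1 + i)" for i
      using suminf_tail_step[OF w, of "l + i"] by (simp add: g_def algebra_simps)
    then show ?thesis using suminf_add[OF summable_norm_cancel[OF aws[of l]] summable_norm_cancel[OF ags[of "l + 1"]]] by simp
  qed
  have part: "(\<Sum>i. \<alpha> i * g (k + i)) = - (\<Sum>j<J. \<beta> (k + j)) + (\<Sum>i. \<alpha> i * g (k + J + i))" for J
  proof (induction J)
    case (Suc J)
    then show ?case using step[of "k + J"] rel[of J] by simp
  qed simp
  have lim: "(\<lambda>J. \<Sum>i. \<alpha> i * g (k + J + i)) \<longlonglongrightarrow> 0"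
  proof (rule Lim_null_comparison)
    show "\<forall>\<^sub>F J in sequentially. norm (\<Sum>i. \<alpha> i * g (k + J + i)) \<le> (\<Sum>i. norm (\<alpha> i)) * T (k + J)"
    proof (intro always_eventually allI)
      fix J
      have "norm (\<Sum>i. \<alpha> i * g (k + J + i)) \<le> (\<Sum>i. norm (\<alpha> i * g (k + J + i)))" by (rule summable_norm[OF ags])
      also have "\<dots> \<le> (\<Sum>i. norm (\<alpha> i) * T (k + J))"
        by (rule suminf_le[OF _ ags summable_mult2[OF \<alpha>]])
          (simp_all add: norm_mult mult_left_mono gT')
      also have "\<dots> = (\<Sum>i. norm (\<alpha> i)) * T (k + J)" by (rule suminf_mult2[OF \<alpha>, symmetric])
      finally show "norm (\<Sum>i. \<alpha> i * g (k + J + i)) \<le> (\<Sum>i. norm (\<alpha> i)) * T (k + J)" .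
    qed
    have "T \<longlonglongrightarrow> 0" unfolding T_def by (rule suminf_tail_tendsto_0[OF \<omega>])
    then have "(\<lambda>J. T (J + k)) \<longlonglongrightarrow> 0" by (rule LIMSEQ_ignore_initial_segment)
    then have "(\<lambda>J. (\<Sum>i. norm (\<alpha> i)) * T (k + J)) \<longlonglongrightarrow> (\<Sum>i. norm (\<alpha> i)) * 0" by (intro tendsto_intros) (simp add: add.commute)
    then show "(\<lambda>J. (\<Sum>i. norm (\<alpha> i)) * T (k + J)) \<longlonglongrightarrow> 0" by simp
  qed
  have \<beta>k: "summable (\<lambda>j. \<beta> (k + j))" using summable_ignore_initial_segment[OF \<beta>, of k] by (simp add: add.commute)
  have "(\<lambda>J. - (\<Sum>j<J. \<beta> (k + j)) + (\<Sum>i. \<alpha> i * g (k + J + i))) \<longlonglongrightarrow> - (\<Sum>j. \<beta> (k + j)) + 0"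
    by (intro tendsto_add tendsto_minus summable_LIMSEQ \<beta>k lim)
  then have "(\<lambda>J::nat. \<Sum>i. \<alpha> i * g (k + i)) \<longlonglongrightarrow> - (\<Sum>j. \<beta> (k + j))" unfolding part[symmetric] by simp
  then have "(\<Sum>i. \<alpha> i * g (k + i)) = - (\<Sum>j. \<beta> (k + j))" by (simp add: LIMSEQ_const_iff)
  with summable_sums[OF summable_norm_cancel[OF ags[of k]]] show ?thesis unfolding g_def by simp
qed

text \<open>Abel summation with \<open>\<alpha> k = A k - A (k + 1)\<close> and \<open>\<beta> k = B k - B (k + 1)\<close>.\<close>

lemma summed_marchenko:
  fixes \<alpha> \<beta> \<omega> \<omega>b :: "nat \<Rightarrow> complex" and d :: nat
  assumes \<alpha>: "summable (\<lambda>i. norm (\<alpha> i))" and \<beta>: "summable (\<lambda>i. norm (\<beta> i))"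
    and \<omega>: "summable (\<lambda>i. norm (\<omega> i))" and \<omega>b: "summable (\<lambda>i. norm (\<omega>b i))"
    and M1: "\<And>k. 1 \<le> k \<Longrightarrow> (\<Sum>i. \<alpha> i * \<omega> (k + i)) = - \<beta> k"
    and M2: "\<And>k. 1 \<le> k \<Longrightarrow> (\<Sum>i. \<beta> i * \<omega>b (k + i)) = - \<alpha> k"
    and \<alpha>0: "\<alpha> 0 = 0" and d: "1 \<le> d"
  defines "A \<equiv> \<lambda>k. \<Sum>i. \<alpha> (k + i)" and "B \<equiv> \<lambda>k. \<Sum>i. \<beta> (k + i)"
    and "g \<equiv> \<lambda>k. \<Sum>i. \<omega> (k + i)" and "gb \<equiv> \<lambda>k. \<Sum>i. \<omega>b (k + i)"
  assumes B0: "B 0 \<noteq> 0"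
  shows "A d / B 0 + gb d + (\<Sum>i. \<Sum>k. (A (k + 2) / B 0 - A (k + 1) / B 0) * g (k + i + 2) * (gb (i + 1 + d) - gb (i + d))) = 0"
proof -
  note \<alpha>s = summable_norm_cancel[OF \<alpha>] and \<beta>s = summable_norm_cancel[OF \<beta>]
  have 1: "(\<lambda>i. \<alpha> i * g (k + i)) sums (- B k)" if "1 \<le> k" for k
    unfolding g_def B_def by (rule tail_correlation_sums[OF \<alpha> \<omega> _ \<beta>s]) (use M1 that in auto)
  have 2: "(\<lambda>i. \<beta> i * gb (k + i)) sums (- A k)" if "1 \<le> k" for k
    unfolding gb_def A_def by (rule tail_correlation_sums[OF \<beta> \<omega>b _ \<alpha>s]) (use M2 that in auto)
  have inner: "(\<Sum>k. (A (k + 2) / B 0 - A (k + 1) / B 0) * g (k + i + 2) * (gb (i + 1 + d) - gb (i + d)))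
      = B (i + 1) * (gb (i + 1 + d) - gb (i + d)) / B 0" for i
  proof (rule sums_unique[symmetric])
    \<comment> \<open>The term with index 0 drops out because \<alpha> 0 = 0, so the sum can start
      at n + 1, as the statement does.\<close>
    have "(\<lambda>k. \<alpha> (Suc k) * g (i + 1 + Suc k)) sums (- B (i + 1))"
      using 1[of "i + 1"] sums_Suc_iff[of "\<lambda>k. \<alpha> k * g (i + 1 + k)" "- B (i + 1)"] \<alpha>0 by simp
    from sums_minus[OF this]
    have "(\<lambda>k. (- \<alpha> (k + 1)) * g (k + i + 2)) sums B (i + 1)" by (simp add: add_ac)
    from sums_divide[OF sums_mult2[OF this, of "gb (i + 1 + d) - gb (i + d)"], of "B 0"]
    have *: "(\<lambda>k. (- \<alpha> (k + 1)) * g (k + i + 2) * (gb (i + 1 + d) - gb (i + d)) / B 0) sums (B (i + 1) * (gb (i + 1 + d) - gb (i + d)) / B 0)" .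
    have "(- \<alpha> (k + 1)) * g (k + i + 2) * (gb (i + 1 + d) - gb (i + d)) / B 0
       = (A (k + 2) / B 0 - A (k + 1) / B 0) * g (k + i + 2) * (gb (i + 1 + d) - gb (i + d))" for k
    proof -
      have "A (k + 2) - A (k + 1) = - \<alpha> (k + 1)" unfolding A_def using suminf_tail_step[OF \<alpha>s, of "k + 1"] by simp
      then show ?thesis by (simp only: diff_divide_distrib[symmetric] times_divide_eq_left)
    qed
    with * show "(\<lambda>k. (A (k + 2) / B 0 - A (k + 1) / B 0) * g (k + i + 2) * (gb (i + 1 + d) - gb (i + d)))
       sums (B (i + 1) * (gb (i + 1 + d) - gb (i + d)) / B 0)" by simp
  qed
  have tB: "B \<longlonglongrightarrow> 0" unfolding B_def by (rule suminf_tail_tendsto_0[OF \<beta>s])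
  have tg: "gb \<longlonglongrightarrow> 0" unfolding gb_def by (rule suminf_tail_tendsto_0[OF summable_norm_cancel[OF \<omega>b]])
  have "(\<lambda>i. gb (i + d)) \<longlonglongrightarrow> 0" by (rule LIMSEQ_ignore_initial_segment[OF tg])
  from tendsto_mult[OF tB this] have tel: "(\<lambda>i. B i * gb (i + d)) \<longlonglongrightarrow> 0" by simp
  \<comment> \<open>Abel summation: the telescoping part contributes - B 0 * gb d and the summed
    second equation contributes - A d, while each combined term is B (i + 1) times a difference of
    \<open>gb\<close>.\<close>
  have "(\<lambda>i. (B (Suc i) * gb (Suc i + d) - B i * gb (i + d)) + \<beta> i * gb (d + i)) sums ((0 - B 0 * gb (0 + d)) + - A d)"
    by (rule sums_add[OF telescope_sums[OF tel] 2[OF d]])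
  moreover have "(B (Suc i) * gb (Suc i + d) - B i * gb (i + d)) + \<beta> i * gb (d + i) = B (i + 1) * (gb (i + 1 + d) - gb (i + d))" for i
  proof -
    have "B i = \<beta> i + B (i + 1)" unfolding B_def by (rule suminf_tail_step[OF \<beta>s])
    then show ?thesis by (simp add: algebra_simps)
  qed
  ultimately have "(\<lambda>i. B (i + 1) * (gb (i + 1 + d) - gb (i + d))) sums (- B 0 * gb d - A d)" by simp
  from sums_divide[OF this, of "B 0"]
  have "(\<Sum>i. B (i + 1) * (gb (i + 1 + d) - gb (i + d)) / B 0) = (- B 0 * gb d - A d) / B 0" by (rule sums_unique[symmetric])
  also have "\<dots> = - gb d - A d / B 0" using B0 by (simp add: diff_divide_distrib)
  finally show ?thesis unfolding inner by simp
qed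

text \<open>The system for \<alpha> and \<beta> consists of the first component of the Marchenko
  equation for (a, b) and the second component of the one for (b, a). Since the kernel indices are
  at least 2 n, all sequences are rebased there. The normalising sum is that of \<beta>, which
  equals \<open>JP b a n 1\<close>.\<close>

lemma summed_marchenko_scrK:
  assumes ns: "nonsing a b" "nonsing b a" and B0: "JP b a n 1 \<noteq> 0" and mn: "n < m"
  shows "scrK a b n m + GGb a b (n + m)
     + (\<Sum>i. \<Sum>k. (scrK a b n (n + 1 + int k + 1) - scrK a b n (n + 1 + int k))
          * GG a b ((n + 1 + int k) + (n + 1 + int i))
          * (GGb a b ((n + 1 + int i) + m) - GGb a b ((n + 1 + int i) + m - 1))) = 0"
proof -
  have ab: "l1pair a b" "l1pair b a" and f: "right_summable a b" "right_summable b a"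
    using ns l1pair_summable[of a b] by (auto simp: nonsing_def)
  have "finite (polesb a b)" using ns(2) unfolding polesb_eq[OF ab(1)] by (auto simp: nonsing_def)
  note Ob = Omegab_eq[OF ab(1) this]
  define d where "d = nat (m - n)"
  have d: "1 \<le> d" "m = n + int d" using mn by (auto simp: d_def)
  define \<alpha> where "\<alpha> i = fst (psi_coeff a b n i)" for i
  define \<beta> where "\<beta> i = snd (psi_coeff b a n i)" for i
  define \<omega> where "\<omega> i = Omega a b (2 * n + int i)" for i
  define \<omega>b where "\<omega>b i = Omegab a b (2 * n + int i)" for i
  have K1: "fst (KK a b n (n + int i)) = \<alpha> i" for i by (simp add: KK_eq[OF f(1)] \<alpha>_def)
  have K2: "fst (KKb a b n (n + int i)) = \<beta> i" for i by (simp add: KKb_eq[OF f(2)] KK_eq[OF f(2)] \<beta>_def)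
  have M1: "(\<Sum>i. \<alpha> i * \<omega> (k + i)) = - \<beta> k" if "1 \<le> k" for k
  proof -
    have "n < n + int k" using that by simp
    from marchenko[OF ns(1) _ this, of fst] have "(\<lambda>i. \<alpha> i * \<omega> (k + i)) sums (- \<beta> k)"
      by (simp add: \<alpha>_def[symmetric] \<omega>_def K2 add.assoc)
    then show ?thesis by (rule sums_unique[symmetric])
  qed
  have M2: "(\<Sum>i. \<beta> i * \<omega>b (k + i)) = - \<alpha> k" if "1 \<le> k" for k
  proof -
    have "n < n + int k" using that by simp
    from marchenko[OF ns(2) _ this, of snd] have "(\<lambda>i. \<beta> i * \<omega>b (k + i)) sums (- \<alpha> k)"
      by (simp add: \<beta>_def[symmetric] \<omega>b_def Ob KKb_eq[OF f(1)] K1 add.assoc)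
    then show ?thesis by (rule sums_unique[symmetric])
  qed
  have sc: "scrK a b n (n + int k) = (\<Sum>i. \<alpha> (k + i)) / (\<Sum>i. \<beta> (0 + i))" for k
    unfolding scrK_def K2 using K1[of "k + _"] by (simp add: add.assoc)
  have G: "GG a b (2 * n + int k) = (\<Sum>i. \<omega> (k + i))" for k by (simp add: GG_def \<omega>_def add.assoc)
  have Gb: "GGb a b (2 * n + int k) = (\<Sum>i. \<omega>b (k + i))" for k by (simp add: GGb_def \<omega>b_def add.assoc)
  have B0': "(\<Sum>i. \<beta> (0 + i)) \<noteq> 0"
    using B0 psi_coeff_props(4)[OF f(2), of 1 n] by (simp add: power_sum_def \<beta>_def)
  have a0: "\<alpha> 0 = 0" unfolding \<alpha>_def psi_coeff_0 by simp
  have i1: "n + 1 + int k + 1 = n + int (k + 2)" "n + 1 + int k = n + int (k + 1)" for k by auto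
  have i2: "n + int (k + 1) + (n + int (i + 1)) = 2 * n + int (k + i + 2)" for k i by auto
  have i3: "n + int (i + 1) + m = 2 * n + int (i + 1 + d)" "2 * n + int (i + 1 + d) - 1 = 2 * n + int (i + d)" "n + m = 2 * n + int d" for i
    using d by auto
  have "summable (\<lambda>i. norm (\<alpha> i))" unfolding \<alpha>_def by (rule psi_coeff_props(1)[OF f(1)])
  moreover have "summable (\<lambda>i. norm (\<beta> i))" unfolding \<beta>_def by (rule psi_coeff_props(2)[OF f(2)])
  moreover have "summable (\<lambda>i. norm (\<omega> i))" unfolding \<omega>_def by (rule Omega_summable[OF ns(1)])
  moreover have "summable (\<lambda>i. norm (\<omega>b i))" unfolding \<omega>b_def Ob by (rule Omega_summable[OF ns(2)])
  ultimately have *: "(\<Sum>i. \<alpha> (d + i)) / (\<Sum>i. \<beta> (0 + i)) + (\<Sum>i. \<omega>b (d + i)) + (\<Sum>i. \<Sum>k. ((\<Sum>i. \<alpha> (k + 2 + i)) / (\<Sum>i. \<beta> (0 + i)) - (\<Sum>i. \<alpha> (k + 1 + i)) / (\<Sum>i. \<beta> (0 + i)))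
      * (\<Sum>j. \<omega> (k + i + 2 + j)) * ((\<Sum>j. \<omega>b (i + 1 + d + j)) - (\<Sum>j. \<omega>b (i + d + j)))) = 0"
    by (rule summed_marchenko[OF _ _ _ _ M1 M2 a0 d(1) B0'])
  show ?thesis unfolding i1(1) unfolding i1(2) i2 i3 G Gb sc using * by (simp only: d(2) sc)
qed

subsection \<open>The potentials (u, v) and (p, s)\<close>

definition l1Z :: "(int \<Rightarrow> complex) \<Rightarrow> bool" where
  "l1Z f \<longleftrightarrow> (\<forall>n. summable (\<lambda>i. norm (f (n + int i)))) \<and> (\<forall>n. summable (\<lambda>i. norm (f (n - int i))))"

lemma l1Z_right_summable: "l1Z a \<Longrightarrow> l1Z b \<Longrightarrow> right_summable a b"
  by (simp add: l1Z_def right_summable_def)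

lemma l1Z_reflect: assumes "l1Z a" shows "l1Z (reflect a)"
proof -
  have "summable (\<lambda>i. norm (reflect a (n + int i)))" "summable (\<lambda>i. norm (reflect a (n - int i)))" for n
  proof -
    have "(\<lambda>i. norm (reflect a (n + int i))) = (\<lambda>i. norm (a ((- n - 1) - int i)))"
      "(\<lambda>i. norm (reflect a (n - int i))) = (\<lambda>i. norm (a ((- n - 1) + int i)))" by (auto simp: reflect_def algebra_simps)
    then show "summable (\<lambda>i. norm (reflect a (n + int i)))" "summable (\<lambda>i. norm (reflect a (n - int i)))"
      using assms by (simp_all add: l1Z_def)
  qed
  then show ?thesis by (simp add: l1Z_def)
qed

lemma l1Z_l1pair: "l1Z a \<Longrightarrow> l1Z b \<Longrightarrow> (\<And>n. 1 - a n * b n \<noteq> 0) \<Longrightarrow> l1pair a b"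
  by (simp add: l1pair_def l1Z_right_summable l1Z_reflect)

lemma l1Z_shift: assumes "l1Z f" shows "l1Z (\<lambda>n. f (n + 1))"
proof -
  have "(\<lambda>i. norm (f (n + int i + 1))) = (\<lambda>i. norm (f ((n + 1) + int i)))"
    "(\<lambda>i. norm (f (n - int i + 1))) = (\<lambda>i. norm (f ((n + 1) - int i)))" for n by (auto simp: algebra_simps)
  then show ?thesis using assms by (simp add: l1Z_def)
qed

lemma l1Z_add: assumes "l1Z f" "l1Z g" shows "l1Z (\<lambda>n. f n + g n)"
proof -
  have "summable (\<lambda>i. norm (f (k i) + g (k i)))" if "summable (\<lambda>i. norm (f (k i)))" "summable (\<lambda>i. norm (g (k i)))" for k :: "nat \<Rightarrow> int"
    by (rule summable_comparison_test'[OF summable_add[OF that], of 0]) (simp add: norm_triangle_ineq)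
  then show ?thesis using assms by (simp add: l1Z_def)
qed

lemma l1Z_minus: "l1Z f \<Longrightarrow> l1Z (\<lambda>n. - f n)" by (simp add: l1Z_def)

lemma l1Z_bounded_mult: assumes "l1Z f" "\<And>n. norm (g n) \<le> C" shows "l1Z (\<lambda>n. f n * g n)"
proof -
  have "summable (\<lambda>i. norm (f (k i) * g (k i)))" if "summable (\<lambda>i. norm (f (k i)))" for k :: "nat \<Rightarrow> int"
    by (rule summable_comparison_test'[OF summable_mult2[OF that, of C], of 0])
      (simp add: norm_mult mult_left_mono assms(2))
  then show ?thesis using assms(1) by (simp add: l1Z_def)
qed

lemma bounded_of_limits:
  fixes f :: "int \<Rightarrow> complex"
  assumes "(f \<longlongrightarrow> L1) at_bot" "(f \<longlongrightarrow> L2) at_top"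
  shows "\<exists>C. \<forall>n. norm (f n) \<le> C"
proof -
  have "eventually (\<lambda>n. norm (f n) < norm L1 + 1) at_bot" using order_tendstoD(2)[OF tendsto_norm[OF assms(1)]] by simp
  then obtain N1 where N1: "\<And>n. n \<le> N1 \<Longrightarrow> norm (f n) < norm L1 + 1" by (auto simp: eventually_at_bot_linorder)
  have "eventually (\<lambda>n. norm (f n) < norm L2 + 1) at_top" using order_tendstoD(2)[OF tendsto_norm[OF assms(2)]] by simp
  then obtain N2 where N2: "\<And>n. N2 \<le> n \<Longrightarrow> norm (f n) < norm L2 + 1" by (auto simp: eventually_at_top_linorder)
  define C where "C = Max (insert (norm L1 + 1) (insert (norm L2 + 1) ((\<lambda>n. norm (f n)) ` {N1..N2})))"
  have "norm (f n) \<le> C" for n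
  proof -
    have fin: "finite (insert (norm L1 + 1) (insert (norm L2 + 1) ((\<lambda>n. norm (f n)) ` {N1..N2})))" by simp
    consider "n \<le> N1" | "N2 \<le> n" | "n \<in> {N1..N2}" by force
    then show ?thesis
    proof cases
      case 1
      have "norm L1 + 1 \<le> C" unfolding C_def by (rule Max_ge[OF fin]) simp
      then show ?thesis using N1[OF 1] by simp
    next
      case 2
      have "norm L2 + 1 \<le> C" unfolding C_def by (rule Max_ge[OF fin]) simp
      then show ?thesis using N2[OF 2] by simp
    next
      case 3
      then show ?thesis unfolding C_def by (intro Max_ge[OF fin]) auto
    qed
  qed
  then show ?thesis by blast
qed

lemma tendsto_at_bot_int_of_summable: "l1Z f \<Longrightarrow> (f \<longlongrightarrow> 0) at_bot"
proof -
  assume f: "l1Z f"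
  have "(\<lambda>i. f (0 - int i)) \<longlonglongrightarrow> 0" 
    by (rule summable_LIMSEQ_zero, rule summable_norm_cancel) (rule f[unfolded l1Z_def, THEN conjunct2, THEN spec])
  then have "(\<lambda>i. f (- (0 + int i))) \<longlonglongrightarrow> 0" by simp
  then have "((\<lambda>n. f (- n)) \<longlongrightarrow> 0) at_top" by (rule tendsto_at_top_int[of "\<lambda>n. f (- n)"])
  then show ?thesis unfolding filterlim_at_bot_int .
qed

lemma tendsto_at_top_int_of_summable: assumes f: "l1Z f" shows "(f \<longlongrightarrow> 0) at_top"
  by (rule tendsto_at_top_int[of f 0], rule summable_LIMSEQ_zero, rule summable_norm_cancel)
    (rule f[unfolded l1Z_def, THEN conjunct1, THEN spec])

lemma l1Z_mult: assumes "l1Z f" "l1Z g" shows "l1Z (\<lambda>n. f n * g n)"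
proof -
  obtain C where "\<forall>n. norm (g n) \<le> C"
    using bounded_of_limits[OF tendsto_at_bot_int_of_summable[OF assms(2)] tendsto_at_top_int_of_summable[OF assms(2)]] by blast
  then show ?thesis by (intro l1Z_bounded_mult[OF assms(1)]) blast
qed

lemma l1Z_decay:
  assumes "((\<lambda>n. real_of_int \<bar>n\<bar> ^ 2 * cmod (q n)) \<longlongrightarrow> 0) at_top" "((\<lambda>n. real_of_int \<bar>n\<bar> ^ 2 * cmod (q n)) \<longlongrightarrow> 0) at_bot"
  shows "l1Z q"
proof -
  have *: "summable (\<lambda>i. norm (f (0 + int i)))"
    if "((\<lambda>n. real_of_int \<bar>n\<bar> ^ 2 * cmod (f n)) \<longlongrightarrow> 0) at_top" for f
  proof -
    have "(\<lambda>i. real_of_int \<bar>0 + int i\<bar> ^ 2 * cmod (f (0 + int i))) \<longlonglongrightarrow> 0" by (rule tendsto_at_top_intD[OF that])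
    then have "eventually (\<lambda>i. real i ^ 2 * cmod (f (int i)) < 1) sequentially" using order_tendstoD(2)[of _ 0 _ 1] by fastforce
    then have "eventually (\<lambda>i. norm (norm (f (0 + int i))) \<le> inverse (real i ^ 2)) sequentially"
      using eventually_gt_at_top[of 0] by eventually_elim (simp add: field_simps)
    then show ?thesis by (rule summable_comparison_test_ev) (rule inverse_power_summable, simp)
  qed
  have 1: "summable (\<lambda>i. norm (q (n + int i)))" for n
    by (rule summable_int_shift[OF *[OF assms(1)]])
  have "((\<lambda>n. real_of_int \<bar>n\<bar> ^ 2 * cmod (q (- n))) \<longlongrightarrow> 0) at_top" using assms(2) unfolding filterlim_at_bot_int by simp
  from summable_int_shift[OF *[OF this]]
  have "summable (\<lambda>i. norm (q (- (- n + int i))))" for n .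
  then have "summable (\<lambda>i. norm (q (n - int i)))" for n by simp
  with 1 show ?thesis by (simp add: l1Z_def)
qed

lemma left_prod_at_top:
  assumes f: "l1Z f" and nz: "\<And>n. 1 + f n \<noteq> 0"
  obtains L where "(left_prod f \<longlongrightarrow> L) at_top" "L \<noteq> 0"
proof -
  have b: "summable (\<lambda>i. norm (f (n - int i)))" for n using f by (simp add: l1Z_def)
  have *: "left_prod f (0 + int k) = left_prod f 0 * (\<Prod>i<k. 1 + f (1 + int i))" for k
  proof (induction k)
    case (Suc k)
    then show ?case using left_prod_step[OF b nz, of "1 + int k"] by (simp add: algebra_simps)
  qed simp
  have cp: "convergent_prod (\<lambda>i. 1 + f (1 + int i))"
    by (intro abs_convergent_prod_imp_convergent_prod summable_imp_abs_convergent_prod) (use f in \<open>simp add: l1Z_def\<close>)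
  have "(\<lambda>k. left_prod f (0 + int k)) \<longlonglongrightarrow> left_prod f 0 * (\<Prod>i. 1 + f (1 + int i))"
    unfolding * by (intro tendsto_intros) (use convergent_prod_LIMSEQ[OF cp] in \<open>simp add: LIMSEQ_lessThan_iff_atMost[symmetric]\<close>)
  from tendsto_at_top_int[OF this] have l: "(left_prod f \<longlongrightarrow> left_prod f 0 * (\<Prod>i. 1 + f (1 + int i))) at_top" .
  have "left_prod f 0 * (\<Prod>i. 1 + f (1 + int i)) \<noteq> 0"
    using left_prod_nonzero[OF b nz] prodinf_nonzero[OF cp] nz by simp
  with l show ?thesis by (rule that)
qed

text \<open>Both the product and its inverse converge at either end, the limits 1 and L being
  nonzero. Bounds on both are needed because the potentials contain quotients of D and E.\<close>

lemma left_prod_bounded: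
  assumes f: "l1Z f" and nz: "\<And>n. 1 + f n \<noteq> 0"
  shows "\<exists>C. \<forall>n. norm (left_prod f n) \<le> C \<and> norm (inverse (left_prod f n)) \<le> C"
proof -
  have b: "summable (\<lambda>i. norm (f (n - int i)))" for n using f by (simp add: l1Z_def)
  obtain L where L: "(left_prod f \<longlongrightarrow> L) at_top" "L \<noteq> 0" by (rule left_prod_at_top[OF f nz])
  note bot = left_prod_tendsto[OF b nz]
  obtain C1 where C1: "\<forall>n. norm (left_prod f n) \<le> C1" using bounded_of_limits[OF bot L(1)] by blast
  obtain C2 where C2: "\<forall>n. norm (inverse (left_prod f n)) \<le> C2"
    using bounded_of_limits[OF tendsto_inverse[OF bot] tendsto_inverse[OF L]] by auto
  show ?thesis by (rule exI[of _ "max C1 C2"]) (use C1 C2 in \<open>auto simp: le_max_iff_disj\<close>)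
qed

lemma psiF_circle_unique:
  assumes "right_summable a b" "norm z = 1" "is_sol a b Y z"
    "((\<lambda>n. fst (Y n z)) \<longlongrightarrow> 0) at_top" "((\<lambda>n. snd (Y n z) / z powi n) \<longlongrightarrow> 1) at_top"
  shows "Y n z = psiF a b n z"
  by (rule psi_circle_unique[OF assms(1-3) _ assms(4,5)])
    (use psiF_is_psi[OF assms(1)] assms(2) in \<open>auto simp: is_psi_def DI_def\<close>)

context
  fixes q r :: "int \<Rightarrow> complex"
  assumes q: "l1Z q" and r: "l1Z r" and nz1: "\<And>n. 1 - q n * r n \<noteq> 0" and nz2: "\<And>n. 1 + q n * r (n + 1) \<noteq> 0"
begin

lemma l1Z_qr: "l1Z (\<lambda>n. - (q n * r n))" and l1Z_qr_shift: "l1Z (\<lambda>n. q n * r (n + 1))"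
  by (intro l1Z_minus l1Z_mult q r l1Z_shift)+

lemma Dp_qr_step: "Dp q r (n + 1) = (1 - q (n + 1) * r (n + 1)) * Dp q r n"
  unfolding Dp_left_prod using left_prod_step[of "\<lambda>n. - (q n * r n)" "n + 1"] l1Z_qr nz1 by (simp add: l1Z_def)

lemma Ep_qr_step: "Ep q r n = (1 + q n * r (n + 1)) * Ep q r (n - 1)"
  unfolding Ep_left_prod by (rule left_prod_step) (use l1Z_qr_shift nz2 in \<open>auto simp: l1Z_def\<close>)

lemma Dp_qr_nonzero: "Dp q r n \<noteq> 0" unfolding Dp_left_prod by (rule left_prod_nonzero) (use l1Z_qr nz1 in \<open>auto simp: l1Z_def\<close>)
lemma Ep_qr_nonzero: "Ep q r n \<noteq> 0" unfolding Ep_left_prod by (rule left_prod_nonzero) (use l1Z_qr_shift nz2 in \<open>auto simp: l1Z_def\<close>)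

lemma Dp_qr_bounded: "\<exists>C. \<forall>n. norm (Dp q r n) \<le> C \<and> norm (inverse (Dp q r n)) \<le> C"
  unfolding Dp_left_prod by (rule left_prod_bounded[OF l1Z_qr]) (use nz1 in simp)

lemma Ep_qr_bounded: "\<exists>C. \<forall>n. norm (Ep q r n) \<le> C \<and> norm (inverse (Ep q r n)) \<le> C"
  unfolding Ep_left_prod by (rule left_prod_bounded[OF l1Z_qr_shift nz2])

lemma l1Z_quot:
  assumes f: "l1Z f" and g: "\<And>n. norm (g n) \<le> C" and h: "\<And>n. norm (inverse (h n)) \<le> C'"
  shows "l1Z (\<lambda>n. f n * g n / h n)"
  unfolding divide_inverse by (rule l1Z_bounded_mult[OF l1Z_bounded_mult[OF f g] h])

lemma pot_l1Z: "l1Z (pot_u q r)" "l1Z (pot_v q r)" "l1Z (pot_p q r)" "l1Z (pot_s q r)"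
proof -
  obtain C1 C2 where "\<forall>n. norm (Dp q r n) \<le> C1 \<and> norm (inverse (Dp q r n)) \<le> C1" "\<forall>n. norm (Ep q r n) \<le> C2 \<and> norm (inverse (Ep q r n)) \<le> C2"
    using Dp_qr_bounded Ep_qr_bounded by blast
  then have C: "\<And>n. norm (Dp q r n) \<le> C1" "\<And>n. norm (inverse (Dp q r n)) \<le> C1" "\<And>n. norm (Ep q r n) \<le> C2" "\<And>n. norm (inverse (Ep q r n)) \<le> C2"
    by blast+
  show "l1Z (pot_u q r)" unfolding pot_u_def[abs_def] by (rule l1Z_quot[OF q C(3) C(2)])
  have "l1Z (\<lambda>n. - r n + r (n + 1) + - (q n * r n * r (n + 1)))"
    by (intro l1Z_add l1Z_minus l1Z_mult l1Z_shift q r)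
  then have "l1Z (\<lambda>n. - r n + r (n + 1) - q n * r n * r (n + 1))" by simp
  then show "l1Z (pot_v q r)" unfolding pot_v_def[abs_def] by (rule l1Z_quot[OF _ C(1) C(4)])
  have "l1Z (\<lambda>n. q n + - q (n + 1) + - (q n * q (n + 1) * r (n + 1)))"
    by (intro l1Z_add l1Z_minus l1Z_mult l1Z_shift q r)
  then have "l1Z (\<lambda>n. q n - q (n + 1) - q n * q (n + 1) * r (n + 1))" by simp
  then show "l1Z (pot_p q r)" unfolding pot_p_def[abs_def] by (rule l1Z_quot[OF _ C(3) C(2)])
  show "l1Z (pot_s q r)" unfolding pot_s_def[abs_def] by (rule l1Z_quot[OF l1Z_shift[OF r] C(1) C(4)])
qed

text \<open>In u n * v n the products D and E cancel except for one factor each, and 1 - u n * v n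
  comes out as the reciprocal of (1 - q n * r n) * (1 + q n * r (n + 1)).\<close>

lemma pot_uv_nonzero: "1 - pot_u q r n * pot_v q r n \<noteq> 0"
proof -
  have dn: "Dp q r n = (1 - q n * r n) * Dp q r (n - 1)" using Dp_qr_step[of "n - 1"] by simp
  have "(1 - pot_u q r n * pot_v q r n) * ((1 - q n * r n) * (1 + q n * r (n + 1))) = 1"
    unfolding pot_u_def pot_v_def dn Ep_qr_step[of n] using nz1[of n] nz2[of n] Dp_qr_nonzero[of "n - 1"] Ep_qr_nonzero[of "n - 1"]
    by (simp add: divide_simps) (simp add: algebra_simps)
  then show ?thesis by auto
qed

text \<open>As for (u, v), but the surviving D factor sits at n + 1.\<close>

lemma pot_ps_nonzero: "1 - pot_p q r n * pot_s q r n \<noteq> 0"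
proof -
  have "(1 - pot_p q r n * pot_s q r n) * ((1 - q (n + 1) * r (n + 1)) * (1 + q n * r (n + 1))) = 1"
    unfolding pot_p_def pot_s_def Dp_qr_step[of n] Ep_qr_step[of n] using nz1[of "n + 1"] nz2[of n] Dp_qr_nonzero[of n] Ep_qr_nonzero[of "n - 1"]
    by (simp add: divide_simps) (simp add: algebra_simps)
  then show ?thesis by auto
qed

lemma pot_uv_l1pair: "l1pair (pot_u q r) (pot_v q r)" and pot_ps_l1pair: "l1pair (pot_p q r) (pot_s q r)"
  by (intro l1Z_l1pair pot_l1Z pot_uv_nonzero pot_ps_nonzero)+

lemma Ep_qr_limit: obtains L where "((\<lambda>n. Ep q r (n - 1)) \<longlongrightarrow> L) at_top" "L \<noteq> 0"
proof -
  obtain L where L: "(Ep q r \<longlongrightarrow> L) at_top" "L \<noteq> 0" unfolding Ep_left_prod by (rule left_prod_at_top[OF l1Z_qr_shift nz2])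
  have "(\<lambda>k. Ep q r ((1 + int k) - 1)) \<longlonglongrightarrow> L" using tendsto_at_top_intD[OF L(1), of 0] by simp
  then have "((\<lambda>n. Ep q r (n - 1)) \<longlongrightarrow> L) at_top" by (rule tendsto_at_top_int[of "\<lambda>n. Ep q r (n - 1)"])
  then show ?thesis using L(2) by (rule that)
qed

lemma Dp_qr_limit: obtains L where "(Dp q r \<longlongrightarrow> L) at_top" "L \<noteq> 0"
proof (rule left_prod_at_top[OF l1Z_qr])
  show "1 + - (q n * r n) \<noteq> 0" for n using nz1 by simp
qed (use that in \<open>simp add: Dp_left_prod\<close>)

lemma l1Z_bounded_mult_tendsto: assumes "l1Z f" "\<And>n. norm (g n) \<le> C" shows "((\<lambda>n. f n * g n) \<longlongrightarrow> 0) at_top"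
  by (rule tendsto_at_top_int_of_summable[OF l1Z_bounded_mult[OF assms]])

text \<open>At \<open>z = 1\<close> the system for (v, u) is solved by \<open>(- r n * Dp q r (n - 1), Ep q r (n - 1))\<close> and
  the one for (p, s) by \<open>(q n * Ep q r (n - 1), Dp q r n)\<close>, up to normalisation.\<close>

lemma pot_uv_JP_1: "JP (pot_v q r) (pot_u q r) n 1 \<noteq> 0"
proof -
  let ?u = "pot_u q r" and ?v = "pot_v q r"
  obtain L where L: "((\<lambda>n. Ep q r (n - 1)) \<longlongrightarrow> L) at_top" "L \<noteq> 0" by (rule Ep_qr_limit)
  obtain C where C: "\<forall>n. norm (Dp q r n) \<le> C" using Dp_qr_bounded by blast
  \<comment> \<open>The argument z is a dummy, as Y solves the system at z = 1 only. Division by L,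
    the limit of E at +infinity, produces the normalisation of psi.\<close>
  define Y :: "int \<Rightarrow> complex \<Rightarrow> complex \<times> complex" where "Y n z = (- r n * Dp q r (n - 1) / L, Ep q r (n - 1) / L)" for n z
  have sol: "is_sol ?v ?u Y 1" unfolding is_sol_def
  proof
    fix n :: int
    have dn: "Dp q r n = (1 - q n * r n) * Dp q r (n - 1)" using Dp_qr_step[of "n - 1"] by simp
    have e: "n + 1 - 1 = n" by simp
    have "- r n * Dp q r (n - 1) / L = - r (n + 1) * Dp q r n / L + ?v n * (Ep q r n / L)"
      unfolding pot_v_def dn Ep_qr_step[of n] using nz2[of n] Ep_qr_nonzero[of "n - 1"] L(2) by (simp add: divide_simps) (simp add: algebra_simps)
    moreover have "Ep q r (n - 1) / L = ?u n * (- r (n + 1) * Dp q r n / L) + Ep q r n / L"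
      unfolding pot_u_def Ep_qr_step[of n] using Dp_qr_nonzero[of n] L(2) by (simp add: divide_simps) (simp add: algebra_simps)
    ultimately show "Y n 1 = (1 * fst (Y (n + 1) 1) + 1 * ?v n * snd (Y (n + 1) 1), ?u n * fst (Y (n + 1) 1) / 1 + snd (Y (n + 1) 1) / 1)"
      unfolding Y_def e by simp
  qed
  have "((\<lambda>n. - r n * Dp q r (n - 1)) \<longlongrightarrow> 0) at_top"
    by (rule l1Z_bounded_mult_tendsto[OF l1Z_minus[OF r]]) (use C in blast)
  from tendsto_divide[OF this tendsto_const L(2)] have 1: "((\<lambda>n. fst (Y n 1)) \<longlongrightarrow> 0) at_top" by (simp add: Y_def)
  from tendsto_divide[OF L(1) tendsto_const L(2)] L(2) have 2: "((\<lambda>n. snd (Y n 1) / 1 powi n) \<longlongrightarrow> 1) at_top" by (simp add: Y_def)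
  have "Y n 1 = psiF ?v ?u n 1"
    using psiF_circle_unique[OF l1pair_summable(2)[OF pot_uv_l1pair] _ sol 1 2, of n] by simp
  then have "snd (Y n 1) = JP ?v ?u n 1" by (simp add: psiF_def DI_def)
  then show ?thesis using Ep_qr_nonzero[of "n - 1"] L(2) by (auto simp: Y_def)
qed

text \<open>Needed for (p, s) itself and not for the swapped pair, because the second equation
  arises from \<open>summed_marchenko_scrK\<close> applied to (s, p).\<close>

lemma pot_ps_JP_1: "JP (pot_p q r) (pot_s q r) n 1 \<noteq> 0"
proof -
  let ?p = "pot_p q r" and ?s = "pot_s q r"
  obtain L where L: "(Dp q r \<longlongrightarrow> L) at_top" "L \<noteq> 0" by (rule Dp_qr_limit)
  obtain C where C: "\<forall>n. norm (Ep q r n) \<le> C" using Ep_qr_bounded by blast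
  define Y :: "int \<Rightarrow> complex \<Rightarrow> complex \<times> complex" where "Y n z = (q n * Ep q r (n - 1) / L, Dp q r n / L)" for n z
  have sol: "is_sol ?p ?s Y 1" unfolding is_sol_def
  proof
    fix n :: int
    have e: "n + 1 - 1 = n" by simp
    have "q n * Ep q r (n - 1) / L = q (n + 1) * Ep q r n / L + ?p n * (Dp q r (n + 1) / L)"
      unfolding pot_p_def Ep_qr_step[of n] using Dp_qr_nonzero[of "n + 1"] L(2) by (simp add: divide_simps) (simp add: algebra_simps)
    moreover have "Dp q r n / L = ?s n * (q (n + 1) * Ep q r n / L) + Dp q r (n + 1) / L"
      unfolding pot_s_def Dp_qr_step[of n] using Ep_qr_nonzero[of n] L(2) by (simp add: divide_simps) (simp add: algebra_simps)
    ultimately show "Y n 1 = (1 * fst (Y (n + 1) 1) + 1 * ?p n * snd (Y (n + 1) 1), ?s n * fst (Y (n + 1) 1) / 1 + snd (Y (n + 1) 1) / 1)"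
      unfolding Y_def e by simp
  qed
  have "((\<lambda>n. q n * Ep q r (n - 1)) \<longlongrightarrow> 0) at_top"
    by (rule l1Z_bounded_mult_tendsto[OF q]) (use C in blast)
  from tendsto_divide[OF this tendsto_const L(2)] have 1: "((\<lambda>n. fst (Y n 1)) \<longlongrightarrow> 0) at_top" by (simp add: Y_def)
  from tendsto_divide[OF L(1) tendsto_const L(2)] L(2) have 2: "((\<lambda>n. snd (Y n 1) / 1 powi n) \<longlongrightarrow> 1) at_top" by (simp add: Y_def)
  have "Y n 1 = psiF ?p ?s n 1"
    using psiF_circle_unique[OF l1pair_summable(1)[OF pot_ps_l1pair] _ sol 1 2, of n] by simp
  then have "snd (Y n 1) = JP ?p ?s n 1" by (simp add: psiF_def DI_def)
  then show ?thesis using Dp_qr_nonzero[of n] L(2) by (auto simp: Y_def)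
qed

end

text \<open>The barred quantities of (a, b) at z are the unbarred ones of (b, a) at 1/z, so the
  hypotheses on both kinds of data amount to nonsingularity of both orders of the pair.\<close>

lemma nonsingI:
  assumes ab: "l1pair a b" and fin: "finite (poles a b)" "finite (polesb a b)"
    and T: "\<And>z. norm z = 1 \<Longrightarrow> inv_Tr a b z \<noteq> 0 \<and> inv_Trb a b z \<noteq> 0"
  shows "nonsing a b" "nonsing b a"
proof -
  show "nonsing a b" using assms by (simp add: nonsing_def)
  have "inj_on inverse (poles b a)" by (auto intro: inj_onI)
  then have "finite (poles b a)" using fin(2) unfolding polesb_eq[OF ab] by (rule finite_imageD[rotated])
  moreover have "inv_Tr b a z \<noteq> 0" if "norm z = 1" for z
    using T[of "inverse z"] that inv_Trb_eq[OF ab, of "inverse z"] by (simp add: norm_inverse)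
  ultimately show "nonsing b a" using ab l1pair_commute by (auto simp: nonsing_def)
qed

text \<open>Translates the first summed equation for (b, a) into the second one for (a, b), so that
  only one of them has to be derived.\<close>

lemma swapped_data:
  assumes "nonsing a b" "nonsing b a"
  shows "scrKb a b = scrK b a" "GG a b = GGb b a" "GGb a b = GG b a"
proof -
  have ab: "l1pair a b" "l1pair b a" and f: "right_summable a b" "right_summable b a"
    using assms l1pair_summable[of a b] by (auto simp: nonsing_def)
  have fin: "finite (polesb a b)" "finite (polesb b a)"
    using assms unfolding polesb_eq[OF ab(1)] polesb_eq[OF ab(2)] by (auto simp: nonsing_def)
  show "scrKb a b = scrK b a" by (simp add: fun_eq_iff scrKb_def scrK_def KKb_eq[OF f(1)] KKb_eq[OF f(2)])
  show "GG a b = GGb b a" by (simp add: fun_eq_iff GG_def GGb_def Omegab_eq[OF ab(2) fin(2)])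
  show "GGb a b = GG b a" by (simp add: fun_eq_iff GG_def GGb_def Omegab_eq[OF ab(1) fin(1)])
qed

theorem theorem7p1:
  fixes q r :: "int \<Rightarrow> complex"
  assumes decay_q: "\<And>k::nat. ((\<lambda>n. real_of_int \<bar>n\<bar> ^ k * cmod (q n)) \<longlongrightarrow> 0) at_top"
                   "\<And>k::nat. ((\<lambda>n. real_of_int \<bar>n\<bar> ^ k * cmod (q n)) \<longlongrightarrow> 0) at_bot"
      and decay_r: "\<And>k::nat. ((\<lambda>n. real_of_int \<bar>n\<bar> ^ k * cmod (r n)) \<longlongrightarrow> 0) at_top"
                   "\<And>k::nat. ((\<lambda>n. real_of_int \<bar>n\<bar> ^ k * cmod (r n)) \<longlongrightarrow> 0) at_bot"
      and nz1: "\<And>n. 1 - q n * r n \<noteq> 0"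
      and nz2: "\<And>n. 1 + q n * r (n + 1) \<noteq> 0"
      and fin_uv: "finite (poles (pot_u q r) (pot_v q r))" "finite (polesb (pot_u q r) (pot_v q r))"
      and fin_ps: "finite (poles (pot_p q r) (pot_s q r))" "finite (polesb (pot_p q r) (pot_s q r))"
      and Tdef: "\<And>z. norm z = 1 \<Longrightarrow> inv_Tr (pot_u q r) (pot_v q r) z \<noteq> 0 \<and> inv_Trb (pot_u q r) (pot_v q r) z \<noteq> 0
                     \<and> inv_Tr (pot_p q r) (pot_s q r) z \<noteq> 0 \<and> inv_Trb (pot_p q r) (pot_s q r) z \<noteq> 0"
      and mn: "m > n"
  shows "(scrK (pot_u q r) (pot_v q r) n m + GGb (pot_u q r) (pot_v q r) (n + m)
           + (\<Sum>i. \<Sum>k. (scrK (pot_u q r) (pot_v q r) n (n + 1 + int k + 1)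
                         - scrK (pot_u q r) (pot_v q r) n (n + 1 + int k))
                        * GG (pot_u q r) (pot_v q r) ((n + 1 + int k) + (n + 1 + int i))
                        * (GGb (pot_u q r) (pot_v q r) ((n + 1 + int i) + m)
                           - GGb (pot_u q r) (pot_v q r) ((n + 1 + int i) + m - 1))) = 0)
       \<and> ( scrKb (pot_p q r) (pot_s q r) n m + GG (pot_p q r) (pot_s q r) (n + m)
           + (\<Sum>i. \<Sum>k. (scrKb (pot_p q r) (pot_s q r) n (n + 1 + int k + 1)
                         - scrKb (pot_p q r) (pot_s q r) n (n + 1 + int k))
                        * GGb (pot_p q r) (pot_s q r) ((n + 1 + int k) + (n + 1 + int i))
                        * (GG (pot_p q r) (pot_s q r) ((n + 1 + int i) + m)
                           - GG (pot_p q r) (pot_s q r) ((n + 1 + int i) + m - 1))) = 0)"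
proof -
  let ?u = "pot_u q r" and ?v = "pot_v q r" and ?p = "pot_p q r" and ?s = "pot_s q r"
  have q: "l1Z q" and r: "l1Z r"
    using l1Z_decay[OF decay_q] l1Z_decay[OF decay_r] by blast+
  note uv = pot_uv_l1pair[OF q r nz1 nz2] and ps = pot_ps_l1pair[OF q r nz1 nz2]
  have ns_uv: "nonsing ?u ?v" "nonsing ?v ?u"
    by (rule nonsingI[OF uv fin_uv], use Tdef in blast)+
  have ns_ps: "nonsing ?p ?s" "nonsing ?s ?p"
    by (rule nonsingI[OF ps fin_ps], use Tdef in blast)+
  show ?thesis
    \<comment> \<open>The second conjunct is the instance a = s, b = p, rewritten by
      \<open>swapped_data\<close>.\<close>
    using summed_marchenko_scrK[OF ns_uv pot_uv_JP_1[OF q r nz1 nz2] mn]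
      summed_marchenko_scrK[OF ns_ps(2,1) pot_ps_JP_1[OF q r nz1 nz2] mn]
    unfolding swapped_data[OF ns_ps] by (rule conjI)
qed

end
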